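(* Let $p>1$. There is a constant $C$ (depending at most on $p$) such that for every time interval $I\subset\mathbb R$ and every $H^{1}$ solution $u$ on the spacetime slab $I\times\mathbb R$ of the one-dimensional defocusing nonlinear Schr\"odinger equation $$iu_t+u_{xx}-|u|^{p-1}u=0,$$ one has $$\big\|\partial_x(|u|^2)\big\|_{L^2_tL^2_x(I\times\mathbb R)}\le C\,\|u\|_{L^\infty_t\dot H^1_x(I\times\mathbb R)}^{1/2}\,\|u\|_{L^\infty_tL^2_x(I\times\mathbb R)}^{3/2}$$ and $$\|u\|_{L^{p+3}_tL^{p+3}_x(I\times\mathbb R)}^{p+3}\le C\,\|u\|_{L^\infty_tL^2_x(I\times\mathbb R)}^{3}\,\|u\|_{L^\infty_t\dot H^1_x(I\times\mathbb R)}.$$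
   Context: $\|f\|_{\dot H^s_x}=\||\nabla|^sf\|_{L^2_x}$, where $\widehat{|\nabla|^s f}(\xi)=|\xi|^s\hat f(\xi)$. $L^q_tL^r_x(I\times\mathbb R)$ is the mixed norm $\big(\int_I\|u(t)\|_{L^r_x}^q\,dt\big)^{1/q}$, with the usual modification for $q=\infty$. An $H^1$ solution on $I\times\mathbb R$ is a solution $u\in C(I;H^1_x(\mathbb R))$ (in the sense of Duhamel's formula) belonging to the class in which the equation is locally well-posed in $H^1$; in particular it is a limit of smooth solutions. *)

theory Defs
  imports "HOL-Probability.Essential_Supremum"
begin

section \<open>Lebesgue norms\<close>

text \<open>All norms take values in \<^typ>\<open>ennreal\<close>. The exponent \<open>a\<close> below is meant to be positive.\<close>

definition ennreal_pow :: "ennreal \<Rightarrow> real \<Rightarrow> ennreal" (infixr "epowr" 80) where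
  "x epowr a = (if x = \<infinity> then \<infinity> else ennreal (enn2real x powr a))"

definition Lp_norm :: "ennreal \<Rightarrow> 'a measure \<Rightarrow> ('a \<Rightarrow> ennreal) \<Rightarrow> ennreal" where
  "Lp_norm q M f =
     (if q = \<infinity> then esssup M f
      else (\<integral>\<^sup>+ x. f x epowr enn2real q \<partial>M) epowr (1 / enn2real q))"

definition Lx_norm :: "ennreal \<Rightarrow> (real \<Rightarrow> 'b::real_normed_vector) \<Rightarrow> ennreal" where
  "Lx_norm r f = Lp_norm r lborel (\<lambda>x. ennreal (norm (f x)))"

text \<open>A time-dependent function is \<open>u t x\<close>; \<open>Lt_norm q I N\<close> is the \<open>L\<^sup>q\<close> norm in time over \<open>I\<close>
  of a scalar quantity \<open>N t\<close>, typically the norm of \<open>u t\<close> in some space of functions of \<open>x\<close>.\<close>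

definition Lt_norm :: "ennreal \<Rightarrow> real set \<Rightarrow> (real \<Rightarrow> ennreal) \<Rightarrow> ennreal" where
  "Lt_norm q I N = Lp_norm q (restrict_space lborel I) N"

definition mixed_norm ::
    "ennreal \<Rightarrow> ennreal \<Rightarrow> real set \<Rightarrow> (real \<Rightarrow> real \<Rightarrow> 'b::real_normed_vector) \<Rightarrow> ennreal" where
  "mixed_norm q r I u = Lt_norm q I (\<lambda>t. Lx_norm r (u t))"

section \<open>Fourier transform and multipliers on \<open>L\<^sup>2(\<real>)\<close>\<close>

definition L2 :: "(real \<Rightarrow> complex) set" where
  "L2 = {f \<in> borel_measurable lborel. Lx_norm 2 f < \<infinity>}"

text \<open>The Fourier--Plancherel transform, as the \<open>L\<^sup>2\<close> limit of the truncated Fourier integrals,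
  in the unitary normalisation \<open>(2\<pi>)\<^sup>-\<^sup>1\<^sup>/\<^sup>2 \<integral> e\<^sup>-\<^sup>i\<^sup>x\<^sup>\<xi> f(x) dx\<close>. Elements of \<^term>\<open>L2\<close> are
  representatives of classes modulo null sets, so the transform is a relation.\<close>

definition has_fourier :: "(real \<Rightarrow> complex) \<Rightarrow> (real \<Rightarrow> complex) \<Rightarrow> bool" where
  "has_fourier f F \<longleftrightarrow> f \<in> L2 \<and> F \<in> L2 \<and>
     ((\<lambda>R. Lx_norm 2 (\<lambda>\<xi>. F \<xi> -
         complex_of_real (1 / sqrt (2 * pi)) * (LINT x:{-R..R}|lborel. cis (- (x * \<xi>)) * f x)))
       \<longlongrightarrow> 0) at_top"

definition has_fourier_multiplier ::
    "(real \<Rightarrow> complex) \<Rightarrow> (real \<Rightarrow> complex) \<Rightarrow> (real \<Rightarrow> complex) \<Rightarrow> bool" where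
  "has_fourier_multiplier m f g \<longleftrightarrow>
     (\<exists>F G. has_fourier f F \<and> has_fourier g G \<and> (AE \<xi> in lborel. G \<xi> = m \<xi> * F \<xi>))"

definition fourier_multiplier :: "(real \<Rightarrow> complex) \<Rightarrow> (real \<Rightarrow> complex) \<Rightarrow> (real \<Rightarrow> complex)" where
  "fourier_multiplier m f = (SOME g. has_fourier_multiplier m f g)"

text \<open>For \<open>f\<close> in \<^term>\<open>L2\<close>, this is infinite exactly if \<open>m\<close> times the transform of \<open>f\<close> is not
  square integrable.\<close>

definition multiplier_norm :: "(real \<Rightarrow> complex) \<Rightarrow> (real \<Rightarrow> complex) \<Rightarrow> ennreal" where
  "multiplier_norm m f =
     (if \<exists>g. has_fourier_multiplier m f g then Lx_norm 2 (fourier_multiplier m f) else \<infinity>)"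

definition Hdot_norm :: "real \<Rightarrow> (real \<Rightarrow> complex) \<Rightarrow> ennreal" where
  "Hdot_norm s f = multiplier_norm (\<lambda>\<xi>. complex_of_real (\<bar>\<xi>\<bar> powr s)) f"

definition H_norm :: "real \<Rightarrow> (real \<Rightarrow> complex) \<Rightarrow> ennreal" where
  "H_norm s f = multiplier_norm (\<lambda>\<xi>. complex_of_real ((1 + \<xi>\<^sup>2) powr (s / 2))) f"

text \<open>The free propagator \<open>e\<^sup>i\<^sup>t\<^sup>\<partial>\<^sup>x\<^sup>x\<close>.\<close>

definition schroedinger :: "real \<Rightarrow> (real \<Rightarrow> complex) \<Rightarrow> (real \<Rightarrow> complex)" where
  "schroedinger t f = fourier_multiplier (\<lambda>\<xi>. cis (- (t * \<xi>\<^sup>2))) f"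

section \<open>Solutions of the nonlinear equation\<close>

text \<open>\<open>has_L2_integral v w a b\<close> says that \<open>w\<close> is the oriented integral of the \<open>L\<^sup>2\<close>-valued curve
  \<open>v\<close> from \<open>a\<close> to \<open>b\<close>. The definition is the library's \<open>has_integral\<close> unfolded on a compact
  interval, with the \<open>L\<^sup>2\<close> seminorm on representatives in place of the norm of the target space.\<close>

definition has_L2_integral_on ::
    "(real \<Rightarrow> real \<Rightarrow> complex) \<Rightarrow> (real \<Rightarrow> complex) \<Rightarrow> real \<Rightarrow> real \<Rightarrow> bool" where
  "has_L2_integral_on v w a b \<longleftrightarrow> w \<in> L2 \<and>
     (\<forall>e>0. \<exists>\<gamma>. gauge \<gamma> \<and>
        (\<forall>D. D tagged_division_of {a..b} \<and> \<gamma> fine D \<longrightarrow>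
           Lx_norm 2 (\<lambda>x. (\<Sum>(s, K)\<in>D. measure lborel K *\<^sub>R v s x) - w x) < ennreal e))"

definition has_L2_integral ::
    "(real \<Rightarrow> real \<Rightarrow> complex) \<Rightarrow> (real \<Rightarrow> complex) \<Rightarrow> real \<Rightarrow> real \<Rightarrow> bool" where
  "has_L2_integral v w a b \<longleftrightarrow>
     (if a \<le> b then has_L2_integral_on v w a b else has_L2_integral_on v (\<lambda>x. - w x) b a)"

definition nonlinearity :: "real \<Rightarrow> (real \<Rightarrow> complex) \<Rightarrow> (real \<Rightarrow> complex)" where
  "nonlinearity p f = (\<lambda>x. complex_of_real (cmod (f x) powr (p - 1)) * f x)"

definition C_H1 :: "real set \<Rightarrow> (real \<Rightarrow> real \<Rightarrow> complex) \<Rightarrow> bool" where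
  "C_H1 I u \<longleftrightarrow> (\<forall>t\<in>I. H_norm 1 (u t) < \<infinity>) \<and>
     (\<forall>t\<in>I. ((\<lambda>s. H_norm 1 (\<lambda>x. u s x - u t x)) \<longlongrightarrow> 0) (at t within I))"

text \<open>Duhamel's formula for \<open>i u\<^sub>t + u\<^sub>x\<^sub>x = |u|\<^sup>p\<^sup>-\<^sup>1 u\<close>:
  \<open>u(t) = e\<^sup>i\<^sup>(\<^sup>t\<^sup>-\<^sup>t\<^sup>0\<^sup>)\<^sup>\<partial>\<^sup>x\<^sup>x u(t\<^sub>0) - i \<integral> e\<^sup>i\<^sup>(\<^sup>t\<^sup>-\<^sup>s\<^sup>)\<^sup>\<partial>\<^sup>x\<^sup>x (|u|\<^sup>p\<^sup>-\<^sup>1 u)(s) ds\<close>, the integral running from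
  \<open>t\<^sub>0\<close> to \<open>t\<close>. In one space dimension the local well-posedness class in \<open>H\<^sup>1\<close> is the whole of
  \<open>C(I; H\<^sup>1)\<close>, since \<open>H\<^sup>1\<close> embeds in \<open>L\<^sup>\<infinity>\<close>; no auxiliary space is imposed.\<close>

definition H1_solution :: "real \<Rightarrow> real set \<Rightarrow> (real \<Rightarrow> real \<Rightarrow> complex) \<Rightarrow> bool" where
  "H1_solution p I u \<longleftrightarrow> C_H1 I u \<and>
     (\<forall>t0\<in>I. \<forall>t\<in>I. \<exists>w.
        has_L2_integral (\<lambda>s. schroedinger (t - s) (nonlinearity p (u s))) w t0 t \<and>
        (AE x in lborel. u t x = schroedinger (t - t0) (u t0) x - \<i> * w x))"

section \<open>Weak derivatives\<close>

definition test_function :: "(real \<Rightarrow> real) \<Rightarrow> bool" where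
  "test_function \<phi> \<longleftrightarrow>
     (\<forall>n. (deriv ^^ n) \<phi> differentiable_on UNIV) \<and> (\<exists>R. \<forall>x. R < \<bar>x\<bar> \<longrightarrow> \<phi> x = 0)"

definition locally_integrable :: "(real \<Rightarrow> real) \<Rightarrow> bool" where
  "locally_integrable f \<longleftrightarrow> (\<forall>a b. set_integrable lborel {a..b} f)"

definition has_weak_deriv :: "(real \<Rightarrow> real) \<Rightarrow> (real \<Rightarrow> real) \<Rightarrow> bool" where
  "has_weak_deriv f g \<longleftrightarrow> locally_integrable f \<and> locally_integrable g \<and>
     (\<forall>\<phi>. test_function \<phi> \<longrightarrow>
        (LINT x|lborel. f x * deriv \<phi> x) = - (LINT x|lborel. g x * \<phi> x))"

text \<open>Determined up to null sets when it exists, as it does for \<open>|f|\<^sup>2\<close> with \<open>f\<close> in \<open>H\<^sup>1\<close>.\<close>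

definition weak_deriv :: "(real \<Rightarrow> real) \<Rightarrow> (real \<Rightarrow> real)" where
  "weak_deriv f = (SOME g. has_weak_deriv f g)"

end

theory Submission
  imports Defs "HOL-Probability.Characteristic_Functions" "HOL-Probability.Sinc_Integral" "HOL-Computational_Algebra.Polynomial"
begin

text \<open>
  The theorem is the one-dimensional interaction Morawetz estimate. For a function \<open>V\<close> on the line with mass
  density \<open>m = |V|\<^sup>2\<close> and momentum density \<open>j = Im (cnj V V\<^sub>x)\<close> consider the action \<open>M(V)\<close>, the double
  integral of \<open>m(y) sgn(x - y) j(x)\<close>. The kernel is bounded, so Cauchy--Schwarz bounds the action by
  \<open>||V||\<^sup>3 ||V\<^sub>x||\<close> (\<open>morawetz_bound\<close>). Along a solution of \<open>\<i> V\<^sub>t + V\<^sub>x\<^sub>x = G\<close> the time derivatives of \<open>m\<close>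
  and \<open>j\<close> are, apart from \<open>G\<close>, spatial derivatives of \<open>- 2 j\<close> and of \<open>m\<^sub>x\<^sub>x / 2 - 2 |V\<^sub>x|\<^sup>2\<close>. Since the sign
  function differentiates to twice the Dirac mass, the double integrals in \<open>dM/dt\<close> collapse to the integral of
  \<open>4 (m |V\<^sub>x|\<^sup>2 - j\<^sup>2) + m\<^sub>x\<^sup>2\<close>, and \<open>m |V\<^sub>x|\<^sup>2 = j\<^sup>2 + m\<^sub>x\<^sup>2 / 4\<close> turns this into the integral of
  \<open>2 m\<^sub>x\<^sup>2\<close> (\<open>morawetz_virial\<close>). For \<open>G = |V|\<^bsup>p-1\<^esup> V\<close> the remaining terms are a positive multiple of the
  integral of \<open>|V|\<^bsup>p+3\<^esup>\<close> (\<open>forcing_nonlinearity\<close>). So \<open>M\<close> is increasing, and integrating \<open>dM/dt\<close> in time bounds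
  both space-time integrals of the theorem by \<open>2 sup ||u||\<^sup>3 ||u\<^sub>x||\<close>.

  An H1 solution is not regular enough for this computation, so it is carried out for \<open>V\<^sub>N(t)\<close>, obtained from
  \<open>u(t)\<close> by cutting off all frequencies above \<open>N\<close>. This function is smooth in space, and Duhamel's formula
  makes it differentiable in time as a curve in L2 (\<open>lowpass_time_derivative\<close>). That this notion of
  differentiability suffices for the action rests on an integration by parts (\<open>morawetz_diff\<close>). The function \<open>V\<^sub>N\<close>
  solves the equation up to the commutator of the cutoff with the nonlinearity. The commutator tends to 0 in L2 and is
  bounded in terms of the H1 norm, hence locally uniformly in time, so dominated convergence in time removes the
  cutoff (\<open>virial_estimate\<close>).

  The definitions refer to the Fourier--Plancherel transform as a relation, so the Plancherel theorem comes first.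
  The isometry follows from Gaussian regularisation and the continuity of translations in L1
  (\<open>Plancherel_bounded\<close>, \<open>Plancherel_L1_L2\<close>), existence of the transform from completeness of L2, and surjectivity
  from the multiplication formula (\<open>has_fourier_cnj_inverse\<close>). At the end, the weak derivative of \<open>|u|\<^sup>2\<close> is
  identified by testing with explicit bump functions (\<open>weak_deriv_mass\<close>), and the passage from pairs of times to the
  essential suprema over the whole interval uses that almost every time is an admissible end point
  (\<open>virial_space_time_bound\<close>).
\<close>

section \<open>Square-integrable functions\<close>

text \<open>The real-valued form of the L2 norm. Where the square of the modulus is not integrable
  its value is the default 0, so membership in \<open>L2\<close> is always tracked
  separately.\<close>
definition nrm :: "(real \<Rightarrow> complex) \<Rightarrow> real" where
  "nrm f = sqrt (LINT x|lborel. (cmod (f x))\<^sup>2)"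

lemma ennreal_epowr: "0 \<le> a \<Longrightarrow> ennreal a epowr r = ennreal (a powr r)"
  by (simp add: ennreal_pow_def)

lemma ennreal_epowr_2: "0 \<le> a \<Longrightarrow> ennreal a epowr 2 = ennreal (a\<^sup>2)"
  by (simp add: ennreal_epowr powr_numeral)

lemma Lx_norm_2: "Lx_norm 2 f = (\<integral>\<^sup>+x. ennreal ((cmod (f x))\<^sup>2) \<partial>lborel) epowr (1/2)"
  by (simp add: Lx_norm_def Lp_norm_def ennreal_epowr_2 enn2real_numeral)

lemma measurable_cnj [measurable]: "cnj \<in> borel_measurable borel"
  by (intro borel_measurable_continuous_onI continuous_intros)

lemma L2_iff: "f \<in> L2 \<longleftrightarrow> f \<in> borel_measurable borel \<and> integrable lborel (\<lambda>x. (cmod (f x))\<^sup>2)"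
proof -
  have "Lx_norm 2 f < \<infinity> \<longleftrightarrow> (\<integral>\<^sup>+x. ennreal ((cmod (f x))\<^sup>2) \<partial>lborel) < \<infinity>"
    unfolding Lx_norm_2 by (auto simp: ennreal_pow_def less_top)
  then show ?thesis
    unfolding L2_def by (auto simp: integrable_iff_bounded)
qed

lemma Lx_norm_L2: "f \<in> L2 \<Longrightarrow> Lx_norm 2 f = ennreal (nrm f)"
  unfolding Lx_norm_2 L2_iff nrm_def
  by (subst nn_integral_eq_integral) (auto simp: ennreal_epowr powr_half_sqrt)

lemma L2_measurable [measurable_dest]: "f \<in> L2 \<Longrightarrow> f \<in> borel_measurable borel"
  by (simp add: L2_iff)

lemma L2_integrable: "f \<in> L2 \<Longrightarrow> integrable lborel (\<lambda>x. (cmod (f x))\<^sup>2)"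
  by (simp add: L2_iff)

lemma nrm_nonneg [simp]: "0 \<le> nrm f"
  by (simp add: nrm_def)

lemma nrm_sq: "(nrm f)\<^sup>2 = (LINT x|lborel. (cmod (f x))\<^sup>2)"
  by (simp add: nrm_def)

lemma L2_bound:
  assumes "g \<in> L2" "f \<in> borel_measurable borel" "AE x in lborel. cmod (f x) \<le> C * cmod (g x)"
  shows "f \<in> L2"
proof -
  note [measurable] = assms(1,2)
  have "integrable lborel (\<lambda>x. C\<^sup>2 * (cmod (g x))\<^sup>2)"
    using L2_integrable[OF assms(1)] by simp
  then have "integrable lborel (\<lambda>x. (cmod (f x))\<^sup>2)"
  proof (rule Bochner_Integration.integrable_bound)
    show "AE x in lborel. norm ((cmod (f x))\<^sup>2) \<le> norm (C\<^sup>2 * (cmod (g x))\<^sup>2)"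
      using assms(3) 
    proof (rule eventually_mono)
      fix x assume "cmod (f x) \<le> C * cmod (g x)"
      then have "(cmod (f x))\<^sup>2 \<le> (C * cmod (g x))\<^sup>2" by (intro power_mono) auto
      then show "norm ((cmod (f x))\<^sup>2) \<le> norm (C\<^sup>2 * (cmod (g x))\<^sup>2)" by (simp add: power_mult_distrib)
    qed
  qed auto
  then show ?thesis using assms by (simp add: L2_iff)
qed

lemma nrm_bound:
  assumes "g \<in> L2" "f \<in> borel_measurable borel" "AE x in lborel. cmod (f x) \<le> C * cmod (g x)" "0 \<le> C"
  shows "nrm f \<le> C * nrm g"
proof -
  have f: "f \<in> L2" using L2_bound[OF assms(1-3)] .
  have "(nrm f)\<^sup>2 \<le> (LINT x|lborel. C\<^sup>2 * (cmod (g x))\<^sup>2)"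
    unfolding nrm_sq
  proof (rule integral_mono_AE)
    show "AE x in lborel. (cmod (f x))\<^sup>2 \<le> C\<^sup>2 * (cmod (g x))\<^sup>2"
      using assms(3) by (rule eventually_mono) (metis norm_ge_zero power_mono power_mult_distrib)
  qed (use L2_integrable[OF f] L2_integrable[OF assms(1)] in auto)
  also have "\<dots> = (C * nrm g)\<^sup>2" by (simp add: nrm_sq power_mult_distrib)
  finally show ?thesis using assms(4) by (simp add: power2_le_iff_abs_le)
qed

lemma nrm_mono:
  assumes "g \<in> L2" "f \<in> borel_measurable borel" "AE x in lborel. cmod (f x) \<le> cmod (g x)"
  shows "nrm f \<le> nrm g"
  using nrm_bound[OF assms(1,2), of 1] assms(3) by simp

lemma nrm_cong_AE: 
  assumes "AE x in lborel. f x = g x" "f \<in> borel_measurable borel" "g \<in> borel_measurable borel"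
  shows "nrm f = nrm g"
  unfolding nrm_def
  using assms by (intro arg_cong[where f=sqrt] integral_cong_AE eventually_mono[OF assms(1)]) auto

lemma L2_cong_AE: 
  assumes "AE x in lborel. f x = g x" "f \<in> borel_measurable borel" "g \<in> L2"
  shows "f \<in> L2"
  by (rule L2_bound[OF assms(3,2), of 1]) (rule eventually_mono[OF assms(1)], simp)

lemma L2_add [simp, intro]:
  assumes "f \<in> L2" "g \<in> L2" shows "(\<lambda>x. f x + g x) \<in> L2"
proof -
  note [measurable] = assms
  have i: "integrable lborel (\<lambda>x. 2 * (cmod (f x))\<^sup>2 + 2 * (cmod (g x))\<^sup>2)"
    using assms by (simp add: L2_iff)
  have *: "(cmod (a + b))\<^sup>2 \<le> 2 * (cmod a)\<^sup>2 + 2 * (cmod b)\<^sup>2" for a b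
  proof -
    have "(cmod (a + b))\<^sup>2 \<le> (cmod a + cmod b)\<^sup>2"
      by (intro power_mono norm_triangle_ineq) auto
    also have "\<dots> \<le> 2 * (cmod a)\<^sup>2 + 2 * (cmod b)\<^sup>2"
      using sum_squares_bound[of "cmod a" "cmod b"] by (simp add: power2_sum)
    finally show ?thesis .
  qed
  have "integrable lborel (\<lambda>x. (cmod (f x + g x))\<^sup>2)"
    by (rule Bochner_Integration.integrable_bound[OF i]) (use * in auto)
  then show ?thesis using assms by (simp add: L2_iff)
qed

lemma L2_cmult [simp, intro]: "f \<in> L2 \<Longrightarrow> (\<lambda>x. c * f x) \<in> L2"
  by (rule L2_bound[where C="cmod c"]) (auto simp: norm_mult L2_iff)

lemma L2_scaleR [simp, intro]: "f \<in> L2 \<Longrightarrow> (\<lambda>x. c *\<^sub>R f x) \<in> L2"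
  by (rule L2_bound[where C="\<bar>c\<bar>"]) (auto simp: L2_iff)

lemma L2_uminus [simp, intro]: "f \<in> L2 \<Longrightarrow> (\<lambda>x. - f x) \<in> L2"
  by (rule L2_bound[where C=1]) (auto simp: L2_iff)

lemma L2_diff [simp, intro]: "f \<in> L2 \<Longrightarrow> g \<in> L2 \<Longrightarrow> (\<lambda>x. f x - g x) \<in> L2"
  using L2_add[of f "\<lambda>x. - g x"] by simp

lemma L2_cnj [simp, intro]: "f \<in> L2 \<Longrightarrow> (\<lambda>x. cnj (f x)) \<in> L2"
  by (rule L2_bound[where C=1]) (auto simp: L2_iff)

lemma L2_zero [simp, intro]: "(\<lambda>x. 0) \<in> L2"
  by (auto simp: L2_iff)

lemma L2_sum [intro]: "finite A \<Longrightarrow> (\<And>i. i \<in> A \<Longrightarrow> f i \<in> L2) \<Longrightarrow> (\<lambda>x. \<Sum>i\<in>A. f i x) \<in> L2"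
  by (induction A rule: finite_induct) auto

lemma L2_indicator [intro]: "f \<in> L2 \<Longrightarrow> A \<in> sets borel \<Longrightarrow> (\<lambda>x. indicator A x * f x) \<in> L2"
  by (rule L2_bound[where C=1 and g=f]) (auto simp: L2_iff indicator_def)

lemma nrm_zero [simp]: "nrm (\<lambda>x. 0) = 0"
  by (simp add: nrm_def)

lemma nrm_cmult: "nrm (\<lambda>x. c * f x) = cmod c * nrm f"
  by (simp add: nrm_def norm_mult power_mult_distrib real_sqrt_mult)

lemma nrm_scaleR: "nrm (\<lambda>x. c *\<^sub>R f x) = \<bar>c\<bar> * nrm f"
  by (simp add: nrm_def power_mult_distrib real_sqrt_mult)

lemma nrm_uminus [simp]: "nrm (\<lambda>x. - f x) = nrm f"
  by (simp add: nrm_def)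

lemma nrm_cnj [simp]: "nrm (\<lambda>x. cnj (f x)) = nrm f"
  by (simp add: nrm_def)

lemma nrm_minus_commute: "nrm (\<lambda>x. f x - g x) = nrm (\<lambda>x. g x - f x)"
  by (simp add: nrm_def norm_minus_commute)

lemma L2_mult_integrable [intro]:
  assumes "f \<in> L2" "g \<in> L2" shows "integrable lborel (\<lambda>x. f x * g x)"
proof -
  note [measurable] = assms
  have "integrable lborel (\<lambda>x. (cmod (f x))\<^sup>2 + (cmod (g x))\<^sup>2)"
    using assms by (simp add: L2_iff)
  then show ?thesis
  proof (rule Bochner_Integration.integrable_bound)
    have "cmod (f x) * cmod (g x) \<le> (cmod (f x))\<^sup>2 + (cmod (g x))\<^sup>2" for x
    proof -
      have "0 \<le> cmod (f x) * cmod (g x)" by simp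
      then show ?thesis using sum_squares_bound[of "cmod (f x)" "cmod (g x)"] by linarith
    qed
    then show "AE x in lborel. norm (f x * g x) \<le> norm ((cmod (f x))\<^sup>2 + (cmod (g x))\<^sup>2)"
      by (simp add: norm_mult)
  qed auto
qed

lemma L2_Cauchy_Schwarz:
  assumes "f \<in> L2" "g \<in> L2"
  shows "(LINT x|lborel. cmod (f x) * cmod (g x)) \<le> nrm f * nrm g"
proof -
  note [measurable] = assms
  have i: "integrable lborel (\<lambda>x. cmod (f x) * cmod (g x))"
    using integrable_norm[OF L2_mult_integrable[OF assms]] by (simp add: norm_mult)
  have "(\<integral>\<^sup>+x. ennreal (cmod (f x)) * ennreal (cmod (g x)) \<partial>lborel)\<^sup>2 \<le>
     (\<integral>\<^sup>+x. ennreal (cmod (f x)) ^ 2 \<partial>lborel) * (\<integral>\<^sup>+x. ennreal (cmod (g x)) ^ 2 \<partial>lborel)"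
    by (rule Cauchy_Schwarz_nn_integral) auto
  also have "\<dots> = ennreal ((nrm f)\<^sup>2 * (nrm g)\<^sup>2)"
    using assms by (simp add: nrm_sq ennreal_power L2_iff nn_integral_eq_integral ennreal_mult)
  finally have "(ennreal (LINT x|lborel. cmod (f x) * cmod (g x)))\<^sup>2 \<le> ennreal ((nrm f)\<^sup>2 * (nrm g)\<^sup>2)"
    using i by (simp add: nn_integral_eq_integral ennreal_mult[symmetric])
  then have "(LINT x|lborel. cmod (f x) * cmod (g x))\<^sup>2 \<le> (nrm f * nrm g)\<^sup>2"
    by (simp add: ennreal_power power_mult_distrib)
  then show ?thesis by (simp add: power2_le_iff_abs_le)
qed

lemma nrm_triangle:
  assumes "f \<in> L2" "g \<in> L2"
  shows "nrm (\<lambda>x. f x + g x) \<le> nrm f + nrm g"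
proof -
  have i: "integrable lborel (\<lambda>x. cmod (f x) * cmod (g x))"
    using integrable_norm[OF L2_mult_integrable[OF assms]] by (simp add: norm_mult)
  have "(nrm (\<lambda>x. f x + g x))\<^sup>2 \<le> (LINT x|lborel. (cmod (f x))\<^sup>2 + (cmod (g x))\<^sup>2 + 2 * (cmod (f x) * cmod (g x)))"
    unfolding nrm_sq
  proof (rule integral_mono)
    show "integrable lborel (\<lambda>x. (cmod (f x + g x))\<^sup>2)"
      using L2_add[OF assms] by (rule L2_integrable)
    show "(cmod (f x + g x))\<^sup>2 \<le> (cmod (f x))\<^sup>2 + (cmod (g x))\<^sup>2 + 2 * (cmod (f x) * cmod (g x))" for x
      using power_mono[OF norm_triangle_ineq[of "f x" "g x"], of 2] by (simp add: power2_sum)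
  qed (use assms i in \<open>auto simp: L2_iff\<close>)
  also have "\<dots> = (nrm f)\<^sup>2 + (nrm g)\<^sup>2 + 2 * (LINT x|lborel. cmod (f x) * cmod (g x))"
    using assms i by (simp add: nrm_sq L2_iff)
  also have "\<dots> \<le> (nrm f + nrm g)\<^sup>2"
    using L2_Cauchy_Schwarz[OF assms] by (simp add: power2_sum)
  finally show ?thesis by (simp add: power2_le_iff_abs_le)
qed

lemma nrm_triangle_diff:
  assumes "f \<in> L2" "g \<in> L2"
  shows "nrm (\<lambda>x. f x - g x) \<le> nrm f + nrm g"
  using nrm_triangle[OF assms(1), of "\<lambda>x. - g x"] assms by simp

lemma nrm_triangle3:
  assumes "f \<in> L2" "g \<in> L2" "h \<in> L2"
  shows "nrm (\<lambda>x. f x - h x) \<le> nrm (\<lambda>x. f x - g x) + nrm (\<lambda>x. g x - h x)"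
  using nrm_triangle[of "\<lambda>x. f x - g x" "\<lambda>x. g x - h x"] assms by simp

lemma nrm_diff_abs:
  assumes "f \<in> L2" "g \<in> L2"
  shows "\<bar>nrm f - nrm g\<bar> \<le> nrm (\<lambda>x. f x - g x)"
  using nrm_triangle[of "\<lambda>x. f x - g x" g] nrm_triangle[of "\<lambda>x. g x - f x" f] assms
  by (simp add: nrm_minus_commute[of g f])

lemma nrm_sum:
  "finite A \<Longrightarrow> (\<And>i. i \<in> A \<Longrightarrow> f i \<in> L2) \<Longrightarrow> nrm (\<lambda>x. \<Sum>i\<in>A. f i x) \<le> (\<Sum>i\<in>A. nrm (f i))"
proof (induction A rule: finite_induct)
  case (insert a A)
  then have "nrm (\<lambda>x. f a x + (\<Sum>i\<in>A. f i x)) \<le> nrm (f a) + nrm (\<lambda>x. \<Sum>i\<in>A. f i x)"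
    by (intro nrm_triangle L2_sum) auto
  with insert show ?case by fastforce
qed simp

lemma nrm_eq_0: 
  assumes "f \<in> L2" "nrm f = 0" shows "AE x in lborel. f x = 0"
proof -
  have "(LINT x|lborel. (cmod (f x))\<^sup>2) = 0" using assms(2) nrm_sq[of f] by simp
  then have "AE x in lborel. (cmod (f x))\<^sup>2 = 0"
    using assms(1) by (subst (asm) integral_nonneg_eq_0_iff_AE) (auto simp: L2_iff)
  then show ?thesis by simp
qed

lemma nrm_tendsto:
  assumes "((\<lambda>i. nrm (\<lambda>x. f i x - g x)) \<longlongrightarrow> 0) F" "g \<in> L2" "\<forall>\<^sub>F i in F. f i \<in> L2"
  shows "((\<lambda>i. nrm (f i)) \<longlongrightarrow> nrm g) F"
proof -
  have "((\<lambda>i. nrm (f i) - nrm g) \<longlongrightarrow> 0) F"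
    by (rule Lim_null_comparison[OF eventually_mono[OF assms(3)] assms(1)]) (use assms(2) nrm_diff_abs in simp)
  then show ?thesis by (simp add: LIM_zero_iff)
qed

lemma nrm_dominated_convergence:
  fixes f :: "nat \<Rightarrow> real \<Rightarrow> complex"
  assumes g: "g \<in> L2" and f: "\<And>n. f n \<in> borel_measurable borel"
    and lim: "AE x in lborel. (\<lambda>n. f n x) \<longlonglongrightarrow> 0"
    and b: "\<And>n. AE x in lborel. cmod (f n x) \<le> cmod (g x)"
  shows "(\<lambda>n. nrm (f n)) \<longlonglongrightarrow> 0"
proof -
  have "(\<lambda>n. LINT x|lborel. (cmod (f n x))\<^sup>2) \<longlonglongrightarrow> (LINT (x::real)|lborel. (0::real))"
  proof (rule integral_dominated_convergence[where w="\<lambda>x. (cmod (g x))\<^sup>2"])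
    show "AE x in lborel. (\<lambda>n. (cmod (f n x))\<^sup>2) \<longlonglongrightarrow> 0"
      using lim by (rule eventually_mono) (auto intro!: tendsto_eq_intros)
    show "AE x in lborel. norm ((cmod (f n x))\<^sup>2) \<le> (cmod (g x))\<^sup>2" for n
      using b[of n] by (rule eventually_mono) (auto intro: power_mono)
  qed (use f g in \<open>auto simp: L2_iff\<close>)
  then have "(\<lambda>n. sqrt (LINT x|lborel. (cmod (f n x))\<^sup>2)) \<longlonglongrightarrow> sqrt 0"
    by (intro tendsto_real_sqrt) simp
  then show ?thesis by (simp add: nrm_def)
qed

text \<open>Besides the bound this gives membership in \<open>L2\<close>, which is how almost
  everywhere limits are shown to be square integrable.\<close>
lemma nrm_Fatou:
  fixes f :: "nat \<Rightarrow> real \<Rightarrow> complex"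
  assumes f: "\<And>n. f n \<in> L2" and g: "g \<in> borel_measurable borel"
    and lim: "AE x in lborel. (\<lambda>n. f n x) \<longlonglongrightarrow> g x"
    and b: "\<And>n. nrm (f n) \<le> K"
  shows "g \<in> L2 \<and> nrm g \<le> K"
proof -
  note [measurable] = f g
  have K: "0 \<le> K" using b[of 0] nrm_nonneg[of "f 0"] by linarith
  have "(\<integral>\<^sup>+x. ennreal ((cmod (g x))\<^sup>2) \<partial>lborel) = (\<integral>\<^sup>+x. liminf (\<lambda>n. ennreal ((cmod (f n x))\<^sup>2)) \<partial>lborel)"
  proof (rule nn_integral_cong_AE, use lim in \<open>rule eventually_mono\<close>)
    fix x assume "(\<lambda>n. f n x) \<longlonglongrightarrow> g x"
    then have "(\<lambda>n. ennreal ((cmod (f n x))\<^sup>2)) \<longlonglongrightarrow> ennreal ((cmod (g x))\<^sup>2)"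
      by (intro tendsto_intros) auto
    then show "ennreal ((cmod (g x))\<^sup>2) = liminf (\<lambda>n. ennreal ((cmod (f n x))\<^sup>2))"
      by (metis lim_imp_Liminf trivial_limit_sequentially)
  qed
  also have "\<dots> \<le> liminf (\<lambda>n. \<integral>\<^sup>+x. ennreal ((cmod (f n x))\<^sup>2) \<partial>lborel)"
    by (rule nn_integral_liminf) auto
  also have "\<dots> \<le> ennreal (K\<^sup>2)"
  proof (rule Liminf_le[OF trivial_limit_sequentially], rule always_eventually, rule allI)
    fix n 
    have "(\<integral>\<^sup>+x. ennreal ((cmod (f n x))\<^sup>2) \<partial>lborel) = ennreal ((nrm (f n))\<^sup>2)"
      using f by (simp add: nn_integral_eq_integral L2_iff nrm_sq)
    also have "\<dots> \<le> ennreal (K\<^sup>2)" using b[of n] by (intro ennreal_leI power_mono) auto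
    finally show "(\<integral>\<^sup>+x. ennreal ((cmod (f n x))\<^sup>2) \<partial>lborel) \<le> ennreal (K\<^sup>2)" .
  qed
  finally have *: "(\<integral>\<^sup>+x. ennreal ((cmod (g x))\<^sup>2) \<partial>lborel) \<le> ennreal (K\<^sup>2)" .
  then have i: "integrable lborel (\<lambda>x. (cmod (g x))\<^sup>2)"
    by (auto simp: integrable_iff_bounded intro: le_less_trans)
  then have "(nrm g)\<^sup>2 \<le> K\<^sup>2" using * by (simp add: nn_integral_eq_integral nrm_sq)
  then show ?thesis using i g K by (auto simp: L2_iff power2_le_iff_abs_le)
qed

text \<open>The partial sums of the moduli have norm at most 2, so by monotone convergence their
  supremum is square integrable and hence finite almost everywhere.\<close>
lemma L2_summable_AE:
  fixes f :: "nat \<Rightarrow> real \<Rightarrow> complex"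
  assumes f: "\<And>n. f n \<in> L2" and b: "\<And>n. nrm (f n) \<le> (1/2)^n"
  shows "AE x in lborel. summable (\<lambda>n. cmod (f n x))"
proof -
  note [measurable] = f
  define s where "s n x = complex_of_real (\<Sum>i<n. cmod (f i x))" for n x
  have cL2: "(\<lambda>x. complex_of_real (cmod (f i x))) \<in> L2" for i
    by (rule L2_bound[OF f[of i], where C=1]) auto
  have sL2: "s n \<in> L2" for n
    unfolding s_def of_real_sum by (rule L2_sum) (auto intro: cL2)
  have sn: "nrm (s n) \<le> 2" for n
  proof -
    have "nrm (s n) \<le> (\<Sum>i<n. nrm (\<lambda>x. complex_of_real (cmod (f i x))))"
      unfolding s_def of_real_sum by (rule nrm_sum) (auto intro: cL2)
    also have "\<dots> = (\<Sum>i<n. nrm (f i))" by (simp add: nrm_def)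
    also have "\<dots> \<le> (\<Sum>i<n. (1/2)^i)" by (rule sum_mono) (rule b)
    also have "\<dots> \<le> (\<Sum>i. (1/2)^i)" by (rule sum_le_suminf) auto
    also have "\<dots> = 2" by (simp add: suminf_geometric)
    finally show ?thesis .
  qed
  have "(\<integral>\<^sup>+x. (SUP n. ennreal ((cmod (s n x))\<^sup>2)) \<partial>lborel) = (SUP n. \<integral>\<^sup>+x. ennreal ((cmod (s n x))\<^sup>2) \<partial>lborel)"
  proof (rule nn_integral_monotone_convergence_SUP)
    show "incseq (\<lambda>n x. ennreal ((cmod (s n x))\<^sup>2))"
      unfolding s_def unfolding norm_of_real
      by (intro incseq_SucI le_funI ennreal_leI power_mono) (auto simp: sum_nonneg abs_of_nonneg)
  qed (auto simp: s_def)
  also have "\<dots> \<le> ennreal 4"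
  proof (rule SUP_least)
    fix n
    have "(\<integral>\<^sup>+x. ennreal ((cmod (s n x))\<^sup>2) \<partial>lborel) = ennreal ((nrm (s n))\<^sup>2)"
      using sL2 by (simp add: nn_integral_eq_integral L2_iff nrm_sq)
    also have "\<dots> \<le> ennreal (2\<^sup>2)" using sn[of n] by (intro ennreal_leI power_mono) auto
    finally show "(\<integral>\<^sup>+x. ennreal ((cmod (s n x))\<^sup>2) \<partial>lborel) \<le> ennreal 4" by simp
  qed
  finally have "(\<integral>\<^sup>+x. (SUP n. ennreal ((cmod (s n x))\<^sup>2)) \<partial>lborel) \<noteq> \<infinity>"
    by (auto simp: top_unique)
  then have "AE x in lborel. (SUP n. ennreal ((cmod (s n x))\<^sup>2)) \<noteq> \<infinity>"
    by (intro nn_integral_PInf_AE) (auto simp: s_def)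
  then show ?thesis
  proof (rule eventually_mono)
    fix x assume "(SUP n. ennreal ((cmod (s n x))\<^sup>2)) \<noteq> \<infinity>"
    then obtain K where K: "0 \<le> K" "(SUP n. ennreal ((cmod (s n x))\<^sup>2)) = ennreal K"
      by (cases "(SUP n. ennreal ((cmod (s n x))\<^sup>2))") auto
    have "ennreal ((cmod (s n x))\<^sup>2) \<le> ennreal K" for n
      unfolding K(2)[symmetric] by (rule SUP_upper) simp
    then have "(cmod (s n x))\<^sup>2 \<le> K" for n using K(1) by simp
    then have "cmod (s n x) \<le> sqrt K" for n by (simp add: real_le_rsqrt)
    then have "(\<Sum>i<n. cmod (f i x)) \<le> sqrt K" for n
      unfolding s_def by (metis abs_le_D1 norm_of_real)
    then show "summable (\<lambda>n. cmod (f n x))"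
      by (intro summableI_nonneg_bounded[where x="sqrt K"]) auto
  qed
qed

text \<open>Riesz--Fischer. A subsequence whose increments are below \<open>(1/2)^k\<close>
  converges almost everywhere, and Fatou turns the Cauchy estimate into convergence in norm to
  that limit.\<close>
lemma L2_complete:
  fixes f :: "nat \<Rightarrow> real \<Rightarrow> complex"
  assumes f: "\<And>n. f n \<in> L2"
    and cauchy: "\<And>e. e > 0 \<Longrightarrow> \<exists>N. \<forall>m\<ge>N. \<forall>n\<ge>N. nrm (\<lambda>x. f m x - f n x) \<le> e"
  shows "\<exists>g\<in>L2. (\<lambda>n. nrm (\<lambda>x. f n x - g x)) \<longlonglongrightarrow> 0"
proof -
  note [measurable] = f
  obtain N where N: "\<And>k m n. m \<ge> N k \<Longrightarrow> n \<ge> N k \<Longrightarrow> nrm (\<lambda>x. f m x - f n x) \<le> (1/2)^k"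
    using cauchy[of "(1/2)^_"] by (metis zero_less_divide_1_iff zero_less_numeral zero_less_power)
  \<comment> \<open>sums instead of \<open>N k\<close> itself, to make \<open>r\<close>
    monotone\<close>
  define r where "r k = (\<Sum>i\<le>k. N i)" for k
  have rN: "r k \<ge> N k" for k unfolding r_def by (rule member_le_sum) auto
  have rr: "j \<le> k \<Longrightarrow> r j \<le> r k" for j k unfolding r_def by (rule sum_mono2) auto
  have "AE x in lborel. summable (\<lambda>k. cmod (f (r (Suc k)) x - f (r k) x))"
    by (rule L2_summable_AE[OF L2_diff[OF f f] N]) (use rN order_trans[OF rN rr] in auto)
  then have ae: "AE x in lborel. convergent (\<lambda>k. f (r k) x)"
  proof (rule eventually_mono)
    fix x assume "summable (\<lambda>k. cmod (f (r (Suc k)) x - f (r k) x))"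
    then have "summable (\<lambda>k. f (r (Suc k)) x - f (r k) x)"
      by (rule summable_norm_cancel)
    then have "convergent (\<lambda>n. \<Sum>k<n. f (r (Suc k)) x - f (r k) x)"
      by (simp add: summable_iff_convergent)
    then have "convergent (\<lambda>n. f (r n) x - f (r 0) x)"
      by (simp add: sum_lessThan_telescope[of "\<lambda>k. f (r k) x"])
    then show "convergent (\<lambda>k. f (r k) x)"
      using convergent_add[OF _ convergent_const[of "f (r 0) x"]] by fastforce
  qed
  define g where "g x = lim (\<lambda>k. f (r k) x)" for x
  have g[measurable]: "g \<in> borel_measurable borel" unfolding g_def by measurable
  have lim: "AE x in lborel. (\<lambda>k. f (r k) x) \<longlonglongrightarrow> g x"
    using ae by (rule eventually_mono) (simp add: g_def convergent_LIMSEQ_iff)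
  have key: "(\<lambda>x. f n x - g x) \<in> L2 \<and> nrm (\<lambda>x. f n x - g x) \<le> (1/2)^k" if "n \<ge> r k" for n k
  proof (rule nrm_Fatou[where f="\<lambda>i x. f n x - f (r (i + k)) x"])
    show "AE x in lborel. (\<lambda>i. f n x - f (r (i + k)) x) \<longlonglongrightarrow> f n x - g x"
      using lim by (rule eventually_mono) (intro tendsto_intros LIMSEQ_ignore_initial_segment)
    show "nrm (\<lambda>x. f n x - f (r (i + k)) x) \<le> (1 / 2) ^ k" for i
      using that rN[of k] rr[of k "i+k"] by (intro N) auto
  qed (use f in auto)
  have gL: "g \<in> L2"
    using L2_diff[OF f[of "r 0"] conjunct1[OF key[of 0 "r 0"]]] by simp
  have "(\<lambda>n. nrm (\<lambda>x. f n x - g x)) \<longlonglongrightarrow> 0"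
  proof (rule LIMSEQ_I)
    fix e :: real assume "e > 0"
    then obtain k where k: "(1/2)^k < e" using real_arch_pow_inv[of e "1/2"] by auto
    show "\<exists>n0. \<forall>n\<ge>n0. norm (nrm (\<lambda>x. f n x - g x) - 0) < e"
      using key[of k] k by (auto intro!: exI[of _ "r k"] le_less_trans[OF _ k])
  qed
  with gL show ?thesis by blast
qed

lemma L2_mult_integral_bound:
  assumes "f \<in> L2" "g \<in> L2"
  shows "(LINT x|lborel. cmod (f x * g x)) \<le> nrm f * nrm g" "cmod (LINT x|lborel. f x * g x) \<le> nrm f * nrm g"
  using L2_Cauchy_Schwarz[OF assms] integral_norm_bound[of lborel "\<lambda>x. f x * g x"]
  by (auto simp: norm_mult)

text \<open>Cauchy--Schwarz on both terms of \<open>f g - f0 g0 = (f - f0) g + f0 (g -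
  g0)\<close>.\<close>
lemma L2_mult_tendsto:
  assumes "((\<lambda>i. nrm (\<lambda>x. f i x - f0 x)) \<longlongrightarrow> 0) F" "((\<lambda>i. nrm (\<lambda>x. g i x - g0 x)) \<longlongrightarrow> 0) F"
    "f0 \<in> L2" "g0 \<in> L2" "\<And>i. f i \<in> L2" "\<And>i. g i \<in> L2"
  shows "((\<lambda>i. LINT x|lborel. cmod (f i x * g i x - f0 x * g0 x)) \<longlongrightarrow> 0) F"
proof (rule Lim_null_comparison)
  let ?b = "\<lambda>i. nrm (\<lambda>x. f i x - f0 x) * nrm (g i) + nrm f0 * nrm (\<lambda>x. g i x - g0 x)"
  have "(?b \<longlongrightarrow> 0 * nrm g0 + nrm f0 * 0) F"
    using assms by (intro tendsto_intros nrm_tendsto) auto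
  then show "(?b \<longlongrightarrow> 0) F" by simp
  show "\<forall>\<^sub>F i in F. norm (LINT x|lborel. cmod (f i x * g i x - f0 x * g0 x)) \<le> ?b i"
  proof (rule always_eventually, rule allI)
    fix i
    have I: "integrable lborel (\<lambda>x. (f i x - f0 x) * g i x)" "integrable lborel (\<lambda>x. f0 x * (g i x - g0 x))"
      using assms by auto
    have eq: "f i x * g i x - f0 x * g0 x = (f i x - f0 x) * g i x + f0 x * (g i x - g0 x)" for x
      by (simp add: algebra_simps)
    have "(LINT x|lborel. cmod (f i x * g i x - f0 x * g0 x)) \<le> 
        (LINT x|lborel. cmod ((f i x - f0 x) * g i x) + cmod (f0 x * (g i x - g0 x)))"
      unfolding eq using I by (intro integral_mono) (auto intro: norm_triangle_ineq)
    also have "\<dots> = (LINT x|lborel. cmod ((f i x - f0 x) * g i x)) + (LINT x|lborel. cmod (f0 x * (g i x - g0 x)))"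
      using I by (intro Bochner_Integration.integral_add) auto
    also have "\<dots> \<le> ?b i"
      using assms by (intro add_mono L2_mult_integral_bound) auto
    finally show "norm (LINT x|lborel. cmod (f i x * g i x - f0 x * g0 x)) \<le> ?b i" by simp
  qed
qed

section \<open>Continuity of translations in L1\<close>

lemma integral_shift: 
  fixes h :: "real \<Rightarrow> 'a::{banach,second_countable_topology}"
  shows "(LINT x|lborel. h (x + t)) = (LINT x|lborel. h x)"
  using lborel_integral_real_affine[of 1 h t] by (simp add: add.commute)

lemma integrable_shift: 
  fixes h :: "real \<Rightarrow> 'a::{banach,second_countable_topology}"
  shows "integrable lborel h \<Longrightarrow> integrable lborel (\<lambda>x. h (x + t))"
  using lborel_integrable_real_affine[of h 1 t] by (simp add: add.commute)

text \<open>Translations preserve the L1 norm, so continuity at 0 passes to L1 limits.\<close>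
lemma L1_translation_approx:
  fixes f :: "real \<Rightarrow> complex"
  assumes f: "integrable lborel f"
    and ap: "\<And>e. e > 0 \<Longrightarrow> \<exists>g. integrable lborel g \<and> (LINT x|lborel. cmod (f x - g x)) \<le> e \<and>
        (\<lambda>n. LINT x|lborel. cmod (g (x + X n) - g x)) \<longlonglongrightarrow> 0"
  shows "(\<lambda>n. LINT x|lborel. cmod (f (x + X n) - f x)) \<longlonglongrightarrow> 0"
proof (rule LIMSEQ_I)
  fix e :: real assume e: "e > 0"
  obtain g where g: "integrable lborel g" "(LINT x|lborel. cmod (f x - g x)) \<le> e / 4"
    "(\<lambda>n. LINT x|lborel. cmod (g (x + X n) - g x)) \<longlonglongrightarrow> 0"
    using ap[of "e/4"] e by auto
  obtain N where N: "\<And>n. n \<ge> N \<Longrightarrow> (LINT x|lborel. cmod (g (x + X n) - g x)) < e / 4"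
    using LIMSEQ_D[OF g(3), of "e/4"] e by (auto simp: abs_of_nonneg)
  note sh = integrable_shift[OF f] integrable_shift[OF g(1)]
  have "(LINT x|lborel. cmod (f (x + X n) - f x)) < e" if "n \<ge> N" for n
  proof -
    have "(LINT x|lborel. cmod (f (x + X n) - f x)) \<le> 
      (LINT x|lborel. cmod (f (x + X n) - g (x + X n)) + cmod (g (x + X n) - g x) + cmod (f x - g x))"
    proof (rule integral_mono)
      show "cmod (f (x + X n) - f x) \<le> cmod (f (x + X n) - g (x + X n)) + cmod (g (x + X n) - g x) + cmod (f x - g x)" for x
        using norm_triangle_ineq4[of "f (x + X n) - g (x + X n) + (g (x + X n) - g x)" "f x - g x"] 
          norm_triangle_ineq[of "f (x + X n) - g (x + X n)" "g (x + X n) - g x"] by simp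
    qed (use f g sh in auto)
    also have "\<dots> = (LINT x|lborel. cmod (f (x + X n) - g (x + X n))) + (LINT x|lborel. cmod (g (x + X n) - g x)) + (LINT x|lborel. cmod (f x - g x))"
      using f g sh by simp
    also have "(LINT x|lborel. cmod (f (x + X n) - g (x + X n))) = (LINT x|lborel. cmod (f x - g x))"
      by (rule integral_shift[where h="\<lambda>x. cmod (f x - g x)"])
    finally show ?thesis using g(2) N[OF that] e by linarith
  qed
  then show "\<exists>no. \<forall>n\<ge>no. norm ((LINT x|lborel. cmod (f (x + X n) - f x)) - 0) < e"
    by (auto simp: abs_of_nonneg)
qed

text \<open>A point of an open set stays in it under small shifts, so the positive part of
  \<open>indicator U x - indicator U (x + h)\<close> tends to 0 pointwise. The difference has
  integral 0, so its L1 norm is twice that of the positive part.\<close>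
lemma L1_translation_open:
  fixes c :: complex
  assumes U: "open U" "emeasure lborel U < \<infinity>" and X: "X \<longlonglongrightarrow> (0::real)"
  shows "(\<lambda>n. LINT x|lborel. cmod (indicat_real U (x + X n) *\<^sub>R c - indicat_real U x *\<^sub>R c)) \<longlonglongrightarrow> 0"
proof -
  let ?g = "indicat_real U"
  have [measurable]: "U \<in> sets borel" using U by auto
  have gi: "integrable lborel ?g" using U by simp
  note sh = integrable_shift[OF gi]
  have a: "(\<lambda>n. LINT x|lborel. max 0 (?g x - ?g (x + X n))) \<longlonglongrightarrow> (LINT (x::real)|lborel. (0::real))"
  proof (rule integral_dominated_convergence[where w="?g"])
    show "AE x in lborel. (\<lambda>n. max 0 (?g x - ?g (x + X n))) \<longlonglongrightarrow> 0"
    proof (rule AE_I2)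
      fix x :: real
      show "(\<lambda>n. max 0 (?g x - ?g (x + X n))) \<longlonglongrightarrow> 0"
      proof (cases "x \<in> U")
        case True
        have "(\<lambda>n. x + X n) \<longlonglongrightarrow> x + 0" by (intro tendsto_intros X)
        then have "\<forall>\<^sub>F n in sequentially. x + X n \<in> U"
          using U(1) True by (simp add: topological_tendstoD)
        then have "\<forall>\<^sub>F n in sequentially. max 0 (?g x - ?g (x + X n)) = 0"
          by (rule eventually_mono) (use True in simp)
        then show ?thesis by (rule tendsto_eventually)
      qed (simp add: indicator_def)
    qed
    show "AE x in lborel. norm (max 0 (?g x - ?g (x + X n))) \<le> ?g x" for n
      by (auto simp: indicator_def)
  qed (use gi in auto)
  have eq: "(LINT x|lborel. cmod (?g (x + X n) *\<^sub>R c - ?g x *\<^sub>R c)) = 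
      2 * cmod c * (LINT x|lborel. max 0 (?g x - ?g (x + X n)))" for n
  proof -
    have "(LINT x|lborel. cmod (?g (x + X n) *\<^sub>R c - ?g x *\<^sub>R c)) = 
      (LINT x|lborel. cmod c * ((?g (x + X n) - ?g x) + 2 * max 0 (?g x - ?g (x + X n))))"
      by (intro Bochner_Integration.integral_cong) (auto simp: indicator_def)
    also have "\<dots> = cmod c * ((LINT x|lborel. ?g (x + X n)) - (LINT x|lborel. ?g x) + 2 * (LINT x|lborel. max 0 (?g x - ?g (x + X n))))"
      using gi sh by (subst integral_mult_right_zero, subst Bochner_Integration.integral_add) auto
    finally show ?thesis by (simp add: integral_shift[of ?g])
  qed
  have "(\<lambda>n. 2 * cmod c * (LINT x|lborel. max 0 (?g x - ?g (x + X n)))) \<longlonglongrightarrow> 2 * cmod c * 0"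
    using a by (intro tendsto_intros) simp
  then show ?thesis unfolding eq by simp
qed

text \<open>Integrable functions are limits of simple functions, and sets of finite measure are
  approximated from outside by open sets.\<close>
lemma L1_translation_continuous:
  fixes f :: "real \<Rightarrow> complex"
  assumes "integrable lborel f" and X: "X \<longlonglongrightarrow> (0::real)"
  shows "(\<lambda>n. LINT x|lborel. cmod (f (x + X n) - f x)) \<longlonglongrightarrow> 0"
  using assms(1)
proof (induction f rule: integrable_induct)
  case (base A c)
  have [measurable]: "A \<in> sets borel" using base by simp
  show ?case
  proof (rule L1_translation_approx)
    show "integrable lborel (\<lambda>x. indicat_real A x *\<^sub>R c)" using base by simp
    fix e :: real assume e: "e > 0"
    \<comment> \<open>the 1 covers the case \<open>c = 0\<close>\<close>
    define d where "d = e / (cmod c + 1)"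
    have d: "d > 0" unfolding d_def using e by (simp add: add_nonneg_pos)
    have cd: "d * cmod c \<le> e" unfolding d_def using e add_nonneg_pos[of "cmod c" 1]
      by (simp add: field_simps)
    obtain U where U: "open U" "A \<subseteq> U" "U - A \<in> lmeasurable" "emeasure lebesgue (U - A) < ennreal d"
      using sets_lebesgue_outer_open[of A d] d base by auto
    have [measurable]: "U \<in> sets borel" using U by auto
    have em: "emeasure lborel (U - A) < ennreal d" using U(4) by simp
    have "emeasure lborel U \<le> emeasure lborel A + emeasure lborel (U - A)"
      using U(2) emeasure_subadditive[of A lborel "U - A"] by (simp add: Un_absorb1)
    also have "\<dots> < \<infinity>" using base(2) em by (auto simp: less_top order.strict_trans)
    finally have fU: "emeasure lborel U < \<infinity>" .
    have "(LINT x|lborel. cmod (indicat_real A x *\<^sub>R c - indicat_real U x *\<^sub>R c)) = (LINT x|lborel. cmod c * indicat_real (U - A) x)"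
      using U(2) by (intro Bochner_Integration.integral_cong) (auto simp: indicator_def)
    also have "\<dots> = cmod c * measure lborel (U - A)" by simp
    also have "\<dots> \<le> cmod c * d"
      using em d by (intro mult_left_mono) (simp_all add: measure_def enn2real_leI less_imp_le)
    also have "\<dots> \<le> e" using cd by (simp add: mult.commute)
    finally show "\<exists>g. integrable lborel g \<and> (LINT x|lborel. cmod (indicat_real A x *\<^sub>R c - g x)) \<le> e \<and>
        (\<lambda>n. LINT x|lborel. cmod (g (x + X n) - g x)) \<longlonglongrightarrow> 0"
      using L1_translation_open[OF U(1) fU X, of c] fU
      by (intro exI[of _ "\<lambda>x. indicat_real U x *\<^sub>R c"]) auto
  qed
next
  case (add f g)
  have "(\<lambda>n. (LINT x|lborel. cmod (f (x + X n) - f x)) + (LINT x|lborel. cmod (g (x + X n) - g x))) \<longlonglongrightarrow> 0 + 0"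
    using add by (intro tendsto_intros)
  then have lim: "(\<lambda>n. (LINT x|lborel. cmod (f (x + X n) - f x)) + (LINT x|lborel. cmod (g (x + X n) - g x))) \<longlonglongrightarrow> 0"
    by simp
  show ?case
  proof (rule Lim_null_comparison[OF always_eventually lim], rule allI)
    fix n
    note sh = integrable_shift[OF add(1), of "X n"] integrable_shift[OF add(2), of "X n"]
    have "(LINT x|lborel. cmod (f (x + X n) + g (x + X n) - (f x + g x))) \<le> 
      (LINT x|lborel. cmod (f (x + X n) - f x) + cmod (g (x + X n) - g x))"
    proof (rule integral_mono)
      show "cmod (f (x + X n) + g (x + X n) - (f x + g x)) \<le> cmod (f (x + X n) - f x) + cmod (g (x + X n) - g x)" for x
        using norm_triangle_ineq[of "f (x + X n) - f x" "g (x + X n) - g x"] by (simp add: algebra_simps)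
    qed (use add sh in auto)
    also have "\<dots> = (LINT x|lborel. cmod (f (x + X n) - f x)) + (LINT x|lborel. cmod (g (x + X n) - g x))"
      using add sh by simp
    finally show "norm (LINT x|lborel. cmod (f (x + X n) + g (x + X n) - (f x + g x))) \<le> 
       (LINT x|lborel. cmod (f (x + X n) - f x)) + (LINT x|lborel. cmod (g (x + X n) - g x))" by simp
  qed
next
  case (lim f s)
  show ?case
  proof (rule L1_translation_approx)
    show "integrable lborel f" by fact
  next
    fix e :: real assume e: "e > 0"
    have "(\<lambda>i. LINT x|lborel. cmod (f x - s i x)) \<longlonglongrightarrow> (LINT (x::real)|lborel. (0::real))"
    proof (rule integral_dominated_convergence[where w="\<lambda>x. 3 * cmod (f x)"])
      show "AE x in lborel. (\<lambda>i. cmod (f x - s i x)) \<longlonglongrightarrow> 0"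
      proof (rule AE_I2)
        fix x :: real
        have "(\<lambda>i. cmod (f x - s i x)) \<longlonglongrightarrow> cmod (f x - f x)"
          by (intro tendsto_intros lim(2)) auto
        then show "(\<lambda>i. cmod (f x - s i x)) \<longlonglongrightarrow> 0" by simp
      qed
      show "AE x in lborel. norm (cmod (f x - s i x)) \<le> 3 * cmod (f x)" for i
      proof (rule AE_I2)
        fix x :: real
        show "norm (cmod (f x - s i x)) \<le> 3 * cmod (f x)"
          using lim(3)[of x i] norm_triangle_ineq4[of "f x" "s i x"] by simp
      qed
    qed (use lim(1,4) in auto)
    then have "\<forall>\<^sub>F i in sequentially. (LINT x|lborel. cmod (f x - s i x)) < e"
      using e by (simp add: order_tendstoD)
    then obtain i where "(LINT x|lborel. cmod (f x - s i x)) < e"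
      using eventually_happens'[OF trivial_limit_sequentially] by blast
    then show "\<exists>g. integrable lborel g \<and> (LINT x|lborel. cmod (f x - g x)) \<le> e \<and>
        (\<lambda>n. LINT x|lborel. cmod (g (x + X n) - g x)) \<longlonglongrightarrow> 0"
      using lim(1,5)[of i] by (intro exI[of _ "s i"]) auto
  qed
qed

section \<open>Fourier integrals\<close>

definition FT :: "(real \<Rightarrow> complex) \<Rightarrow> (real \<Rightarrow> complex)" where
  "FT f \<xi> = complex_of_real (1 / sqrt (2 * pi)) * (LINT x|lborel. cis (- (x * \<xi>)) * f x)"

lemma measurable_cis [measurable]: "cis \<in> borel_measurable borel"
  by (intro borel_measurable_continuous_onI continuous_intros)

lemma FT_measurable [measurable]: 
  assumes [measurable]: "f \<in> borel_measurable borel" shows "FT f \<in> borel_measurable borel"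
  unfolding FT_def[abs_def] by measurable

lemma integrable_unimodular_mult:
  fixes f :: "real \<Rightarrow> complex"
  assumes "integrable lborel f" and [measurable]: "u \<in> borel_measurable borel" and "\<And>x. cmod (u x) \<le> 1"
  shows "integrable lborel (\<lambda>x. u x * f x)"
proof (rule Bochner_Integration.integrable_bound[OF assms(1)])
  show "(\<lambda>x. u x * f x) \<in> borel_measurable lborel"
    using borel_measurable_integrable[OF assms(1)] by measurable
  show "AE x in lborel. cmod (u x * f x) \<le> cmod (f x)"
    using assms(3) by (auto simp: norm_mult intro!: mult_left_le_one_le)
qed

lemma FT_integrand_integrable:
  "integrable lborel f \<Longrightarrow> integrable lborel (\<lambda>x. cis (- (x * \<xi>)) * f x)"
  by (rule integrable_unimodular_mult) auto

lemma FT_bound: "cmod (FT f \<xi>) \<le> (1 / sqrt (2 * pi)) * (LINT x|lborel. cmod (f x))"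
proof -
  have "cmod (LINT x|lborel. cis (- (x * \<xi>)) * f x) \<le> (LINT x|lborel. cmod (cis (- (x * \<xi>)) * f x))"
    by (rule integral_norm_bound)
  then show ?thesis unfolding FT_def by (simp add: norm_mult norm_divide divide_right_mono)
qed

lemma FT_add: "integrable lborel f \<Longrightarrow> integrable lborel g \<Longrightarrow> FT (\<lambda>x. f x + g x) \<xi> = FT f \<xi> + FT g \<xi>"
  unfolding FT_def by (simp add: distrib_left FT_integrand_integrable)

lemma FT_diff: "integrable lborel f \<Longrightarrow> integrable lborel g \<Longrightarrow> FT (\<lambda>x. f x - g x) \<xi> = FT f \<xi> - FT g \<xi>"
  unfolding FT_def by (simp add: right_diff_distrib FT_integrand_integrable)

lemma FT_cmult: "FT (\<lambda>x. c * f x) \<xi> = c * FT f \<xi>"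
proof -
  have "(LINT x|lborel. cis (- (x * \<xi>)) * (c * f x)) = (LINT x|lborel. c * (cis (- (x * \<xi>)) * f x))"
    by (simp add: mult_ac)
  then show ?thesis unfolding FT_def by simp
qed

text \<open>The integrability condition of Fubini for a bounded kernel acting between two
  integrable functions; it serves both the Fourier kernel and the kernel \<open>sgn (x -
  y)\<close>.\<close>
lemma integrable_pair_bounded:
  fixes f g :: "real \<Rightarrow> complex" and k :: "real \<times> real \<Rightarrow> complex"
  assumes f: "integrable lborel f" and g: "integrable lborel g"
    and [measurable]: "k \<in> borel_measurable (borel \<Otimes>\<^sub>M borel)" and k: "\<And>z. cmod (k z) \<le> B"
  shows "integrable (lborel \<Otimes>\<^sub>M lborel) (\<lambda>(x, y). k (x, y) * (f x * g y))"
proof (rule Bochner_Integration.integrable_bound)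
  note [measurable] = borel_measurable_integrable[OF f] borel_measurable_integrable[OF g]
  have B: "0 \<le> B" using k[of undefined] norm_ge_zero order_trans by blast
  show "integrable (lborel \<Otimes>\<^sub>M lborel) (\<lambda>(x, y). B *\<^sub>R (f x * g y))"
  proof (rule lborel_pair.Fubini_integrable)
    show "integrable lborel (\<lambda>x. LINT y|lborel. norm (case (x, y) of (x, y) \<Rightarrow> B *\<^sub>R (f x * g y)))"
      using f by (simp add: norm_mult)
    show "AE x in lborel. integrable lborel (\<lambda>y. case (x, y) of (x, y) \<Rightarrow> B *\<^sub>R (f x * g y))"
      using g by simp
  qed measurable
  show "(\<lambda>(x, y). k (x, y) * (f x * g y)) \<in> borel_measurable (lborel \<Otimes>\<^sub>M lborel)"
    by measurable
  show "AE z in lborel \<Otimes>\<^sub>M lborel. norm (case z of (x, y) \<Rightarrow> k (x, y) * (f x * g y)) \<le> norm (case z of (x, y) \<Rightarrow> B *\<^sub>R (f x * g y))"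
    using k B by (intro always_eventually allI) (auto simp: norm_mult split: prod.split intro!: mult_right_mono)
qed

lemma FT_mult_integrable:
  assumes f: "integrable lborel f" and g: "integrable lborel g"
  shows "integrable lborel (\<lambda>\<xi>. FT f \<xi> * g \<xi>)"
proof (rule Bochner_Integration.integrable_bound)
  let ?B = "(1 / sqrt (2 * pi)) * (LINT x|lborel. cmod (f x))"
  show "integrable lborel (\<lambda>\<xi>. ?B *\<^sub>R g \<xi>)" using g by simp
  note [measurable] = borel_measurable_integrable[OF f] borel_measurable_integrable[OF g]
  show "(\<lambda>\<xi>. FT f \<xi> * g \<xi>) \<in> borel_measurable lborel" by measurable
  show "AE \<xi> in lborel. norm (FT f \<xi> * g \<xi>) \<le> norm (?B *\<^sub>R g \<xi>)"
  proof (rule AE_I2)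
    fix \<xi>
    have "norm (FT f \<xi> * g \<xi>) \<le> ?B * norm (g \<xi>)"
      using FT_bound[of f \<xi>] by (simp only: norm_mult) (intro mult_right_mono, auto)
    also have "\<dots> = norm (?B *\<^sub>R g \<xi>)" by simp
    finally show "norm (FT f \<xi> * g \<xi>) \<le> norm (?B *\<^sub>R g \<xi>)" .
  qed
qed

text \<open>The kernel \<open>cis (- (x * \<xi>))\<close> is symmetric in \<open>x\<close> and
  \<open>\<xi>\<close>, so Fubini moves the transform from one factor to the other.\<close>
lemma FT_multiplication_formula:
  assumes f: "integrable lborel f" and g: "integrable lborel g"
  shows "(LINT \<xi>|lborel. FT f \<xi> * g \<xi>) = (LINT x|lborel. f x * FT g x)"
proof -
  let ?c = "complex_of_real (1 / sqrt (2 * pi))"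
  have "integrable (lborel \<Otimes>\<^sub>M lborel) (\<lambda>(x, y). (\<lambda>(x, y). ?c * cis (- (x * y))) (x, y) * (f x * g y))"
    by (rule integrable_pair_bounded[OF f g, where B="1 / sqrt (2 * pi)"]) (auto simp: norm_mult norm_divide)
  then have i: "integrable (lborel \<Otimes>\<^sub>M lborel) (\<lambda>(x, y). ?c * cis (- (x * y)) * (f x * g y))" by simp
  have "(LINT \<xi>|lborel. FT f \<xi> * g \<xi>) = (LINT \<xi>|lborel. (LINT x|lborel. ?c * cis (- (x * \<xi>)) * (f x * g \<xi>)))"
    unfolding FT_def integral_mult_left_zero[symmetric] integral_mult_right_zero[symmetric]
    by (intro Bochner_Integration.integral_cong) (auto simp: mult_ac)
  also have "\<dots> = (LINT x|lborel. (LINT \<xi>|lborel. ?c * cis (- (x * \<xi>)) * (f x * g \<xi>)))"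
    by (rule lborel_pair.Fubini_integral[OF i])
  also have "\<dots> = (LINT x|lborel. f x * FT g x)"
    unfolding FT_def integral_mult_left_zero[symmetric] integral_mult_right_zero[symmetric]
    by (intro Bochner_Integration.integral_cong) (auto simp: mult_ac)
  finally show ?thesis .
qed

lemma cnj_FT: "cnj (FT f \<xi>) = FT (\<lambda>x. cnj (f x)) (- \<xi>)"
proof -
  have "cnj (LINT x|lborel. cis (- (x * \<xi>)) * f x) = (LINT x|lborel. cnj (cis (- (x * \<xi>)) * f x))"
    by (rule Bochner_Integration.integral_cnj[symmetric])
  then show ?thesis unfolding FT_def by (simp add: cis_cnj)
qed

section \<open>The Plancherel identity by Gaussian regularisation\<close>

text \<open>The characteristic function of the standard normal distribution, rescaled by
  \<open>s\<close>.\<close>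
lemma Gaussian_FT:
  assumes s: "0 < s"
  shows "(LINT \<xi>|lborel. cis (z * \<xi>) * complex_of_real (exp (- (s * \<xi>)\<^sup>2 / 2))) = 
     complex_of_real (2 * pi / s * std_normal_density (z / s))"
proof -
  have "complex_of_real (exp (- (z/s)\<^sup>2 / 2)) = char std_normal_distribution (z / s)"
    by (simp add: char_std_normal_distribution)
  also have "\<dots> = (LINT x|lborel. std_normal_density x *\<^sub>R exp (\<i> * (complex_of_real (z / s) * complex_of_real x)))"
    unfolding char_def by (subst integral_density) auto
  also have "\<dots> = \<bar>s\<bar> *\<^sub>R (LINT x|lborel. std_normal_density (0 + s * x) *\<^sub>R exp (\<i> * (complex_of_real (z / s) * complex_of_real (0 + s * x))))"
    using s by (subst lborel_integral_real_affine[where c=s and t=0]) auto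
  also have "\<dots> = s *\<^sub>R (LINT x|lborel. complex_of_real (1 / sqrt (2 * pi)) * (cis (z * x) * complex_of_real (exp (- (s * x)\<^sup>2 / 2))))"
    using s by (auto simp: std_normal_density_def cis_conv_exp scaleR_conv_of_real mult_ac intro!: Bochner_Integration.integral_cong)
  also have "\<dots> = complex_of_real (s / sqrt (2 * pi)) * (LINT x|lborel. (cis (z * x) * complex_of_real (exp (- (s * x)\<^sup>2 / 2))))"
    by (simp add: scaleR_conv_of_real)
  finally have eq: "complex_of_real (exp (- (z/s)\<^sup>2 / 2)) = complex_of_real (s / sqrt (2 * pi)) * (LINT x|lborel. (cis (z * x) * complex_of_real (exp (- (s * x)\<^sup>2 / 2))))" .
  have "complex_of_real (2 * pi / s * std_normal_density (z / s)) = complex_of_real (sqrt (2 * pi) / s) * complex_of_real (exp (- (z/s)\<^sup>2 / 2))"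
  proof -
    have "sqrt (2 * pi) * sqrt (2 * pi) = 2 * pi" by simp
    then have "2 * pi / s * std_normal_density (z / s) = sqrt (2 * pi) / s * exp (- (z/s)\<^sup>2 / 2)"
      unfolding std_normal_density_def using s by (simp add: divide_simps mult.assoc)
    then show ?thesis by (simp only: of_real_mult)
  qed
  also have "\<dots> = (LINT x|lborel. (cis (z * x) * complex_of_real (exp (- (s * x)\<^sup>2 / 2))))"
  proof -
    have "sqrt (2 * pi) / s * (s / sqrt (2 * pi)) = 1" using s by simp
    then have "complex_of_real (sqrt (2 * pi) / s) * complex_of_real (s / sqrt (2 * pi)) = 1"
      unfolding of_real_mult[symmetric] by simp
    then show ?thesis unfolding eq mult.assoc[symmetric] by simp
  qed
  finally show ?thesis by simp
qed

lemma Gaussian_integrable: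
  assumes s: "0 < s"
  shows "integrable lborel (\<lambda>\<xi>. complex_of_real (exp (- (s * \<xi>)\<^sup>2 / 2)))"
proof -
  have "integrable lborel (\<lambda>x. sqrt (2 * pi) * std_normal_density (0 + s * x))"
    using s by (intro integrable_mult_right, subst lborel_integrable_real_affine_iff) auto
  then have "integrable lborel (\<lambda>\<xi>. exp (- (s * \<xi>)\<^sup>2 / 2))"
    by (simp add: std_normal_density_def)
  then show ?thesis by (rule integrable_of_real)
qed

text \<open>Two applications of the multiplication formula move both transforms onto the Gaussian
  weight, whose transform is again Gaussian. After the substitution \<open>y = x + s z\<close> the
  right-hand side averages the autocorrelation of \<open>f\<close> at \<open>s z\<close> over the
  standard normal density in \<open>z\<close>, which is the form in which \<open>s\<close> can
  tend to 0.\<close>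
lemma FT_Gaussian_quadratic:
  assumes f: "integrable lborel f" and s: "0 < s"
  shows "(LINT \<xi>|lborel. FT f \<xi> * (cnj (FT f \<xi>) * complex_of_real (exp (- (s * \<xi>)\<^sup>2 / 2)))) =
    (LINT x|lborel. LINT z|lborel. cnj (f (x + s * z)) * (f x * complex_of_real (std_normal_density z)))"
proof -
  let ?w = "\<lambda>\<xi>. complex_of_real (exp (- (s * \<xi>)\<^sup>2 / 2))"
  let ?c = "complex_of_real (1 / sqrt (2 * pi))"
  let ?g = "\<lambda>\<xi>. cnj (FT f \<xi>) * ?w \<xi>"
  have fm[measurable]: "f \<in> borel_measurable borel" using borel_measurable_integrable[OF f] by simp
  have cf: "integrable lborel (\<lambda>x. cnj (f x))" using f by simp
  have wi: "integrable lborel ?w" by (rule Gaussian_integrable[OF s])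
  have "integrable lborel (\<lambda>\<xi>. cnj (FT f \<xi> * ?w \<xi>))"
    by (rule integrable_cnj[OF FT_mult_integrable[OF f wi]])
  then have gi: "integrable lborel ?g" by (simp del: complex_integrable_cnj)
  have key: "FT ?g x = (LINT z|lborel. cnj (f (x + s * z)) * complex_of_real (std_normal_density z))" for x
  proof -
    have wci: "integrable lborel (\<lambda>\<xi>. cis (x * \<xi>) * ?w \<xi>)"
      by (rule integrable_unimodular_mult[OF wi]) auto
    have FTw: "FT (\<lambda>\<xi>. cis (x * \<xi>) * ?w \<xi>) y = ?c * complex_of_real (2 * pi / s * std_normal_density ((x - y) / s))" for y
      unfolding Gaussian_FT[OF s, symmetric] FT_def
      by (simp add: cis_mult mult.assoc[symmetric] algebra_simps)
    have "FT ?g x = ?c * (LINT \<xi>|lborel. cis (- (\<xi> * x)) * (FT (\<lambda>x. cnj (f x)) (- \<xi>) * ?w \<xi>))"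
      unfolding cnj_FT[symmetric] by (rule FT_def)
    also have "\<dots> = ?c * (LINT \<xi>|lborel. cis (\<xi> * x) * (FT (\<lambda>x. cnj (f x)) \<xi> * ?w \<xi>))"
      by (subst lborel_integral_real_affine[where c="-1" and t=0]) auto
    also have "\<dots> = ?c * (LINT \<xi>|lborel. FT (\<lambda>x. cnj (f x)) \<xi> * (cis (x * \<xi>) * ?w \<xi>))"
      by (simp add: mult_ac)
    also have "\<dots> = ?c * (LINT y|lborel. cnj (f y) * (?c * complex_of_real (2 * pi / s * std_normal_density ((x - y) / s))))"
      unfolding FT_multiplication_formula[OF cf wci] FTw by simp
    also have "\<dots> = (LINT y|lborel. ?c * (cnj (f y) * (?c * complex_of_real (2 * pi / s * std_normal_density ((x - y) / s)))))"
      by (rule integral_mult_right_zero[symmetric])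
    also have "\<dots> = (LINT y|lborel. cnj (f y) * (complex_of_real (1 / s) * complex_of_real (std_normal_density ((x - y) / s))))"
    proof (intro Bochner_Integration.integral_cong refl)
      fix y
      have "?c * ?c = complex_of_real (1 / (2 * pi))" by (simp flip: of_real_mult)
      then have "?c * (?c * complex_of_real (2 * pi / s * std_normal_density ((x - y) / s))) = 
         complex_of_real (1 / s * std_normal_density ((x - y) / s))"
        unfolding mult.assoc[symmetric] by (simp only: of_real_mult[symmetric]) simp
      then show "?c * (cnj (f y) * (?c * complex_of_real (2 * pi / s * std_normal_density ((x - y) / s)))) =
        cnj (f y) * (complex_of_real (1 / s) * complex_of_real (std_normal_density ((x - y) / s)))"
        by (metis mult.left_commute of_real_mult)
    qed
    also have "\<dots> = \<bar>s\<bar> *\<^sub>R (LINT z|lborel. cnj (f (x + s * z)) * (complex_of_real (1 / s) * complex_of_real (std_normal_density ((x - (x + s * z)) / s))))"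
      using s by (subst lborel_integral_real_affine[where c=s and t=x]) auto
    also have "\<dots> = (LINT z|lborel. s *\<^sub>R (cnj (f (x + s * z)) * (complex_of_real (1 / s) * complex_of_real (std_normal_density ((x - (x + s * z)) / s)))))"
      using s by simp
    also have "\<dots> = (LINT z|lborel. cnj (f (x + s * z)) * complex_of_real (std_normal_density z))"
      using s by (intro Bochner_Integration.integral_cong refl) (simp add: scaleR_conv_of_real std_normal_density_def)
    finally show ?thesis .
  qed
  have "(LINT \<xi>|lborel. FT f \<xi> * ?g \<xi>) = (LINT x|lborel. f x * FT ?g x)"
    by (rule FT_multiplication_formula[OF f gi])
  also have "\<dots> = (LINT x|lborel. LINT z|lborel. f x * (cnj (f (x + s * z)) * complex_of_real (std_normal_density z)))"
    unfolding key by simp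
  also have "\<dots> = (LINT x|lborel. LINT z|lborel. cnj (f (x + s * z)) * (f x * complex_of_real (std_normal_density z)))"
    by (intro Bochner_Integration.integral_cong refl) (simp add: mult_ac)
  finally show ?thesis .
qed

text \<open>Let \<open>s\<close> tend to 0 in \<open>FT_Gaussian_quadratic\<close>. The weights on
  the left increase to 1. On the right the autocorrelation is continuous at 0, because
  \<open>f\<close> is bounded and translations are continuous in L1, and its value at 0 is the
  squared norm of \<open>f\<close>.\<close>
lemma Plancherel_bounded:
  assumes f: "integrable lborel f" and B: "\<And>x. cmod (f x) \<le> B"
  shows "f \<in> L2 \<and> FT f \<in> L2 \<and> nrm (FT f) = nrm f"
proof -
  have fm[measurable]: "f \<in> borel_measurable borel" using borel_measurable_integrable[OF f] by simp
  have B0: "0 \<le> B" using B[of 0] norm_ge_zero order_trans by blast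
  have fL: "f \<in> L2"
    unfolding L2_iff
  proof
    show "integrable lborel (\<lambda>x. (cmod (f x))\<^sup>2)"
    proof (rule Bochner_Integration.integrable_bound)
      show "integrable lborel (\<lambda>x. B * cmod (f x))" using f by simp
      show "AE x in lborel. norm ((cmod (f x))\<^sup>2) \<le> norm (B * cmod (f x))"
        using B B0 by (auto simp: power2_eq_square abs_mult intro!: mult_right_mono)
    qed simp
  qed simp
  \<comment> \<open>the autocorrelation of \<open>f\<close> and the Gaussian-weighted squared
    norm of its transform\<close>
  define A where "A t = (LINT x|lborel. cnj (f (x + t)) * f x)" for t
  define I where "I s = (LINT \<xi>|lborel. (cmod (FT f \<xi>))\<^sup>2 * exp (- (s * \<xi>)\<^sup>2 / 2))" for s :: real
  have bi: "integrable lborel (\<lambda>x. cnj (f (x + t)) * f x)" for t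
  proof (rule Bochner_Integration.integrable_bound)
    show "integrable lborel (\<lambda>x. B *\<^sub>R f x)" using f by simp
    show "AE x in lborel. norm (cnj (f (x + t)) * f x) \<le> norm (B *\<^sub>R f x)"
      using B B0 by (auto simp: norm_mult intro!: mult_right_mono)
  qed simp
  have A0: "A 0 = complex_of_real ((nrm f)\<^sup>2)"
  proof -
    have "A 0 = (LINT x|lborel. complex_of_real ((cmod (f x))\<^sup>2))"
      unfolding A_def by (intro Bochner_Integration.integral_cong refl) (simp add: complex_norm_square mult.commute del: of_real_power)
    then show ?thesis by (simp add: nrm_sq del: of_real_power)
  qed
  have Abound: "cmod (A t) \<le> B * (LINT x|lborel. cmod (f x))" for t
  proof -
    have "cmod (A t) \<le> (LINT x|lborel. cmod (cnj (f (x + t)) * f x))"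
      unfolding A_def by (rule integral_norm_bound)
    also have "\<dots> \<le> (LINT x|lborel. B * cmod (f x))"
      using integrable_norm[OF bi[of t]] f B by (intro integral_mono) (auto simp: norm_mult intro!: mult_right_mono)
    finally show ?thesis by simp
  qed
  have Acont: "(\<lambda>n. A (X n)) \<longlonglongrightarrow> A 0" if X: "X \<longlonglongrightarrow> 0" for X :: "nat \<Rightarrow> real"
  proof -
    have lim: "(\<lambda>n. B * (LINT x|lborel. cmod (f (x + X n) - f x))) \<longlonglongrightarrow> 0"
      using tendsto_mult[OF tendsto_const L1_translation_continuous[OF f X], of B] by simp
    have "(\<lambda>n. A (X n) - A 0) \<longlonglongrightarrow> 0"
    proof (rule Lim_null_comparison[OF always_eventually lim], rule allI)
      fix n
      note sh = integrable_shift[OF f, of "X n"]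
      have "A (X n) - A 0 = (LINT x|lborel. cnj (f (x + X n)) * f x - cnj (f (x + 0)) * f x)"
        unfolding A_def using bi[of "X n"] bi[of 0] by (simp only: Bochner_Integration.integral_diff)
      also have "cmod \<dots> \<le> (LINT x|lborel. cmod (cnj (f (x + X n)) * f x - cnj (f (x + 0)) * f x))"
        by (rule integral_norm_bound)
      also have "\<dots> \<le> (LINT x|lborel. B * cmod (f (x + X n) - f x))"
      proof (rule integral_mono)
        fix x
        have "cnj (f (x + X n)) * f x - cnj (f (x + 0)) * f x = cnj (f (x + X n) - f x) * f x"
          by (simp add: algebra_simps)
        then have "cmod (cnj (f (x + X n)) * f x - cnj (f (x + 0)) * f x) = cmod (f x) * cmod (f (x + X n) - f x)"
          by (metis complex_mod_cnj mult.commute norm_mult)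
        also have "\<dots> \<le> B * cmod (f (x + X n) - f x)" using B by (intro mult_right_mono) auto
        finally show "cmod (cnj (f (x + X n)) * f x - cnj (f (x + 0)) * f x) \<le> B * cmod (f (x + X n) - f x)" .
      qed (use f sh bi[of "X n"] bi[of 0] in \<open>auto intro!: Bochner_Integration.integrable_diff integrable_norm\<close>)
      finally show "norm (A (X n) - A 0) \<le> B * (LINT x|lborel. cmod (f (x + X n) - f x))" by simp
    qed
    then show ?thesis by (simp add: LIM_zero_iff)
  qed
  have IA: "complex_of_real (I s) = (LINT z|lborel. complex_of_real (std_normal_density z) * A (s * z))" if s: "0 < s" for s
  proof -
    have phi: "integrable lborel (\<lambda>z. complex_of_real (std_normal_density z))" by simp
    have "integrable (lborel \<Otimes>\<^sub>M lborel) (\<lambda>(x, z). (\<lambda>(x, z). cnj (f (x + s * z))) (x, z) * (f x * complex_of_real (std_normal_density z)))"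
      by (rule integrable_pair_bounded[OF f phi, where B=B]) (auto simp: B)
    then have i: "integrable (lborel \<Otimes>\<^sub>M lborel) (\<lambda>(x, z). cnj (f (x + s * z)) * (f x * complex_of_real (std_normal_density z)))" by simp
    have "complex_of_real (I s) = (LINT \<xi>|lborel. FT f \<xi> * (cnj (FT f \<xi>) * complex_of_real (exp (- (s * \<xi>)\<^sup>2 / 2))))"
      unfolding I_def integral_complex_of_real[symmetric]
      by (intro Bochner_Integration.integral_cong refl) (simp add: complex_norm_square mult.assoc del: of_real_power)
    also have "\<dots> = (LINT x|lborel. LINT z|lborel. cnj (f (x + s * z)) * (f x * complex_of_real (std_normal_density z)))"
      by (rule FT_Gaussian_quadratic[OF f s])
    also have "\<dots> = (LINT z|lborel. LINT x|lborel. cnj (f (x + s * z)) * (f x * complex_of_real (std_normal_density z)))"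
      by (rule lborel_pair.Fubini_integral[OF i, symmetric])
    also have "\<dots> = (LINT z|lborel. complex_of_real (std_normal_density z) * A (s * z))"
      unfolding A_def integral_mult_right_zero[symmetric]
      by (intro Bochner_Integration.integral_cong refl) (simp add: mult_ac)
    finally show ?thesis .
  qed
  define r where "r n = 1 / real (Suc n)" for n
  have r: "0 < r n" "r \<longlonglongrightarrow> 0" "r (Suc n) \<le> r n" for n
    unfolding r_def using LIMSEQ_inverse_real_of_nat by (auto simp: inverse_eq_divide field_simps)
  have rdec: "decseq r" using r(3) by (rule decseq_SucI)
  have "(\<lambda>n. LINT z|lborel. complex_of_real (std_normal_density z) * A (r n * z)) \<longlonglongrightarrow> (LINT z|lborel. complex_of_real (std_normal_density z) * A 0)"
  proof (rule integral_dominated_convergence[where w="\<lambda>z. std_normal_density z * (B * (LINT x|lborel. cmod (f x)))"])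
    have [measurable]: "A \<in> borel_measurable borel" unfolding A_def by measurable
    show "(\<lambda>z. complex_of_real (std_normal_density z) * A (r n * z)) \<in> borel_measurable lborel" for n by measurable
    show "AE z in lborel. (\<lambda>n. complex_of_real (std_normal_density z) * A (r n * z)) \<longlonglongrightarrow> complex_of_real (std_normal_density z) * A 0"
    proof (rule AE_I2)
      fix z :: real
      have "(\<lambda>n. r n * z) \<longlonglongrightarrow> 0" using tendsto_mult[OF r(2) tendsto_const[of z]] by simp
      then show "(\<lambda>n. complex_of_real (std_normal_density z) * A (r n * z)) \<longlonglongrightarrow> complex_of_real (std_normal_density z) * A 0"
        by (intro tendsto_intros Acont)
    qed
    show "AE z in lborel. norm (complex_of_real (std_normal_density z) * A (r n * z)) \<le> std_normal_density z * (B * (LINT x|lborel. cmod (f x)))" for n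
      using Abound by (intro AE_I2) (auto simp: norm_mult intro!: mult_left_mono)
  qed auto
  moreover have "(LINT z|lborel. complex_of_real (std_normal_density z) * A 0) = A 0"
    by (simp add: integral_complex_of_real)
  ultimately have "(\<lambda>n. complex_of_real (I (r n))) \<longlonglongrightarrow> complex_of_real ((nrm f)\<^sup>2)"
    using IA[OF r(1)] A0 by simp
  then have Ilim: "(\<lambda>n. I (r n)) \<longlonglongrightarrow> (nrm f)\<^sup>2"
    by (simp add: tendsto_of_real_iff del: of_real_power)
  have Ii: "integrable lborel (\<lambda>\<xi>. (cmod (FT f \<xi>))\<^sup>2 * exp (- (r n * \<xi>)\<^sup>2 / 2))" for n
  proof -
    have "integrable lborel (\<lambda>\<xi>. FT f \<xi> * (cnj (FT f \<xi>) * complex_of_real (exp (- (r n * \<xi>)\<^sup>2 / 2))))"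
    proof (rule FT_mult_integrable[OF f])
      have "integrable lborel (\<lambda>\<xi>. cnj (FT f \<xi> * complex_of_real (exp (- (r n * \<xi>)\<^sup>2 / 2))))"
        using FT_mult_integrable[OF f Gaussian_integrable[OF r(1)[of n]]] by (simp del: complex_cnj_mult)
      then show "integrable lborel (\<lambda>\<xi>. cnj (FT f \<xi>) * complex_of_real (exp (- (r n * \<xi>)\<^sup>2 / 2)))" by (simp del: complex_integrable_cnj)
    qed
    from integrable_norm[OF this] show ?thesis by (simp add: norm_mult power2_eq_square mult.assoc)
  qed
  have "integrable lborel (\<lambda>\<xi>. (cmod (FT f \<xi>))\<^sup>2) \<and> (LINT \<xi>|lborel. (cmod (FT f \<xi>))\<^sup>2) = (nrm f)\<^sup>2"
  proof -
    have mon: "AE \<xi> in lborel. mono (\<lambda>n. (cmod (FT f \<xi>))\<^sup>2 * exp (- (r n * \<xi>)\<^sup>2 / 2))"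
    proof (rule AE_I2, rule incseq_SucI)
      fix \<xi> n
      have "(r (Suc n) * \<xi>)\<^sup>2 \<le> (r n * \<xi>)\<^sup>2"
        unfolding power_mult_distrib using r(1)[of "Suc n"] r(3)[of n]
        by (intro mult_right_mono power_mono) auto
      then show "(cmod (FT f \<xi>))\<^sup>2 * exp (- (r n * \<xi>)\<^sup>2 / 2) \<le> (cmod (FT f \<xi>))\<^sup>2 * exp (- (r (Suc n) * \<xi>)\<^sup>2 / 2)"
        by (intro mult_left_mono) auto
    qed
    have lim: "AE \<xi> in lborel. (\<lambda>n. (cmod (FT f \<xi>))\<^sup>2 * exp (- (r n * \<xi>)\<^sup>2 / 2)) \<longlonglongrightarrow> (cmod (FT f \<xi>))\<^sup>2"
    proof (rule AE_I2)
      fix \<xi>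
      have "(\<lambda>n. (cmod (FT f \<xi>))\<^sup>2 * exp (- (r n * \<xi>)\<^sup>2 / 2)) \<longlonglongrightarrow> (cmod (FT f \<xi>))\<^sup>2 * exp (- (0 * \<xi>)\<^sup>2 / 2)"
        by (intro tendsto_intros r(2)) auto
      then show "(\<lambda>n. (cmod (FT f \<xi>))\<^sup>2 * exp (- (r n * \<xi>)\<^sup>2 / 2)) \<longlonglongrightarrow> (cmod (FT f \<xi>))\<^sup>2" by simp
    qed
    show ?thesis
      using integrable_monotone_convergence[OF Ii mon lim Ilim[unfolded I_def]] 
        integral_monotone_convergence[OF Ii mon lim Ilim[unfolded I_def]] by simp
  qed
  then show ?thesis using fL nrm_nonneg unfolding nrm_def[of "FT f"] L2_iff by simp
qed

text \<open>Set \<open>f\<close> to 0 where its modulus exceeds \<open>n\<close>. The transforms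
  converge pointwise, and by the bounded case they are Cauchy in L2; Fatou identifies the two
  limits.\<close>
lemma Plancherel_L1_L2:
  assumes f: "integrable lborel f" and fL: "f \<in> L2"
  shows "FT f \<in> L2 \<and> nrm (FT f) = nrm f"
proof -
  note [measurable] = fL
  define g where "g n x = (if cmod (f x) \<le> real n then f x else 0)" for n :: nat and x
  have gm[measurable]: "g n \<in> borel_measurable borel" for n unfolding g_def by measurable
  have gf: "cmod (g n x) \<le> cmod (f x)" for n x unfolding g_def by auto
  have gi: "integrable lborel (g n)" for n
    by (rule Bochner_Integration.integrable_bound[OF f]) (use gf in auto)
  have gB: "cmod (g n x) \<le> real n" for n x unfolding g_def by auto
  have gL: "g n \<in> L2" for n using Plancherel_bounded[OF gi gB] by blast
  have glim: "(\<lambda>n. g n x) \<longlonglongrightarrow> f x" for x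
  proof (rule tendsto_eventually)
    obtain N where "cmod (f x) \<le> real N" using real_arch_simple by blast
    then show "\<forall>\<^sub>F n in sequentially. g n x = f x"
      unfolding g_def by (intro eventually_sequentiallyI[of N]) auto
  qed
  have gnlim: "(\<lambda>n. nrm (\<lambda>x. g n x - f x)) \<longlonglongrightarrow> 0"
  proof (rule nrm_dominated_convergence[where g="\<lambda>x. 2 * f x"])
    show "AE x in lborel. (\<lambda>n. g n x - f x) \<longlonglongrightarrow> 0"
      by (intro AE_I2) (use glim in \<open>auto intro: LIM_zero\<close>)
    show "AE x in lborel. cmod (g n x - f x) \<le> cmod (2 * f x)" for n
      unfolding g_def by (intro AE_I2) (auto simp: norm_mult)
  qed (use fL in auto)
  have Flim: "(\<lambda>n. FT (g n) \<xi>) \<longlonglongrightarrow> FT f \<xi>" for \<xi>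
    unfolding FT_def
  proof (intro tendsto_mult tendsto_const integral_dominated_convergence[where w="\<lambda>x. cmod (f x)"])
    show "AE x in lborel. (\<lambda>n. cis (- (x * \<xi>)) * g n x) \<longlonglongrightarrow> cis (- (x * \<xi>)) * f x"
      by (intro AE_I2 tendsto_intros glim)
    show "AE x in lborel. norm (cis (- (x * \<xi>)) * g n x) \<le> cmod (f x)" for n
      using gf by (simp add: norm_mult)
  qed (use f in auto)
  have iso: "nrm (\<lambda>\<xi>. FT (g n) \<xi> - FT (g m) \<xi>) = nrm (\<lambda>x. g n x - g m x)" for n m
  proof -
    have b: "cmod (g n x - g m x) \<le> real n + real m" for x
      using gB[of n x] gB[of m x] norm_triangle_ineq4[of "g n x" "g m x"] by linarith
    have *: "nrm (FT (\<lambda>x. g n x - g m x)) = nrm (\<lambda>x. g n x - g m x)"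
      using Plancherel_bounded[OF Bochner_Integration.integrable_diff[OF gi gi] b] by blast
    show ?thesis proof -
      have "FT (\<lambda>x. g n x - g m x) = (\<lambda>\<xi>. FT (g n) \<xi> - FT (g m) \<xi>)"
        using FT_diff[OF gi[of n] gi[of m]] by (rule ext)
      with * show ?thesis by simp
    qed
  qed
  have FgL: "FT (g n) \<in> L2" "nrm (FT (g n)) = nrm (g n)" for n using Plancherel_bounded[OF gi gB] by blast+
  have fat: "(\<lambda>\<xi>. FT (g n) \<xi> - FT f \<xi>) \<in> L2 \<and> nrm (\<lambda>\<xi>. FT (g n) \<xi> - FT f \<xi>) \<le> e"
    if e: "\<And>m. m \<ge> n \<Longrightarrow> nrm (\<lambda>x. g n x - g m x) \<le> e" for n e
  proof (rule nrm_Fatou[where f="\<lambda>m \<xi>. FT (g n) \<xi> - FT (g (m + n)) \<xi>"])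
    show "AE x in lborel. (\<lambda>m. FT (g n) x - FT (g (m + n)) x) \<longlonglongrightarrow> FT (g n) x - FT f x"
      by (intro AE_I2 tendsto_intros LIMSEQ_ignore_initial_segment Flim)
    show "nrm (\<lambda>\<xi>. FT (g n) \<xi> - FT (g (m + n)) \<xi>) \<le> e" for m
      unfolding iso by (rule e) simp
  qed (use FgL in auto)
  have FlimL: "(\<lambda>n. nrm (\<lambda>\<xi>. FT (g n) \<xi> - FT f \<xi>)) \<longlonglongrightarrow> 0"
  proof (rule LIMSEQ_I)
    fix e :: real assume e: "e > 0"
    obtain N where N: "\<And>n. n \<ge> N \<Longrightarrow> nrm (\<lambda>x. g n x - f x) < e / 4"
      using LIMSEQ_D[OF gnlim, of "e/4"] e by auto
    have "nrm (\<lambda>\<xi>. FT (g n) \<xi> - FT f \<xi>) < e" if n: "n \<ge> N" for n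
    proof -
      have "nrm (\<lambda>x. g n x - g m x) \<le> e / 2" if "m \<ge> n" for m
        using nrm_triangle3[OF gL[of n] fL gL[of m]] N[of n] N[of m] n that nrm_minus_commute[of f "g m"] by linarith
      then show ?thesis using fat[of n "e/2"] e by auto
    qed
    then show "\<exists>N. \<forall>n\<ge>N. norm (nrm (\<lambda>\<xi>. FT (g n) \<xi> - FT f \<xi>) - 0) < e" by auto
  qed
  have FL: "FT f \<in> L2"
  proof -
    have "nrm (\<lambda>x. g 0 x - g m x) \<le> nrm (g 0) + nrm f" for m
      using nrm_triangle_diff[OF gL[of 0] gL[of m]] nrm_mono[OF fL gm[of m]] gf[of m] by force
    then have "(\<lambda>\<xi>. FT (g 0) \<xi> - FT f \<xi>) \<in> L2" using fat[of 0] by blast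
    from L2_diff[OF FgL(1)[of 0] this] show ?thesis by simp
  qed
  have "(\<lambda>n. nrm (FT (g n))) \<longlonglongrightarrow> nrm (FT f)"
    by (rule nrm_tendsto[OF FlimL FL]) (use FgL in auto)
  moreover have "(\<lambda>n. nrm (FT (g n))) \<longlonglongrightarrow> nrm f"
    unfolding FgL(2) by (rule nrm_tendsto[OF gnlim fL]) (use gL in auto)
  ultimately show ?thesis using FL LIMSEQ_unique by blast
qed

section \<open>The Fourier--Plancherel transform\<close>

text \<open>On the Fourier side the same operation is the sharp frequency cutoff.\<close>
definition trunc :: "real \<Rightarrow> (real \<Rightarrow> complex) \<Rightarrow> (real \<Rightarrow> complex)" where
  "trunc R f x = indicator {-R..R} x * f x"

lemma trunc_L2 [intro]: "f \<in> L2 \<Longrightarrow> trunc R f \<in> L2"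
  unfolding trunc_def[abs_def] by (rule L2_indicator) auto

lemma indicator_Icc_L2: "(\<lambda>x. indicator {a..b::real} x) \<in> L2"
proof -
  have "integrable lborel (indicat_real {a..b})"
    by (intro integrable_real_indicator) (auto simp: emeasure_lborel_Icc_eq)
  moreover have "(\<lambda>x. (cmod (indicator {a..b} x))\<^sup>2) = indicat_real {a..b}"
    by (auto simp: indicator_def)
  ultimately show ?thesis by (simp add: L2_iff)
qed

lemma trunc_integrable: "f \<in> L2 \<Longrightarrow> integrable lborel (trunc R f)"
  unfolding trunc_def[abs_def] by (intro L2_mult_integrable indicator_Icc_L2)

lemma trunc_tendsto:
  assumes f: "f \<in> L2"
  shows "((\<lambda>R. nrm (\<lambda>x. f x - trunc R f x)) \<longlongrightarrow> 0) at_top"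
proof (rule tendsto_at_topI_sequentially)
  fix X :: "nat \<Rightarrow> real" assume X: "filterlim X at_top sequentially"
  show "(\<lambda>n. nrm (\<lambda>x. f x - trunc (X n) f x)) \<longlonglongrightarrow> 0"
  proof (rule nrm_dominated_convergence[OF f])
    show "(\<lambda>x. f x - trunc (X n) f x) \<in> borel_measurable borel" for n
      by (intro L2_measurable L2_diff f trunc_L2)
    show "AE x in lborel. (\<lambda>n. f x - trunc (X n) f x) \<longlonglongrightarrow> 0"
    proof (rule AE_I2)
      fix x :: real
      have "\<forall>\<^sub>F n in sequentially. \<bar>x\<bar> \<le> X n" using X by (simp add: filterlim_at_top)
      then have "\<forall>\<^sub>F n in sequentially. f x - trunc (X n) f x = 0"
        by (rule eventually_mono) (auto simp: trunc_def abs_le_iff)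
      then show "(\<lambda>n. f x - trunc (X n) f x) \<longlonglongrightarrow> 0" by (rule tendsto_eventually)
    qed
    show "AE x in lborel. cmod (f x - trunc (X n) f x) \<le> cmod (f x)" for n
      by (rule AE_I2) (simp add: trunc_def indicator_def)
  qed
qed

lemma FT_trunc_L2: "f \<in> L2 \<Longrightarrow> FT (trunc R f) \<in> L2"
  using Plancherel_L1_L2[OF trunc_integrable trunc_L2] by blast

lemma has_fourier_iff: "has_fourier f F \<longleftrightarrow> f \<in> L2 \<and> F \<in> L2 \<and> 
  ((\<lambda>R. nrm (\<lambda>\<xi>. F \<xi> - FT (trunc R f) \<xi>)) \<longlongrightarrow> 0) at_top"
proof -
  have eq: "complex_of_real (1 / sqrt (2 * pi)) * (LINT x:{-R..R}|lborel. cis (- (x * \<xi>)) * f x) = FT (trunc R f) \<xi>" for R \<xi>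
    unfolding FT_def set_lebesgue_integral_def trunc_def
    by (intro arg_cong2[where f="(*)"] Bochner_Integration.integral_cong) (auto simp: indicator_def)
  have "((\<lambda>R. Lx_norm 2 (\<lambda>\<xi>. F \<xi> - FT (trunc R f) \<xi>)) \<longlongrightarrow> 0) at_top \<longleftrightarrow> 
     ((\<lambda>R. nrm (\<lambda>\<xi>. F \<xi> - FT (trunc R f) \<xi>)) \<longlongrightarrow> 0) at_top" if "f \<in> L2" "F \<in> L2"
  proof -
    have "Lx_norm 2 (\<lambda>\<xi>. F \<xi> - FT (trunc R f) \<xi>) = ennreal (nrm (\<lambda>\<xi>. F \<xi> - FT (trunc R f) \<xi>))" for R
      using that by (intro Lx_norm_L2 L2_diff FT_trunc_L2)
    then show ?thesis by (simp add: tendsto_ennreal_iff flip: ennreal_0)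
  qed
  then show ?thesis unfolding has_fourier_def eq by blast
qed

lemma has_fourier_L2: "has_fourier f F \<Longrightarrow> f \<in> L2" "has_fourier f F \<Longrightarrow> F \<in> L2"
  by (auto simp: has_fourier_iff)

lemma has_fourier_nrm:
  assumes "has_fourier f F" shows "nrm F = nrm f"
proof -
  have f: "f \<in> L2" and F: "F \<in> L2" and l: "((\<lambda>R. nrm (\<lambda>\<xi>. F \<xi> - FT (trunc R f) \<xi>)) \<longlongrightarrow> 0) at_top"
    using assms by (auto simp: has_fourier_iff)
  have "((\<lambda>R. nrm (FT (trunc R f))) \<longlongrightarrow> nrm F) at_top"
    using l F by (intro nrm_tendsto) (auto simp: nrm_minus_commute[of _ F] FT_trunc_L2[OF f])
  moreover have "nrm (FT (trunc R f)) = nrm (trunc R f)" for R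
    using Plancherel_L1_L2[OF trunc_integrable[OF f] trunc_L2[OF f]] by blast
  moreover have "((\<lambda>R. nrm (trunc R f)) \<longlongrightarrow> nrm f) at_top"
    using trunc_tendsto[OF f] f by (intro nrm_tendsto) (auto simp: nrm_minus_commute[of _ f] intro: always_eventually)
  ultimately show ?thesis using tendsto_unique[OF trivial_limit_at_top_linorder] by force
qed

lemma has_fourier_FT:
  assumes f: "integrable lborel f" "f \<in> L2"
  shows "has_fourier f (FT f)"
proof -
  have "nrm (\<lambda>\<xi>. FT f \<xi> - FT (trunc R f) \<xi>) = nrm (\<lambda>x. f x - trunc R f x)" for R
  proof -
    have "FT (\<lambda>x. f x - trunc R f x) = (\<lambda>\<xi>. FT f \<xi> - FT (trunc R f) \<xi>)"
      using FT_diff[OF f(1) trunc_integrable[OF f(2)]] by (rule ext)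
    then show ?thesis
      using Plancherel_L1_L2[of "\<lambda>x. f x - trunc R f x"] f by (auto simp: trunc_integrable trunc_L2)
  qed
  then show ?thesis using trunc_tendsto[OF f(2)] Plancherel_L1_L2[OF f] f by (simp add: has_fourier_iff)
qed

text \<open>The transforms of the truncations of \<open>f\<close> are Cauchy because the transform
  is isometric on truncations.\<close>
lemma has_fourier_exists:
  assumes f: "f \<in> L2" shows "\<exists>F. has_fourier f F"
proof -
  have iso: "nrm (\<lambda>\<xi>. FT (trunc R f) \<xi> - FT (trunc S f) \<xi>) = nrm (\<lambda>x. trunc R f x - trunc S f x)" for R S
  proof -
    have "FT (\<lambda>x. trunc R f x - trunc S f x) = (\<lambda>\<xi>. FT (trunc R f) \<xi> - FT (trunc S f) \<xi>)"
      using FT_diff[OF trunc_integrable[OF f] trunc_integrable[OF f]] by (rule ext)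
    then show ?thesis
      using Plancherel_L1_L2[of "\<lambda>x. trunc R f x - trunc S f x"] f by (auto simp: trunc_integrable trunc_L2)
  qed
  have cauchy: "\<exists>N. \<forall>R\<ge>N. \<forall>S\<ge>N. nrm (\<lambda>\<xi>. FT (trunc R f) \<xi> - FT (trunc S f) \<xi>) \<le> e" if e: "e > 0" for e
  proof -
    have "\<forall>\<^sub>F R in at_top. nrm (\<lambda>x. f x - trunc R f x) < e / 2"
      using order_tendstoD(2)[OF trunc_tendsto[OF f], of "e/2"] e by simp
    then obtain N where N: "\<And>R. R \<ge> N \<Longrightarrow> nrm (\<lambda>x. f x - trunc R f x) < e / 2"
      by (auto simp: eventually_at_top_linorder)
    have "nrm (\<lambda>\<xi>. FT (trunc R f) \<xi> - FT (trunc S f) \<xi>) \<le> e" if "R \<ge> N" "S \<ge> N" for R S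
      unfolding iso using nrm_triangle3[OF trunc_L2[OF f, of R] f trunc_L2[OF f, of S]] N[OF that(1)] N[OF that(2)]
        nrm_minus_commute[of f "trunc R f"] by linarith
    then show ?thesis by blast
  qed
  have "\<exists>F\<in>L2. (\<lambda>n. nrm (\<lambda>\<xi>. FT (trunc (real n) f) \<xi> - F \<xi>)) \<longlonglongrightarrow> 0"
  proof (rule L2_complete)
    fix e :: real assume "e > 0"
    then obtain N where N: "\<forall>R\<ge>N. \<forall>S\<ge>N. nrm (\<lambda>\<xi>. FT (trunc R f) \<xi> - FT (trunc S f) \<xi>) \<le> e" using cauchy by blast
    have "real n \<ge> N" if "n \<ge> nat \<lceil>N\<rceil>" for n using that by linarith
    then show "\<exists>N. \<forall>m\<ge>N. \<forall>n\<ge>N. nrm (\<lambda>x. FT (trunc (real m) f) x - FT (trunc (real n) f) x) \<le> e"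
      using N by blast
  qed (rule FT_trunc_L2[OF f])
  then obtain F where F: "F \<in> L2" and lim: "(\<lambda>n. nrm (\<lambda>\<xi>. FT (trunc (real n) f) \<xi> - F \<xi>)) \<longlonglongrightarrow> 0" by blast
  have "((\<lambda>R. nrm (\<lambda>\<xi>. F \<xi> - FT (trunc R f) \<xi>)) \<longlongrightarrow> 0) at_top"
  proof (rule tendstoI)
    fix e :: real assume e: "e > 0"
    then obtain N where N: "\<forall>R\<ge>N. \<forall>S\<ge>N. nrm (\<lambda>\<xi>. FT (trunc R f) \<xi> - FT (trunc S f) \<xi>) \<le> e / 4" using cauchy[of "e/4"] by auto
    have "\<forall>\<^sub>F n in sequentially. nrm (\<lambda>\<xi>. FT (trunc (real n) f) \<xi> - F \<xi>) < e / 4"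
      using order_tendstoD(2)[OF lim, of "e/4"] e by simp
    moreover have "\<forall>\<^sub>F n in sequentially. real n \<ge> N"
      by (intro eventually_sequentiallyI[of "nat \<lceil>N\<rceil>"]) linarith
    ultimately have "\<forall>\<^sub>F n in sequentially. nrm (\<lambda>\<xi>. FT (trunc (real n) f) \<xi> - F \<xi>) < e / 4 \<and> real n \<ge> N"
      by (rule eventually_conj)
    then obtain n where n: "nrm (\<lambda>\<xi>. FT (trunc (real n) f) \<xi> - F \<xi>) < e / 4" "real n \<ge> N"
      using eventually_happens'[OF trivial_limit_sequentially] by blast
    have "nrm (\<lambda>\<xi>. F \<xi> - FT (trunc R f) \<xi>) < e" if "R \<ge> N" for R
    proof -
      have "nrm (\<lambda>\<xi>. FT (trunc (real n) f) \<xi> - FT (trunc R f) \<xi>) \<le> e / 4" using N n(2) that by blast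
      then show ?thesis
        using nrm_triangle3[OF F FT_trunc_L2[OF f, of "real n"] FT_trunc_L2[OF f, of R]] n(1) e
          nrm_minus_commute[of F "FT (trunc (real n) f)"] by linarith
    qed
    then show "\<forall>\<^sub>F R in at_top. dist (nrm (\<lambda>\<xi>. F \<xi> - FT (trunc R f) \<xi>)) 0 < e"
      by (auto simp: eventually_at_top_linorder intro!: exI[of _ N])
  qed
  then show ?thesis using f F by (auto simp: has_fourier_iff)
qed

lemma trunc_add: "trunc R (\<lambda>x. f x + g x) = (\<lambda>x. trunc R f x + trunc R g x)"
  by (auto simp: trunc_def algebra_simps)

lemma trunc_cmult: "trunc R (\<lambda>x. c * f x) = (\<lambda>x. c * trunc R f x)"
  by (auto simp: trunc_def algebra_simps)

lemma has_fourier_add: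
  assumes "has_fourier f F" "has_fourier g G"
  shows "has_fourier (\<lambda>x. f x + g x) (\<lambda>\<xi>. F \<xi> + G \<xi>)"
proof -
  have f: "f \<in> L2" "F \<in> L2" "g \<in> L2" "G \<in> L2" using assms has_fourier_L2 by auto
  have "((\<lambda>R. nrm (\<lambda>\<xi>. F \<xi> - FT (trunc R f) \<xi>) + nrm (\<lambda>\<xi>. G \<xi> - FT (trunc R g) \<xi>)) \<longlongrightarrow> 0 + 0) at_top"
    using assms by (intro tendsto_intros) (auto simp: has_fourier_iff)
  then have l: "((\<lambda>R. nrm (\<lambda>\<xi>. F \<xi> - FT (trunc R f) \<xi>) + nrm (\<lambda>\<xi>. G \<xi> - FT (trunc R g) \<xi>)) \<longlongrightarrow> 0) at_top" by simp
  have "((\<lambda>R. nrm (\<lambda>\<xi>. F \<xi> + G \<xi> - FT (trunc R (\<lambda>x. f x + g x)) \<xi>)) \<longlongrightarrow> 0) at_top"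
  proof (rule Lim_null_comparison[OF always_eventually l], rule allI)
    fix R
    have "(\<lambda>\<xi>. F \<xi> + G \<xi> - FT (trunc R (\<lambda>x. f x + g x)) \<xi>) = (\<lambda>\<xi>. (F \<xi> - FT (trunc R f) \<xi>) + (G \<xi> - FT (trunc R g) \<xi>))"
      unfolding trunc_add by (auto simp: FT_add trunc_integrable f)
    then show "norm (nrm (\<lambda>\<xi>. F \<xi> + G \<xi> - FT (trunc R (\<lambda>x. f x + g x)) \<xi>)) \<le> nrm (\<lambda>\<xi>. F \<xi> - FT (trunc R f) \<xi>) + nrm (\<lambda>\<xi>. G \<xi> - FT (trunc R g) \<xi>)"
      using nrm_triangle[of "\<lambda>\<xi>. F \<xi> - FT (trunc R f) \<xi>" "\<lambda>\<xi>. G \<xi> - FT (trunc R g) \<xi>"] by (simp add: f FT_trunc_L2)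
  qed
  then show ?thesis using f by (auto simp: has_fourier_iff)
qed

lemma has_fourier_cmult:
  assumes "has_fourier f F"
  shows "has_fourier (\<lambda>x. c * f x) (\<lambda>\<xi>. c * F \<xi>)"
proof -
  have "((\<lambda>R. cmod c * nrm (\<lambda>\<xi>. F \<xi> - FT (trunc R f) \<xi>)) \<longlongrightarrow> cmod c * 0) at_top"
    using assms by (intro tendsto_intros) (auto simp: has_fourier_iff)
  then show ?thesis using assms 
    by (auto simp: has_fourier_iff trunc_cmult FT_cmult nrm_cmult simp flip: right_diff_distrib)
qed

lemma has_fourier_diff:
  assumes "has_fourier f F" "has_fourier g G"
  shows "has_fourier (\<lambda>x. f x - g x) (\<lambda>\<xi>. F \<xi> - G \<xi>)"
  using has_fourier_add[OF assms(1) has_fourier_cmult[OF assms(2), of "-1"]] by simp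

lemma has_fourier_cong_AE:
  assumes "has_fourier f F" "AE x in lborel. f x = g x" "AE x in lborel. F x = G x"
    and [measurable]: "g \<in> borel_measurable borel" "G \<in> borel_measurable borel"
  shows "has_fourier g G"
proof -
  have L: "f \<in> L2" "F \<in> L2" using assms has_fourier_L2 by auto
  note [measurable] = L
  have g: "g \<in> L2" using assms(2) L by (intro L2_cong_AE[of g f]) (auto simp: eq_commute)
  have G: "G \<in> L2" using assms(3) L by (intro L2_cong_AE[of G F]) (auto simp: eq_commute)
  have "FT (trunc R g) \<xi> = FT (trunc R f) \<xi>" for R \<xi>
  proof -
    have "(LINT x|lborel. cis (- (x * \<xi>)) * trunc R g x) = (LINT x|lborel. cis (- (x * \<xi>)) * trunc R f x)"
    proof (rule integral_cong_AE)
      show "AE x in lborel. cis (- (x * \<xi>)) * trunc R g x = cis (- (x * \<xi>)) * trunc R f x"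
        using assms(2) by (rule eventually_mono) (simp add: trunc_def)
    qed (unfold trunc_def, measurable)
    then show ?thesis by (simp add: FT_def)
  qed
  moreover have "nrm (\<lambda>\<xi>. G \<xi> - FT (trunc R f) \<xi>) = nrm (\<lambda>\<xi>. F \<xi> - FT (trunc R f) \<xi>)" for R
  proof (rule nrm_cong_AE)
    show "AE \<xi> in lborel. G \<xi> - FT (trunc R f) \<xi> = F \<xi> - FT (trunc R f) \<xi>"
      using assms(3) by (rule eventually_mono) simp
  qed (auto intro!: L2_measurable FT_trunc_L2 L2_diff L G)
  ultimately show ?thesis using assms(1) g G by (simp add: has_fourier_iff)
qed

lemma has_fourier_unique:
  assumes "has_fourier f F" "has_fourier f G" shows "AE x in lborel. F x = G x"
proof -
  have "has_fourier (\<lambda>x. f x - f x) (\<lambda>\<xi>. F \<xi> - G \<xi>)" by (rule has_fourier_diff[OF assms])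
  then have "nrm (\<lambda>\<xi>. F \<xi> - G \<xi>) = 0" using has_fourier_nrm by fastforce
  then have "AE \<xi> in lborel. F \<xi> - G \<xi> = 0" using assms has_fourier_L2 by (intro nrm_eq_0) auto
  then show ?thesis by simp
qed

lemma has_fourier_inj:
  assumes "has_fourier f F" "has_fourier g F" shows "AE x in lborel. f x = g x"
proof -
  have "has_fourier (\<lambda>x. f x - g x) (\<lambda>\<xi>. F \<xi> - F \<xi>)" by (rule has_fourier_diff[OF assms])
  then have "nrm (\<lambda>x. f x - g x) = 0" using has_fourier_nrm by fastforce
  then have "AE \<xi> in lborel. f \<xi> - g \<xi> = 0" using assms has_fourier_L2 by (intro nrm_eq_0) auto
  then show ?thesis by simp
qed

lemma L2_mult_integral_tendsto:
  assumes "((\<lambda>i. nrm (\<lambda>x. f i x - f0 x)) \<longlongrightarrow> 0) F" "((\<lambda>i. nrm (\<lambda>x. g i x - g0 x)) \<longlongrightarrow> 0) F"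
    "f0 \<in> L2" "g0 \<in> L2" "\<And>i. f i \<in> L2" "\<And>i. g i \<in> L2"
  shows "((\<lambda>i. LINT x|lborel. f i x * g i x) \<longlongrightarrow> (LINT x|lborel. f0 x * g0 x)) F"
proof -
  have "((\<lambda>i. (LINT x|lborel. f i x * g i x) - (LINT x|lborel. f0 x * g0 x)) \<longlongrightarrow> 0) F"
  proof (rule Lim_null_comparison[OF always_eventually L2_mult_tendsto[OF assms]], rule allI)
    fix i
    have "(LINT x|lborel. f i x * g i x) - (LINT x|lborel. f0 x * g0 x) = (LINT x|lborel. f i x * g i x - f0 x * g0 x)"
      using assms by (subst Bochner_Integration.integral_diff) auto
    then show "norm ((LINT x|lborel. f i x * g i x) - (LINT x|lborel. f0 x * g0 x)) \<le> (LINT x|lborel. cmod (f i x * g i x - f0 x * g0 x))"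
      by (simp only: integral_norm_bound)
  qed
  then show ?thesis by (simp add: LIM_zero_iff)
qed

lemma has_fourier_multiplication_formula:
  assumes "has_fourier f F" "has_fourier g G"
  shows "(LINT \<xi>|lborel. F \<xi> * g \<xi>) = (LINT x|lborel. f x * G x)"
proof -
  have L: "f \<in> L2" "F \<in> L2" "g \<in> L2" "G \<in> L2" using assms has_fourier_L2 by auto
  have "((\<lambda>R. LINT \<xi>|lborel. FT (trunc R f) \<xi> * trunc R g \<xi>) \<longlongrightarrow> (LINT \<xi>|lborel. F \<xi> * g \<xi>)) at_top"
    using assms trunc_tendsto[OF L(3)]
    by (intro L2_mult_integral_tendsto) (auto simp: has_fourier_iff L nrm_minus_commute[of _ F] nrm_minus_commute[of _ g] FT_trunc_L2)
  moreover have "(LINT \<xi>|lborel. FT (trunc R f) \<xi> * trunc R g \<xi>) = (LINT x|lborel. trunc R f x * FT (trunc R g) x)" for R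
    by (intro FT_multiplication_formula trunc_integrable L)
  moreover have "((\<lambda>R. LINT x|lborel. trunc R f x * FT (trunc R g) x) \<longlongrightarrow> (LINT x|lborel. f x * G x)) at_top"
    using assms trunc_tendsto[OF L(1)]
    by (intro L2_mult_integral_tendsto) (auto simp: has_fourier_iff L nrm_minus_commute[of _ f] nrm_minus_commute[of _ G] FT_trunc_L2)
  ultimately show ?thesis using tendsto_unique[OF trivial_limit_at_top_linorder] by force
qed

text \<open>Up to conjugations the transform is its own inverse. If \<open>G\<close> is the
  transform of \<open>cnj H\<close>, the multiplication formula evaluates the inner product of
  \<open>G\<close> and \<open>F\<close> as the squared norm of \<open>H\<close>; since
  \<open>G\<close>, \<open>H\<close> and \<open>F\<close> have the same norm, expanding the square
  shows that \<open>G - F\<close> has norm 0. Surjectivity of the transform follows.\<close>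
lemma has_fourier_cnj_inverse:
  assumes H: "has_fourier (\<lambda>x. cnj (F x)) H"
  shows "has_fourier (\<lambda>x. cnj (H x)) F"
proof -
  have cF: "(\<lambda>x. cnj (F x)) \<in> L2" and HL: "H \<in> L2" using has_fourier_L2[OF H] by auto
  have F: "F \<in> L2" using L2_cnj[OF cF] by simp
  obtain G where G: "has_fourier (\<lambda>x. cnj (H x)) G" using has_fourier_exists[OF L2_cnj[OF HL]] by blast
  have GL: "G \<in> L2" using has_fourier_L2[OF G] by simp
  have n: "nrm G = nrm H" "nrm H = nrm F" using has_fourier_nrm[OF G] has_fourier_nrm[OF H] by simp_all
  have "(LINT \<xi>|lborel. G \<xi> * cnj (F \<xi>)) = (LINT x|lborel. cnj (H x) * H x)"
    by (rule has_fourier_multiplication_formula[OF G H])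
  also have "\<dots> = (LINT x|lborel. complex_of_real ((cmod (H x))\<^sup>2))"
    by (intro Bochner_Integration.integral_cong refl) (simp add: complex_norm_square mult.commute del: of_real_power)
  also have "\<dots> = complex_of_real ((nrm H)\<^sup>2)" by (simp add: nrm_sq del: of_real_power)
  finally have ip: "(LINT \<xi>|lborel. G \<xi> * cnj (F \<xi>)) = complex_of_real ((nrm H)\<^sup>2)" .
  have i: "integrable lborel (\<lambda>\<xi>. G \<xi> * cnj (F \<xi>))" using GL F by auto
  have rp: "(LINT \<xi>|lborel. Re (G \<xi> * cnj (F \<xi>))) = (nrm H)\<^sup>2"
    using ip i by (simp del: times_complex.sel of_real_power)
  have "(nrm (\<lambda>\<xi>. G \<xi> - F \<xi>))\<^sup>2 = (LINT \<xi>|lborel. (cmod (G \<xi>))\<^sup>2 + (cmod (F \<xi>))\<^sup>2 - 2 * Re (G \<xi> * cnj (F \<xi>)))"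
    unfolding nrm_sq cmod_power2
    by (intro Bochner_Integration.integral_cong refl) (simp add: power2_eq_square algebra_simps)
  also have "\<dots> = (LINT \<xi>|lborel. (cmod (G \<xi>))\<^sup>2) + (LINT \<xi>|lborel. (cmod (F \<xi>))\<^sup>2) - 2 * (LINT \<xi>|lborel. Re (G \<xi> * cnj (F \<xi>)))"
    using L2_integrable[OF GL] L2_integrable[OF F] i
    by (subst Bochner_Integration.integral_diff, auto simp del: times_complex.sel)+
  also have "\<dots> = 0" unfolding rp nrm_sq[symmetric] using n by simp
  finally have "nrm (\<lambda>\<xi>. G \<xi> - F \<xi>) = 0" by simp
  then have "AE \<xi> in lborel. G \<xi> - F \<xi> = 0" using GL F by (intro nrm_eq_0) auto
  then show ?thesis using G GL HL F
    by (intro has_fourier_cong_AE[OF G]) (auto intro: L2_measurable)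
qed

lemma has_fourier_surj:
  assumes "F \<in> L2" shows "\<exists>f. has_fourier f F"
  using has_fourier_exists[OF L2_cnj[OF assms]] has_fourier_cnj_inverse by blast

text \<open>The inverse Fourier integral.\<close>
definition IFT :: "(real \<Rightarrow> complex) \<Rightarrow> (real \<Rightarrow> complex)" where
  "IFT F x = FT F (- x)"

lemma IFT_measurable [measurable]: 
  assumes [measurable]: "F \<in> borel_measurable borel" shows "IFT F \<in> borel_measurable borel"
  unfolding IFT_def[abs_def] by measurable

lemma has_fourier_IFT:
  assumes "integrable lborel F" "F \<in> L2"
  shows "has_fourier (IFT F) F"
proof -
  have "has_fourier (\<lambda>x. cnj (F x)) (FT (\<lambda>x. cnj (F x)))"
    using assms by (intro has_fourier_FT) auto
  from has_fourier_cnj_inverse[OF this] show ?thesis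
    by (simp add: cnj_FT IFT_def[abs_def])
qed

lemma fourier_inversion:
  assumes "has_fourier f F" "integrable lborel F"
  shows "AE x in lborel. f x = IFT F x"
  using has_fourier_inj[OF assms(1) has_fourier_IFT[OF assms(2)]] has_fourier_L2[OF assms(1)] by simp

section \<open>Fourier multipliers\<close>

lemma has_fourier_multiplierI:
  assumes "has_fourier f F" "(\<lambda>\<xi>. m \<xi> * F \<xi>) \<in> L2"
  shows "\<exists>g. has_fourier_multiplier m f g"
  using has_fourier_surj[OF assms(2)] assms(1) unfolding has_fourier_multiplier_def by fastforce

text \<open>Transforms are unique up to null sets, so the representatives chosen in the definition
  do not matter.\<close>
lemma has_fourier_multiplierD:
  assumes g: "has_fourier_multiplier m f g" and f: "has_fourier f F" and [measurable]: "m \<in> borel_measurable borel"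
  shows "has_fourier g (\<lambda>\<xi>. m \<xi> * F \<xi>)"
proof -
  obtain F' G where FG: "has_fourier f F'" "has_fourier g G" "AE \<xi> in lborel. G \<xi> = m \<xi> * F' \<xi>"
    using g unfolding has_fourier_multiplier_def by blast
  have "AE \<xi> in lborel. F' \<xi> = F \<xi>" by (rule has_fourier_unique[OF FG(1) f])
  with FG(3) have "AE \<xi> in lborel. G \<xi> = m \<xi> * F \<xi>" by eventually_elim simp
  moreover have [measurable]: "F \<in> borel_measurable borel" "g \<in> borel_measurable borel"
    using has_fourier_L2 FG f by (auto intro: L2_measurable)
  ultimately show ?thesis by (intro has_fourier_cong_AE[OF FG(2)]) auto
qed

lemma fourier_multiplier_has_fourier:
  assumes "has_fourier f F" "(\<lambda>\<xi>. m \<xi> * F \<xi>) \<in> L2" "m \<in> borel_measurable borel"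
  shows "has_fourier (fourier_multiplier m f) (\<lambda>\<xi>. m \<xi> * F \<xi>)"
  unfolding fourier_multiplier_def
  by (rule has_fourier_multiplierD[OF someI_ex[OF has_fourier_multiplierI[OF assms(1,2)]] assms(1,3)])

lemma multiplier_norm_eq:
  assumes "has_fourier f F" "(\<lambda>\<xi>. m \<xi> * F \<xi>) \<in> L2" "m \<in> borel_measurable borel"
  shows "multiplier_norm m f = ennreal (nrm (\<lambda>\<xi>. m \<xi> * F \<xi>))"
  using has_fourier_multiplierI[OF assms(1,2)] fourier_multiplier_has_fourier[OF assms]
  unfolding multiplier_norm_def by (simp add: Lx_norm_L2 has_fourier_L2 has_fourier_nrm)

lemma multiplier_norm_finite:
  assumes "multiplier_norm m f < \<infinity>" "m \<in> borel_measurable borel"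
  shows "f \<in> L2" "has_fourier f F \<Longrightarrow> (\<lambda>\<xi>. m \<xi> * F \<xi>) \<in> L2"
proof -
  obtain g where g: "has_fourier_multiplier m f g"
    using assms(1) unfolding multiplier_norm_def by (auto split: if_splits)
  then show "f \<in> L2" unfolding has_fourier_multiplier_def using has_fourier_L2 by blast
  show "(\<lambda>\<xi>. m \<xi> * F \<xi>) \<in> L2" if "has_fourier f F"
    using has_fourier_multiplierD[OF g that assms(2)] has_fourier_L2 by blast
qed

lemma schroedinger_has_fourier:
  assumes f: "has_fourier f F"
  shows "has_fourier (schroedinger t f) (\<lambda>\<xi>. cis (- (t * \<xi>\<^sup>2)) * F \<xi>)"
  unfolding schroedinger_def
proof (rule fourier_multiplier_has_fourier[OF f])
  have [measurable]: "F \<in> borel_measurable borel" using has_fourier_L2[OF f] by (auto intro: L2_measurable)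
  show "(\<lambda>\<xi>. cis (- (t * \<xi>\<^sup>2)) * F \<xi>) \<in> L2"
    by (rule L2_bound[of F _ 1]) (use has_fourier_L2[OF f] in \<open>auto simp: norm_mult\<close>)
qed measurable

section \<open>The kernel sgn (x - y)\<close>

lemma integrable_borel: "integrable lborel f \<Longrightarrow> f \<in> borel_measurable borel"
  using borel_measurable_integrable[of lborel f] by simp

text \<open>The inner integral of the interaction Morawetz action.\<close>
definition sgn_conv :: "(real \<Rightarrow> real) \<Rightarrow> real \<Rightarrow> real" where
  "sgn_conv f y = (LINT x|lborel. sgn (x - y) * f x)"

definition sgn_form :: "(real \<Rightarrow> real) \<Rightarrow> (real \<Rightarrow> real) \<Rightarrow> real" where
  "sgn_form a b = (LINT y|lborel. a y * sgn_conv b y)"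

lemma measurable_sgn_real [measurable]: "(sgn :: real \<Rightarrow> real) \<in> borel_measurable borel"
proof -
  have "(sgn :: real \<Rightarrow> real) = (\<lambda>x. indicator {0<..} x - indicator {..<0} x)"
    by (auto simp: sgn_if indicator_def)
  then show ?thesis by simp
qed

lemma abs_sgn_le: "\<bar>sgn (x::real)\<bar> \<le> 1"
  by (simp add: sgn_if)

lemma sgn_conv_integrable:
  fixes f :: "real \<Rightarrow> real"
  assumes f: "integrable lborel f" shows "integrable lborel (\<lambda>x. sgn (x - y) * f x)"
proof (rule Bochner_Integration.integrable_bound[OF f])
  note [measurable] = integrable_borel[OF f]
  show "(\<lambda>x. sgn (x - y) * f x) \<in> borel_measurable lborel" by measurable
  show "AE x in lborel. norm (sgn (x - y) * f x) \<le> norm (f x)"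
    using abs_sgn_le by (auto simp: abs_mult intro!: mult_left_le_one_le)
qed

lemma sgn_conv_bound:
  assumes f: "integrable lborel f" shows "\<bar>sgn_conv f y\<bar> \<le> (LINT x|lborel. \<bar>f x\<bar>)"
proof -
  have "norm (sgn_conv f y) \<le> (LINT x|lborel. norm (sgn (x - y) * f x))"
    unfolding sgn_conv_def by (rule integral_norm_bound)
  also have "\<dots> \<le> (LINT x|lborel. \<bar>f x\<bar>)"
    using abs_sgn_le f integrable_norm[OF sgn_conv_integrable[OF f, of y]]
    by (intro integral_mono) (auto simp: abs_mult intro!: mult_left_le_one_le)
  finally show ?thesis by simp
qed

lemma sgn_conv_add: "integrable lborel f \<Longrightarrow> integrable lborel g \<Longrightarrow> sgn_conv (\<lambda>x. f x + g x) y = sgn_conv f y + sgn_conv g y"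
  unfolding sgn_conv_def by (simp add: distrib_left sgn_conv_integrable)

lemma sgn_conv_diff: "integrable lborel f \<Longrightarrow> integrable lborel g \<Longrightarrow> sgn_conv (\<lambda>x. f x - g x) y = sgn_conv f y - sgn_conv g y"
  unfolding sgn_conv_def by (simp add: right_diff_distrib sgn_conv_integrable)

lemma sgn_conv_cmult: "sgn_conv (\<lambda>x. c * f x) y = c * sgn_conv f y"
proof -
  have "(LINT x|lborel. sgn (x - y) * (c * f x)) = (LINT x|lborel. c * (sgn (x - y) * f x))"
    by (simp add: mult_ac)
  then show ?thesis unfolding sgn_conv_def by simp
qed

lemma sgn_conv_measurable [measurable]:
  assumes [measurable]: "f \<in> borel_measurable borel" shows "sgn_conv f \<in> borel_measurable borel"
  unfolding sgn_conv_def[abs_def] by measurable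

lemma integrable_mult_bounded:
  fixes a b :: "real \<Rightarrow> real"
  assumes a: "integrable lborel a" and [measurable]: "b \<in> borel_measurable borel" and b: "\<And>x. \<bar>b x\<bar> \<le> K"
  shows "integrable lborel (\<lambda>x. a x * b x)" "(LINT x|lborel. \<bar>a x * b x\<bar>) \<le> (LINT x|lborel. \<bar>a x\<bar>) * K"
    "\<bar>LINT x|lborel. a x * b x\<bar> \<le> (LINT x|lborel. \<bar>a x\<bar>) * K"
proof -
  have K: "0 \<le> K" using b[of 0] by linarith
  note [measurable] = integrable_borel[OF a]
  have le: "\<bar>a x * b x\<bar> \<le> \<bar>a x\<bar> * K" for x using b[of x] by (simp add: abs_mult mult_left_mono)
  show i: "integrable lborel (\<lambda>x. a x * b x)"
  proof (rule Bochner_Integration.integrable_bound)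
    show "integrable lborel (\<lambda>x. \<bar>a x\<bar> * K)" using a by simp
    show "AE x in lborel. norm (a x * b x) \<le> norm (\<bar>a x\<bar> * K)" using le K by (simp add: abs_mult)
  qed measurable
  have "(LINT x|lborel. \<bar>a x * b x\<bar>) \<le> (LINT x|lborel. \<bar>a x\<bar> * K)"
    using i a le by (intro integral_mono) auto
  then show 1: "(LINT x|lborel. \<bar>a x * b x\<bar>) \<le> (LINT x|lborel. \<bar>a x\<bar>) * K" by simp
  show "\<bar>LINT x|lborel. a x * b x\<bar> \<le> (LINT x|lborel. \<bar>a x\<bar>) * K"
    using integral_norm_bound[of lborel "\<lambda>x. a x * b x"] 1 unfolding real_norm_def by linarith
qed

lemma sgn_form_integrable:
  assumes a: "integrable lborel a" and b: "integrable lborel b"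
  shows "integrable lborel (\<lambda>y. a y * sgn_conv b y)"
  using integrable_borel[OF b] by (intro integrable_mult_bounded[OF a _ sgn_conv_bound[OF b]]) measurable

lemma sgn_form_bound:
  assumes a: "integrable lborel a" and b: "integrable lborel b"
  shows "\<bar>sgn_form a b\<bar> \<le> (LINT x|lborel. \<bar>a x\<bar>) * (LINT x|lborel. \<bar>b x\<bar>)"
  unfolding sgn_form_def
  using integrable_borel[OF b] by (intro integrable_mult_bounded(3)[OF a _ sgn_conv_bound[OF b]]) measurable

lemma sgn_form_add_left: "integrable lborel a \<Longrightarrow> integrable lborel a' \<Longrightarrow> integrable lborel b \<Longrightarrow>
   sgn_form (\<lambda>x. a x + a' x) b = sgn_form a b + sgn_form a' b"
  unfolding sgn_form_def by (simp add: distrib_right sgn_form_integrable)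

lemma sgn_form_diff_left: "integrable lborel a \<Longrightarrow> integrable lborel a' \<Longrightarrow> integrable lborel b \<Longrightarrow>
   sgn_form (\<lambda>x. a x - a' x) b = sgn_form a b - sgn_form a' b"
  unfolding sgn_form_def by (simp add: left_diff_distrib sgn_form_integrable)

lemma sgn_form_add_right: "integrable lborel a \<Longrightarrow> integrable lborel b \<Longrightarrow> integrable lborel b' \<Longrightarrow>
   sgn_form a (\<lambda>x. b x + b' x) = sgn_form a b + sgn_form a b'"
  unfolding sgn_form_def by (simp add: sgn_conv_add distrib_left sgn_form_integrable)

lemma sgn_form_diff_right: "integrable lborel a \<Longrightarrow> integrable lborel b \<Longrightarrow> integrable lborel b' \<Longrightarrow>
   sgn_form a (\<lambda>x. b x - b' x) = sgn_form a b - sgn_form a b'"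
  unfolding sgn_form_def by (simp add: sgn_conv_diff right_diff_distrib sgn_form_integrable)

lemma sgn_form_cmult_left: "sgn_form (\<lambda>x. c * a x) b = c * sgn_form a b"
  unfolding sgn_form_def by (simp add: mult.assoc)

lemma sgn_form_cmult_right: "sgn_form a (\<lambda>x. c * b x) = c * sgn_form a b"
  unfolding sgn_form_def sgn_conv_cmult by (simp add: mult.left_commute)

text \<open>The kernel is odd.\<close>
lemma sgn_form_antisym:
  assumes a: "integrable lborel a" and b: "integrable lborel b"
  shows "sgn_form a b = - sgn_form b a"
proof -
  have ac: "integrable lborel (\<lambda>x. complex_of_real (a x))" and bc: "integrable lborel (\<lambda>x. complex_of_real (b x))"
    using a b by auto
  have "integrable (lborel \<Otimes>\<^sub>M lborel) (\<lambda>(x, y). (\<lambda>(x, y). complex_of_real (sgn (x - y))) (x, y) * (complex_of_real (b x) * complex_of_real (a y)))"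
    using abs_sgn_le by (intro integrable_pair_bounded[OF bc ac, where B=1]) auto
  then have "integrable (lborel \<Otimes>\<^sub>M lborel) (\<lambda>z. Re (case z of (x, y) \<Rightarrow> complex_of_real (sgn (x - y)) * (complex_of_real (b x) * complex_of_real (a y))))"
    by (intro integrable_Re) simp
  also have "(\<lambda>z. Re (case z of (x, y) \<Rightarrow> complex_of_real (sgn (x - y)) * (complex_of_real (b x) * complex_of_real (a y)))) = 
    (\<lambda>(x, y). sgn (x - y) * (b x * a y))" by (auto split: prod.split)
  finally have i: "integrable (lborel \<Otimes>\<^sub>M lborel) (\<lambda>(x, y). sgn (x - y) * (b x * a y))" .
  have "sgn_form a b = (LINT y|lborel. LINT x|lborel. sgn (x - y) * (b x * a y))"
    unfolding sgn_form_def sgn_conv_def integral_mult_right_zero[symmetric]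
    by (intro Bochner_Integration.integral_cong refl) (simp add: mult_ac)
  also have "\<dots> = (LINT x|lborel. LINT y|lborel. sgn (x - y) * (b x * a y))"
    by (rule lborel_pair.Fubini_integral[OF i])
  also have "\<dots> = (LINT x|lborel. b x * (LINT y|lborel. - (sgn (y - x) * a y)))"
  proof (intro Bochner_Integration.integral_cong refl)
    fix x
    have "(LINT y|lborel. sgn (x - y) * (b x * a y)) = (LINT y|lborel. b x * (- (sgn (y - x) * a y)))"
    proof (intro Bochner_Integration.integral_cong refl)
      fix y
      have "sgn (x - y) = - sgn (y - x)" by (metis minus_diff_eq sgn_minus)
      then show "sgn (x - y) * (b x * a y) = b x * (- (sgn (y - x) * a y))" by simp
    qed
    then show "(LINT y|lborel. sgn (x - y) * (b x * a y)) = b x * (LINT y|lborel. - (sgn (y - x) * a y))"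
      by (simp only: integral_mult_right_zero)
  qed
  finally show ?thesis by (simp add: sgn_form_def sgn_conv_def)
qed

lemma sgn_form_tendsto:
  assumes a: "integrable lborel a" "\<And>i. integrable lborel (a' i)" "((\<lambda>i. LINT x|lborel. \<bar>a' i x - a x\<bar>) \<longlongrightarrow> 0) F"
    and b: "integrable lborel b" "\<And>i. integrable lborel (b' i)" "((\<lambda>i. LINT x|lborel. \<bar>b' i x - b x\<bar>) \<longlongrightarrow> 0) F"
  shows "((\<lambda>i. sgn_form (a' i) (b' i)) \<longlongrightarrow> sgn_form a b) F"
proof -
  let ?d = "\<lambda>i. LINT x|lborel. \<bar>a' i x - a x\<bar>" and ?e = "\<lambda>i. LINT x|lborel. \<bar>b' i x - b x\<bar>"
  have "((\<lambda>i. ?d i * (?e i + (LINT x|lborel. \<bar>b x\<bar>)) + (LINT x|lborel. \<bar>a x\<bar>) * ?e i) \<longlongrightarrow> 0 * (0 + (LINT x|lborel. \<bar>b x\<bar>)) + (LINT x|lborel. \<bar>a x\<bar>) * 0) F"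
    by (intro tendsto_intros a b)
  then have l: "((\<lambda>i. ?d i * (?e i + (LINT x|lborel. \<bar>b x\<bar>)) + (LINT x|lborel. \<bar>a x\<bar>) * ?e i) \<longlongrightarrow> 0) F" by simp
  have "((\<lambda>i. sgn_form (a' i) (b' i) - sgn_form a b) \<longlongrightarrow> 0) F"
  proof (rule Lim_null_comparison[OF always_eventually l], rule allI)
    fix i
    have ad: "integrable lborel (\<lambda>x. a' i x - a x)" "integrable lborel (\<lambda>x. b' i x - b x)" using a b by auto
    have "sgn_form (a' i) (b' i) - sgn_form a b = sgn_form (\<lambda>x. a' i x - a x) (b' i) + sgn_form a (\<lambda>x. b' i x - b x)"
      using a b by (simp add: sgn_form_diff_left sgn_form_diff_right)
    moreover have "\<bar>sgn_form (\<lambda>x. a' i x - a x) (b' i)\<bar> \<le> ?d i * (LINT x|lborel. \<bar>b' i x\<bar>)"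
      by (rule sgn_form_bound[OF ad(1) b(2)])
    moreover have "?d i * (LINT x|lborel. \<bar>b' i x\<bar>) \<le> ?d i * (?e i + (LINT x|lborel. \<bar>b x\<bar>))"
    proof (intro mult_left_mono)
      have "(LINT x|lborel. \<bar>b' i x\<bar>) \<le> (LINT x|lborel. \<bar>b' i x - b x\<bar> + \<bar>b x\<bar>)"
        using b ad by (intro integral_mono) auto
      then show "(LINT x|lborel. \<bar>b' i x\<bar>) \<le> ?e i + (LINT x|lborel. \<bar>b x\<bar>)" using b ad by simp
    qed simp
    moreover have "\<bar>sgn_form a (\<lambda>x. b' i x - b x)\<bar> \<le> (LINT x|lborel. \<bar>a x\<bar>) * ?e i"
      by (rule sgn_form_bound[OF a(1) ad(2)])
    ultimately show "norm (sgn_form (a' i) (b' i) - sgn_form a b) \<le> ?d i * (?e i + (LINT x|lborel. \<bar>b x\<bar>)) + (LINT x|lborel. \<bar>a x\<bar>) * ?e i"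
      unfolding real_norm_def by linarith
  qed
  then show ?thesis by (simp add: LIM_zero_iff)
qed

section \<open>Integration by parts on the line\<close>

text \<open>Otherwise the modulus of \<open>g\<close> would exceed half that of \<open>l\<close>
  on a half-line, which has infinite measure.\<close>
lemma integrable_tendsto_zero_at_top:
  fixes g :: "real \<Rightarrow> real"
  assumes g: "integrable lborel g" and l: "(g \<longlongrightarrow> l) at_top"
  shows "l = 0"
proof (rule ccontr)
  assume "l \<noteq> 0"
  then have "\<bar>l\<bar> / 2 < \<bar>l\<bar>" by simp
  moreover have "((\<lambda>x. \<bar>g x\<bar>) \<longlongrightarrow> \<bar>l\<bar>) at_top" using l by (rule tendsto_rabs)
  ultimately have "\<forall>\<^sub>F x in at_top. \<bar>l\<bar> / 2 < \<bar>g x\<bar>" by (intro order_tendstoD(1))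
  then obtain N where N: "\<And>x. x \<ge> N \<Longrightarrow> \<bar>l\<bar> / 2 < \<bar>g x\<bar>" by (auto simp: eventually_at_top_linorder)
  have "\<bar>l\<bar> / 2 * real k \<le> (LINT x|lborel. \<bar>g x\<bar>)" for k :: nat
  proof -
    have "(LINT x|lborel. \<bar>l\<bar> / 2 * indicat_real {N..N + real k} x) \<le> (LINT x|lborel. \<bar>g x\<bar>)"
    proof (rule integral_mono)
      show "integrable lborel (\<lambda>x. \<bar>l\<bar> / 2 * indicat_real {N..N + real k} x)"
        by (intro integrable_mult_right integrable_real_indicator) (auto simp: emeasure_lborel_Icc_eq)
      show "\<bar>l\<bar> / 2 * indicat_real {N..N + real k} x \<le> \<bar>g x\<bar>" for x
        using N[of x] by (auto simp: indicator_def)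
    qed (use g in auto)
    then show ?thesis by simp
  qed
  moreover obtain k :: nat where "real k > (LINT x|lborel. \<bar>g x\<bar>) / (\<bar>l\<bar> / 2)" using reals_Archimedean2 by blast
  ultimately show False using \<open>l \<noteq> 0\<close> by (simp add: field_simps) (meson not_less)
qed

text \<open>As \<open>g'\<close> is integrable, \<open>g\<close> has a limit at infinity, and as
  \<open>g\<close> is integrable the limit is 0.\<close>
lemma integral_deriv_Ici:
  fixes g g' :: "real \<Rightarrow> real"
  assumes g: "integrable lborel g" and g': "integrable lborel g'"
    and d: "\<And>x. (g has_vector_derivative g' x) (at x)"
  shows "(LINT x|lborel. indicator {y..} x * g' x) = - g y"
proof -
  note [measurable] = integrable_borel[OF g']
  have ftc: "(LINT x|lborel. indicator {y..b} x * g' x) = g b - g y" if "y \<le> b" for b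
  proof -
    have "(g' has_integral (g b - g y)) {y..b}"
      using that d by (intro fundamental_theorem_of_calculus) (auto intro: has_vector_derivative_at_within)
    moreover have "set_integrable lborel {y..b} g'"
      unfolding set_integrable_def using integrable_mult_bounded(1)[OF g', of "indicator {y..b}" 1] 
      by (auto simp: mult.commute indicator_def)
    from set_borel_integral_eq_integral(2)[OF this]
    have "(LINT x|lborel. indicator {y..b} x * g' x) = integral {y..b} g'"
      unfolding set_lebesgue_integral_def by simp
    ultimately show ?thesis by (simp add: integral_unique)
  qed
  have "((\<lambda>b. LINT x|lborel. indicator {y..b} x * g' x) \<longlongrightarrow> (LINT x|lborel. indicator {y..} x * g' x)) at_top"
  proof (rule integral_dominated_convergence_at_top[where w="\<lambda>x. \<bar>g' x\<bar>"])
    show "AE x in lborel. ((\<lambda>b. indicator {y..b} x * g' x) \<longlongrightarrow> indicator {y..} x * g' x) at_top"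
    proof (rule AE_I2)
      fix x :: real
      have "\<forall>\<^sub>F b in at_top. x \<le> b" by (rule eventually_ge_at_top)
      then have "\<forall>\<^sub>F b in at_top. indicator {y..b} x * g' x = indicator {y..} x * g' x"
        by (rule eventually_mono) (auto simp: indicator_def)
      then show "((\<lambda>b. indicator {y..b} x * g' x) \<longlongrightarrow> indicator {y..} x * g' x) at_top" by (rule tendsto_eventually)
    qed
  qed (use g' in \<open>auto simp: indicator_def intro!: always_eventually\<close>)
  then have "(g \<longlongrightarrow> (LINT x|lborel. indicator {y..} x * g' x) + g y) at_top"
  proof (rule Lim_transform_eventually[OF tendsto_add[OF _ tendsto_const]])
    show "\<forall>\<^sub>F b in at_top. (LINT x|lborel. indicator {y..b} x * g' x) + g y = g b"
      using eventually_ge_at_top[of y] by (rule eventually_mono) (simp add: ftc)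
  qed
  from integrable_tendsto_zero_at_top[OF g this] show ?thesis by simp
qed

lemma integral_deriv_Iic:
  fixes g g' :: "real \<Rightarrow> real"
  assumes g: "integrable lborel g" and g': "integrable lborel g'"
    and d: "\<And>x. (g has_vector_derivative g' x) (at x)"
  shows "(LINT x|lborel. indicator {..y} x * g' x) = g y"
proof -
  have "(LINT x|lborel. indicator {- y..} x * (- g' (- x))) = - g (- (- y))"
  proof (rule integral_deriv_Ici[where g="\<lambda>x. g (- x)"])
    show "integrable lborel (\<lambda>x. g (- x))" "integrable lborel (\<lambda>x. - g' (- x))"
      using lborel_integrable_real_affine[OF g, of "-1" 0] lborel_integrable_real_affine[OF g', of "-1" 0] by auto
    show "((\<lambda>x. g (- x)) has_vector_derivative - g' (- x)) (at x)" for x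
    proof -
      have "(uminus has_vector_derivative - 1) (at x)"
        by (auto intro!: derivative_eq_intros)
      from vector_diff_chain_at[OF this d[of "- x"]] show ?thesis by (simp add: o_def)
    qed
  qed
  also have "(LINT x|lborel. indicator {- y..} x * (- g' (- x))) = - (LINT x|lborel. indicator {- y..} (- x) * g' x)"
    by (subst lborel_integral_real_affine[where c="-1" and t=0]) auto
  also have "(\<lambda>x. indicator {- y..} (- x) * g' x) = (\<lambda>x. indicator {..y} x * g' x)" 
    by (auto simp: indicator_def)
  finally show ?thesis by simp
qed

text \<open>The rigorous form of the statement that the derivative of the sign function is twice
  the Dirac mass.\<close>
lemma sgn_conv_deriv:
  fixes g g' :: "real \<Rightarrow> real"
  assumes g: "integrable lborel g" and g': "integrable lborel g'"
    and d: "\<And>x. (g has_vector_derivative g' x) (at x)"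
  shows "sgn_conv g' y = - 2 * g y"
proof -
  have i: "integrable lborel (\<lambda>x. indicator A x * g' x)" if "A \<in> sets borel" for A
    using integrable_mult_bounded(1)[OF g', of "indicator A" 1] that by (auto simp: mult.commute indicator_def)
  have "sgn_conv g' y = (LINT x|lborel. indicator {y..} x * g' x - indicator {..y} x * g' x)"
    unfolding sgn_conv_def
  proof (rule integral_cong_AE)
    show "AE x in lborel. sgn (x - y) * g' x = indicator {y..} x * g' x - indicator {..y} x * g' x"
      using AE_lborel_singleton[of y] by (rule eventually_mono) (auto simp: indicator_def sgn_if)
  qed (use integrable_borel[OF g'] in measurable)
  also have "\<dots> = - g y - g y"
    using i integral_deriv_Ici[OF assms] integral_deriv_Iic[OF assms] by (subst Bochner_Integration.integral_diff) auto
  finally show ?thesis by simp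
qed

lemma integral_deriv_zero:
  fixes g g' :: "real \<Rightarrow> real"
  assumes g: "integrable lborel g" and g': "integrable lborel g'"
    and d: "\<And>x. (g has_vector_derivative g' x) (at x)"
  shows "(LINT x|lborel. g' x) = 0"
proof -
  have i: "integrable lborel (\<lambda>x. indicator A x * g' x)" if "A \<in> sets borel" for A
    using integrable_mult_bounded(1)[OF g', of "indicator A" 1] that by (auto simp: mult.commute indicator_def)
  have "(LINT x|lborel. g' x) = (LINT x|lborel. indicator {0..} x * g' x + indicator {..0} x * g' x)"
  proof (rule integral_cong_AE)
    show "AE x in lborel. g' x = indicator {0..} x * g' x + indicator {..0} x * g' x"
      using AE_lborel_singleton[of 0] by (rule eventually_mono) (auto simp: indicator_def)
  qed (use integrable_borel[OF g'] in measurable)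
  also have "\<dots> = - g 0 + g 0"
    using i integral_deriv_Ici[OF assms] integral_deriv_Iic[OF assms] by (subst Bochner_Integration.integral_add) auto
  finally show ?thesis by simp
qed

section \<open>The interaction Morawetz action\<close>

definition mass :: "(real \<Rightarrow> complex) \<Rightarrow> real \<Rightarrow> real" where
  "mass V x = (cmod (V x))\<^sup>2"

text \<open>If \<open>V1\<close> is the derivative of \<open>V\<close>, then \<open>ReP V
  V1\<close> is half the derivative of the mass density and \<open>ImP V V1\<close> is the
  momentum density.\<close>
definition ReP :: "(real \<Rightarrow> complex) \<Rightarrow> (real \<Rightarrow> complex) \<Rightarrow> real \<Rightarrow> real" where
  "ReP U W x = Re (cnj (U x) * W x)"

definition ImP :: "(real \<Rightarrow> complex) \<Rightarrow> (real \<Rightarrow> complex) \<Rightarrow> real \<Rightarrow> real" where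
  "ImP U W x = Im (cnj (U x) * W x)"

text \<open>The double integral of \<open>sgn (x - y)\<close> against the mass density at
  \<open>y\<close> and the momentum density at \<open>x\<close>. The spatial derivative
  \<open>V1\<close> of \<open>V\<close> is a separate argument.\<close>
definition morawetz :: "(real \<Rightarrow> complex) \<Rightarrow> (real \<Rightarrow> complex) \<Rightarrow> real" where
  "morawetz V V1 = sgn_form (mass V) (ImP V V1)"

text \<open>The derivative of the action when \<open>V\<close> moves with velocity
  \<open>P\<close>. The spatial derivative of \<open>P\<close> has been integrated by parts away,
  so that the expression makes sense for \<open>P\<close> in \<open>L2\<close>.\<close>
definition morawetz_deriv :: "(real \<Rightarrow> complex) \<Rightarrow> (real \<Rightarrow> complex) \<Rightarrow> (real \<Rightarrow> complex) \<Rightarrow> real" where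
  "morawetz_deriv V V1 P = 2 * sgn_form (ReP V P) (ImP V V1) + 2 * sgn_form (mass V) (ImP P V1)
     - 2 * (LINT x|lborel. mass V x * ImP V P x)"

definition has_L2_deriv :: "(real \<Rightarrow> complex) \<Rightarrow> (real \<Rightarrow> complex) \<Rightarrow> bool" where
  "has_L2_deriv V V1 \<longleftrightarrow> V \<in> L2 \<and> V1 \<in> L2 \<and> (\<forall>x. (V has_vector_derivative V1 x) (at x))"

lemma has_L2_deriv_imp: 
  assumes "has_L2_deriv V V1"
  shows "V \<in> L2" "V1 \<in> L2" "(V has_vector_derivative V1 x) (at x)"
  using assms by (auto simp: has_L2_deriv_def)

lemma cnj_mult_integrable: "U \<in> L2 \<Longrightarrow> W \<in> L2 \<Longrightarrow> integrable lborel (\<lambda>x. cnj (U x) * W x)"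
  by (intro L2_mult_integrable L2_cnj)

lemma ReP_integrable [intro]: "U \<in> L2 \<Longrightarrow> W \<in> L2 \<Longrightarrow> integrable lborel (ReP U W)"
  unfolding ReP_def[abs_def] by (intro integrable_Re cnj_mult_integrable)

lemma ImP_integrable [intro]: "U \<in> L2 \<Longrightarrow> W \<in> L2 \<Longrightarrow> integrable lborel (ImP U W)"
  unfolding ImP_def[abs_def] by (intro integrable_Im cnj_mult_integrable)

lemma mass_integrable [intro]: "U \<in> L2 \<Longrightarrow> integrable lborel (mass U)"
  unfolding mass_def[abs_def] by (rule L2_integrable)

lemma mass_nonneg [simp]: "0 \<le> mass U x" by (simp add: mass_def)

lemma ReP_bound: "U \<in> L2 \<Longrightarrow> W \<in> L2 \<Longrightarrow> (LINT x|lborel. \<bar>ReP U W x\<bar>) \<le> nrm U * nrm W"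
proof -
  assume *: "U \<in> L2" "W \<in> L2"
  have "(LINT x|lborel. \<bar>ReP U W x\<bar>) \<le> (LINT x|lborel. cmod (cnj (U x) * W x))"
    using * by (intro integral_mono) (auto simp: ReP_def[abs_def] intro!: integrable_abs integrable_Re cnj_mult_integrable integrable_norm abs_Re_le_cmod simp del: times_complex.sel)
  also have "\<dots> \<le> nrm U * nrm W" using L2_mult_integral_bound(1)[of "\<lambda>x. cnj (U x)" W] * by simp
  finally show ?thesis .
qed

lemma ImP_bound: "U \<in> L2 \<Longrightarrow> W \<in> L2 \<Longrightarrow> (LINT x|lborel. \<bar>ImP U W x\<bar>) \<le> nrm U * nrm W"
proof -
  assume *: "U \<in> L2" "W \<in> L2"
  have "(LINT x|lborel. \<bar>ImP U W x\<bar>) \<le> (LINT x|lborel. cmod (cnj (U x) * W x))"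
    using * by (intro integral_mono) (auto simp: ImP_def[abs_def] intro!: integrable_abs integrable_Im cnj_mult_integrable integrable_norm abs_Im_le_cmod simp del: times_complex.sel)
  also have "\<dots> \<le> nrm U * nrm W" using L2_mult_integral_bound(1)[of "\<lambda>x. cnj (U x)" W] * by simp
  finally show ?thesis .
qed

lemma mass_integral: "(LINT x|lborel. \<bar>mass U x\<bar>) = (nrm U)\<^sup>2"
  by (simp add: nrm_sq mass_def)

text \<open>Cauchy--Schwarz, because the kernel is bounded by 1.\<close>
lemma morawetz_bound:
  assumes "V \<in> L2" "V1 \<in> L2"
  shows "\<bar>morawetz V V1\<bar> \<le> (nrm V)^3 * nrm V1"
proof -
  have "\<bar>morawetz V V1\<bar> \<le> (LINT x|lborel. \<bar>mass V x\<bar>) * (LINT x|lborel. \<bar>ImP V V1 x\<bar>)"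
    unfolding morawetz_def using assms by (intro sgn_form_bound) auto
  also have "\<dots> \<le> (nrm V)\<^sup>2 * (nrm V * nrm V1)"
    unfolding mass_integral using assms by (intro mult_left_mono ImP_bound) auto
  finally show ?thesis by (simp add: power2_eq_square power3_eq_cube mult.assoc)
qed

lemma cnj_vector_derivative: "(V has_vector_derivative D) F \<Longrightarrow> ((\<lambda>x. cnj (V x)) has_vector_derivative cnj D) F"
  by (rule bounded_linear.has_vector_derivative[OF bounded_linear_cnj])

lemma cnj_mult_vector_derivative:
  assumes "(U has_vector_derivative U1) (at x)" "(W has_vector_derivative W1) (at x)"
  shows "((\<lambda>x. cnj (U x) * W x) has_vector_derivative cnj (U x) * W1 + cnj U1 * W x) (at x)"
  by (rule has_vector_derivative_mult[OF cnj_vector_derivative[OF assms(1)] assms(2)])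

lemma Re_vector_derivative: "(V has_vector_derivative D) F \<Longrightarrow> ((\<lambda>x. Re (V x)) has_vector_derivative Re D) F"
  by (rule bounded_linear.has_vector_derivative[OF bounded_linear_Re])

lemma Im_vector_derivative: "(V has_vector_derivative D) F \<Longrightarrow> ((\<lambda>x. Im (V x)) has_vector_derivative Im D) F"
  by (rule bounded_linear.has_vector_derivative[OF bounded_linear_Im])

lemma ReP_vector_derivative:
  assumes "(U has_vector_derivative U1 x) (at x)" "(W has_vector_derivative W1 x) (at x)"
  shows "(ReP U W has_vector_derivative ReP U W1 x + ReP U1 W x) (at x)"
  using Re_vector_derivative[OF cnj_mult_vector_derivative[OF assms]] unfolding ReP_def[abs_def] by simp

lemma ImP_vector_derivative:
  assumes "(U has_vector_derivative U1 x) (at x)" "(W has_vector_derivative W1 x) (at x)"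
  shows "(ImP U W has_vector_derivative ImP U W1 x + ImP U1 W x) (at x)"
  using Im_vector_derivative[OF cnj_mult_vector_derivative[OF assms]] unfolding ImP_def[abs_def] by simp

lemma mass_eq_ReP: "mass V = ReP V V"
  unfolding mass_def[abs_def] ReP_def[abs_def] cmod_power2 by (rule ext) (simp add: power2_eq_square)

lemma mass_vector_derivative:
  assumes "(V has_vector_derivative V1 x) (at x)"
  shows "(mass V has_vector_derivative 2 * ReP V V1 x) (at x)"
proof -
  have "ReP V V1 x + ReP V1 V x = 2 * ReP V V1 x" by (simp add: ReP_def)
  then show ?thesis using ReP_vector_derivative[of V V1 x V V1, OF assms assms] unfolding mass_eq_ReP by simp
qed

text \<open>Put \<open>D = W - V\<close>. The momentum density changes by the imaginary part of
  \<open>cnj D * W1 + cnj V * (W1 - V1)\<close>. In the second term the derivative is moved from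
  \<open>D\<close> onto \<open>V\<close>, which leaves the local term because the sign function
  jumps by 2. The increment then enters only through \<open>D\<close> itself: for
  differentiability in time it suffices that \<open>V\<close> is differentiable as a curve in
  \<open>L2\<close> and that \<open>V1\<close> is continuous.\<close>
lemma morawetz_diff:
  assumes V: "has_L2_deriv V V1" and W: "has_L2_deriv W W1"
  shows "morawetz W W1 - morawetz V V1 = 
     sgn_form (ReP (\<lambda>x. V x + W x) (\<lambda>x. W x - V x)) (ImP W W1) 
     + sgn_form (mass V) (ImP (\<lambda>x. W x - V x) (\<lambda>x. V1 x + W1 x))
     - 2 * (LINT x|lborel. mass V x * ImP V (\<lambda>x. W x - V x) x)"
proof -
  let ?D = "\<lambda>x. W x - V x" and ?D1 = "\<lambda>x. W1 x - V1 x"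
  note L = has_L2_deriv_imp(1,2)[OF V] has_L2_deriv_imp(1,2)[OF W]
  have DL: "?D \<in> L2" "?D1 \<in> L2" using L by auto
  have m: "ReP (\<lambda>x. V x + W x) ?D = (\<lambda>x. mass W x - mass V x)"
    unfolding mass_def ReP_def cmod_power2 by (rule ext) (simp add: power2_eq_square algebra_simps)
  have g: "(ImP V ?D has_vector_derivative ImP V ?D1 x + ImP V1 ?D x) (at x)" for x
    using has_L2_deriv_imp(3)[OF V] has_L2_deriv_imp(3)[OF W] by (intro ImP_vector_derivative has_vector_derivative_diff)
  have j: "ImP W W1 = (\<lambda>x. ImP V V1 x + (ImP ?D (\<lambda>x. V1 x + W1 x) x + (ImP V ?D1 x + ImP V1 ?D x)))"
    by (rule ext) (simp add: ImP_def algebra_simps)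
  have gi: "integrable lborel (\<lambda>x. ImP V ?D1 x + ImP V1 ?D x)" 
    using L DL by (intro Bochner_Integration.integrable_add ImP_integrable)
  have Ai: "integrable lborel (ImP ?D (\<lambda>x. V1 x + W1 x))"
    using L DL by (intro ImP_integrable) auto
  have mi: "integrable lborel (mass V)" "integrable lborel (mass W)" "integrable lborel (ImP V V1)" "integrable lborel (ImP W W1)"
    using L by auto
  have sc: "sgn_conv (\<lambda>x. ImP V ?D1 x + ImP V1 ?D x) y = -2 * ImP V ?D y" for y
    by (rule sgn_conv_deriv[OF ImP_integrable[OF L(1) DL(1)] gi g])
  have "sgn_form (mass V) (ImP W W1) = sgn_form (mass V) (ImP V V1) + (sgn_form (mass V) (ImP ?D (\<lambda>x. V1 x + W1 x)) + 
      sgn_form (mass V) (\<lambda>x. ImP V ?D1 x + ImP V1 ?D x))"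
    unfolding j using mi gi Ai by (simp add: sgn_form_add_right)
  also have "sgn_form (mass V) (\<lambda>x. ImP V ?D1 x + ImP V1 ?D x) = - 2 * (LINT x|lborel. mass V x * ImP V ?D x)"
    unfolding sgn_form_def sc by (simp flip: integral_mult_right_zero integral_minus add: mult.left_commute)
  finally have "sgn_form (mass V) (ImP W W1) = morawetz V V1 + sgn_form (mass V) (ImP ?D (\<lambda>x. V1 x + W1 x))
      - 2 * (LINT x|lborel. mass V x * ImP V ?D x)"
    by (simp add: morawetz_def)
  moreover have "sgn_form (ReP (\<lambda>x. V x + W x) ?D) (ImP W W1) = morawetz W W1 - sgn_form (mass V) (ImP W W1)"
    unfolding m morawetz_def using mi by (intro sgn_form_diff_left)
  ultimately show ?thesis by simp
qed

lemma ReP_ImP_tendsto: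
  assumes "((\<lambda>i. nrm (\<lambda>x. f i x - f0 x)) \<longlongrightarrow> 0) F" "((\<lambda>i. nrm (\<lambda>x. g i x - g0 x)) \<longlongrightarrow> 0) F"
    "f0 \<in> L2" "g0 \<in> L2" "\<And>i. f i \<in> L2" "\<And>i. g i \<in> L2"
  shows "((\<lambda>i. LINT x|lborel. \<bar>ReP (f i) (g i) x - ReP f0 g0 x\<bar>) \<longlongrightarrow> 0) F"
    "((\<lambda>i. LINT x|lborel. \<bar>ImP (f i) (g i) x - ImP f0 g0 x\<bar>) \<longlongrightarrow> 0) F"
proof -
  have c: "((\<lambda>i. nrm (\<lambda>x. cnj (f i x) - cnj (f0 x))) \<longlongrightarrow> 0) F"
    using assms(1) by (simp add: nrm_def flip: complex_cnj_diff)
  have l: "((\<lambda>i. LINT x|lborel. cmod (cnj (f i x) * g i x - cnj (f0 x) * g0 x)) \<longlongrightarrow> 0) F"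
    using assms by (intro L2_mult_tendsto c) auto
  have i: "integrable lborel (\<lambda>x. cnj (f i x) * g i x - cnj (f0 x) * g0 x)" for i
    using assms by (intro Bochner_Integration.integrable_diff cnj_mult_integrable) auto
  show "((\<lambda>i. LINT x|lborel. \<bar>ReP (f i) (g i) x - ReP f0 g0 x\<bar>) \<longlongrightarrow> 0) F"
  proof (rule Lim_null_comparison[OF always_eventually l], rule allI)
    fix k
    have "(LINT x|lborel. \<bar>ReP (f k) (g k) x - ReP f0 g0 x\<bar>) \<le> (LINT x|lborel. cmod (cnj (f k x) * g k x - cnj (f0 x) * g0 x))"
    proof (rule integral_mono)
      show "integrable lborel (\<lambda>x. \<bar>ReP (f k) (g k) x - ReP f0 g0 x\<bar>)"
        using assms by (intro integrable_abs Bochner_Integration.integrable_diff ReP_integrable) auto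
      show "\<bar>ReP (f k) (g k) x - ReP f0 g0 x\<bar> \<le> cmod (cnj (f k x) * g k x - cnj (f0 x) * g0 x)" for x
        unfolding ReP_def minus_complex.sel[symmetric] by (rule abs_Re_le_cmod)
    qed (use i in auto)
    then show "norm (LINT x|lborel. \<bar>ReP (f k) (g k) x - ReP f0 g0 x\<bar>) \<le> (LINT x|lborel. cmod (cnj (f k x) * g k x - cnj (f0 x) * g0 x))" by simp
  qed
  show "((\<lambda>i. LINT x|lborel. \<bar>ImP (f i) (g i) x - ImP f0 g0 x\<bar>) \<longlongrightarrow> 0) F"
  proof (rule Lim_null_comparison[OF always_eventually l], rule allI)
    fix k
    have "(LINT x|lborel. \<bar>ImP (f k) (g k) x - ImP f0 g0 x\<bar>) \<le> (LINT x|lborel. cmod (cnj (f k x) * g k x - cnj (f0 x) * g0 x))"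
    proof (rule integral_mono)
      show "integrable lborel (\<lambda>x. \<bar>ImP (f k) (g k) x - ImP f0 g0 x\<bar>)"
        using assms by (intro integrable_abs Bochner_Integration.integrable_diff ImP_integrable) auto
      show "\<bar>ImP (f k) (g k) x - ImP f0 g0 x\<bar> \<le> cmod (cnj (f k x) * g k x - cnj (f0 x) * g0 x)" for x
        unfolding ImP_def minus_complex.sel[symmetric] by (rule abs_Im_le_cmod)
    qed (use i in auto)
    then show "norm (LINT x|lborel. \<bar>ImP (f k) (g k) x - ImP f0 g0 x\<bar>) \<le> (LINT x|lborel. cmod (cnj (f k x) * g k x - cnj (f0 x) * g0 x))" by simp
  qed
qed

lemma nrm_add_tendsto:
  assumes "((\<lambda>i. nrm (\<lambda>x. f i x - f0 x)) \<longlongrightarrow> 0) F" "((\<lambda>i. nrm (\<lambda>x. g i x - g0 x)) \<longlongrightarrow> 0) F"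
    "f0 \<in> L2" "g0 \<in> L2" "\<And>i. f i \<in> L2" "\<And>i. g i \<in> L2"
  shows "((\<lambda>i. nrm (\<lambda>x. (f i x + g i x) - (f0 x + g0 x))) \<longlongrightarrow> 0) F"
proof -
  have "((\<lambda>i. nrm (\<lambda>x. f i x - f0 x) + nrm (\<lambda>x. g i x - g0 x)) \<longlongrightarrow> 0 + 0) F"
    using assms by (intro tendsto_intros)
  then have l: "((\<lambda>i. nrm (\<lambda>x. f i x - f0 x) + nrm (\<lambda>x. g i x - g0 x)) \<longlongrightarrow> 0) F" by simp
  show ?thesis
  proof (rule Lim_null_comparison[OF always_eventually l], rule allI)
    fix i
    have "(\<lambda>x. (f i x + g i x) - (f0 x + g0 x)) = (\<lambda>x. (f i x - f0 x) + (g i x - g0 x))" by auto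
    then show "norm (nrm (\<lambda>x. (f i x + g i x) - (f0 x + g0 x))) \<le> nrm (\<lambda>x. f i x - f0 x) + nrm (\<lambda>x. g i x - g0 x)"
      using nrm_triangle[of "\<lambda>x. f i x - f0 x" "\<lambda>x. g i x - g0 x"] assms by auto
  qed
qed

text \<open>Divide \<open>morawetz_diff\<close> by \<open>s - t\<close>; every term is multilinear
  in factors that converge in L2.\<close>
lemma morawetz_has_derivative:
  fixes V V1 :: "real \<Rightarrow> real \<Rightarrow> complex"
  assumes V: "\<And>s. has_L2_deriv (V s) (V1 s)" and P: "P \<in> L2"
    and K: "\<And>x. mass (V t) x \<le> K"
    and V1c: "((\<lambda>s. nrm (\<lambda>x. V1 s x - V1 t x)) \<longlongrightarrow> 0) (at t within T)"
    and Vd: "((\<lambda>s. nrm (\<lambda>x. (1 / (s - t)) *\<^sub>R (V s x - V t x) - P x)) \<longlongrightarrow> 0) (at t within T)"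
  shows "((\<lambda>s. morawetz (V s) (V1 s)) has_vector_derivative morawetz_deriv (V t) (V1 t) P) (at t within T)"
proof -
  let ?F = "at t within T"
  define Q where "Q s x = (1 / (s - t)) *\<^sub>R (V s x - V t x)" for s x
  note L = has_L2_deriv_imp(1,2)[OF V]
  have QL: "Q s \<in> L2" for s unfolding Q_def[abs_def] using L by auto
  have Qc: "((\<lambda>s. nrm (\<lambda>x. Q s x - P x)) \<longlongrightarrow> 0) ?F" using Vd by (simp add: Q_def)
  have VQ: "V s x - V t x = (s - t) *\<^sub>R Q s x" if "s \<noteq> t" for s x using that by (simp add: Q_def)
  have Vc: "((\<lambda>s. nrm (\<lambda>x. V s x - V t x)) \<longlongrightarrow> 0) ?F"
  proof -
    have "((\<lambda>s. \<bar>s - t\<bar> * nrm (Q s)) \<longlongrightarrow> \<bar>t - t\<bar> * nrm P) ?F"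
      by (intro tendsto_intros nrm_tendsto[OF Qc P]) (auto simp: QL)
    then have "((\<lambda>s. \<bar>s - t\<bar> * nrm (Q s)) \<longlongrightarrow> 0) ?F" by simp
    moreover have "\<forall>\<^sub>F s in ?F. \<bar>s - t\<bar> * nrm (Q s) = nrm (\<lambda>x. V s x - V t x)"
      unfolding eventually_at_filter
      by (rule always_eventually) (simp add: VQ nrm_scaleR)
    ultimately show ?thesis by (rule Lim_transform_eventually)
  qed
  have c: "((\<lambda>s::real. nrm (\<lambda>x. V t x - V t x)) \<longlongrightarrow> 0) ?F" "((\<lambda>s::real. nrm (\<lambda>x. V1 t x - V1 t x)) \<longlongrightarrow> 0) ?F" by simp_all
  let ?R = "\<lambda>s. sgn_form (ReP (\<lambda>x. V t x + V s x) (Q s)) (ImP (V s) (V1 s)) 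
     + sgn_form (mass (V t)) (ImP (Q s) (\<lambda>x. V1 t x + V1 s x))
     - 2 * (LINT x|lborel. mass (V t) x * ImP (V t) (Q s) x)"
  have "((\<lambda>s. sgn_form (ReP (\<lambda>x. V t x + V s x) (Q s)) (ImP (V s) (V1 s))) \<longlongrightarrow> sgn_form (ReP (\<lambda>x. V t x + V t x) P) (ImP (V t) (V1 t))) ?F"
    by (intro sgn_form_tendsto ReP_integrable ImP_integrable L2_add L P QL ReP_ImP_tendsto nrm_add_tendsto c Vc V1c Qc)
  moreover have "((\<lambda>s. sgn_form (mass (V t)) (ImP (Q s) (\<lambda>x. V1 t x + V1 s x))) \<longlongrightarrow> sgn_form (mass (V t)) (ImP P (\<lambda>x. V1 t x + V1 t x))) ?F"
    by (intro sgn_form_tendsto mass_integrable ImP_integrable L2_add L P QL ReP_ImP_tendsto nrm_add_tendsto c Vc V1c Qc) simp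
  moreover have "((\<lambda>s. LINT x|lborel. mass (V t) x * ImP (V t) (Q s) x) \<longlongrightarrow> (LINT x|lborel. mass (V t) x * ImP (V t) P x)) ?F"
  proof -
    have mm: "mass (V t) \<in> borel_measurable borel" using integrable_borel[OF mass_integrable[OF L(1)]] .
    have mb: "\<bar>mass (V t) x\<bar> \<le> K" for x using K[of x] by simp
    have l: "((\<lambda>s. (LINT x|lborel. \<bar>ImP (V t) (Q s) x - ImP (V t) P x\<bar>) * K) \<longlongrightarrow> 0) ?F"
      by (rule tendsto_mult_left_zero[OF ReP_ImP_tendsto(2)[OF c(1) Qc L(1) P L(1) QL]])
    have "((\<lambda>s. (LINT x|lborel. mass (V t) x * ImP (V t) (Q s) x) - (LINT x|lborel. mass (V t) x * ImP (V t) P x)) \<longlongrightarrow> 0) ?F"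
    proof (rule Lim_null_comparison[OF always_eventually l], rule allI)
      fix s
      have i: "integrable lborel (\<lambda>x. ImP (V t) (Q s) x * mass (V t) x)" "integrable lborel (\<lambda>x. ImP (V t) P x * mass (V t) x)"
        by (intro integrable_mult_bounded(1)[OF _ mm mb] ImP_integrable L QL P)+
      have "(LINT x|lborel. mass (V t) x * ImP (V t) (Q s) x) - (LINT x|lborel. mass (V t) x * ImP (V t) P x) = 
        (LINT x|lborel. (ImP (V t) (Q s) x - ImP (V t) P x) * mass (V t) x)"
        unfolding left_diff_distrib Bochner_Integration.integral_diff[OF i] by (simp add: mult.commute)
      also have "\<bar>\<dots>\<bar> \<le> (LINT x|lborel. \<bar>ImP (V t) (Q s) x - ImP (V t) P x\<bar>) * K"
        by (intro integrable_mult_bounded(3)[OF _ mm mb] Bochner_Integration.integrable_diff ImP_integrable L QL P)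
      finally show "norm ((LINT x|lborel. mass (V t) x * ImP (V t) (Q s) x) - (LINT x|lborel. mass (V t) x * ImP (V t) P x)) \<le> (LINT x|lborel. \<bar>ImP (V t) (Q s) x - ImP (V t) P x\<bar>) * K" by simp
    qed
    then show ?thesis by (simp add: LIM_zero_iff)
  qed
  ultimately have "(?R \<longlongrightarrow> sgn_form (ReP (\<lambda>x. V t x + V t x) P) (ImP (V t) (V1 t)) + sgn_form (mass (V t)) (ImP P (\<lambda>x. V1 t x + V1 t x))
     - 2 * (LINT x|lborel. mass (V t) x * ImP (V t) P x)) ?F"
    by (intro tendsto_intros)
  moreover have "sgn_form (ReP (\<lambda>x. V t x + V t x) P) (ImP (V t) (V1 t)) = 2 * sgn_form (ReP (V t) P) (ImP (V t) (V1 t))"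
    unfolding sgn_form_cmult_left[symmetric] by (intro arg_cong2[where f=sgn_form] ext) (auto simp: ReP_def algebra_simps)
  moreover have "sgn_form (mass (V t)) (ImP P (\<lambda>x. V1 t x + V1 t x)) = 2 * sgn_form (mass (V t)) (ImP P (V1 t))"
    unfolding sgn_form_cmult_right[symmetric] by (intro arg_cong2[where f=sgn_form] ext) (auto simp: ImP_def algebra_simps)
  ultimately have R: "(?R \<longlongrightarrow> morawetz_deriv (V t) (V1 t) P) ?F" by (simp add: morawetz_deriv_def)
  have "\<forall>\<^sub>F s in ?F. ?R s = (1 / (s - t)) *\<^sub>R (morawetz (V s) (V1 s) - morawetz (V t) (V1 t))"
    unfolding eventually_at_filter
  proof (rule always_eventually, intro allI impI)
    fix s assume st: "s \<noteq> t" "s \<in> T"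
    let ?c = "1 / (s - t)"
    have "?R s = ?c * (sgn_form (ReP (\<lambda>x. V t x + V s x) (\<lambda>x. V s x - V t x)) (ImP (V s) (V1 s)) 
     + sgn_form (mass (V t)) (ImP (\<lambda>x. V s x - V t x) (\<lambda>x. V1 t x + V1 s x))
     - 2 * (LINT x|lborel. mass (V t) x * ImP (V t) (\<lambda>x. V s x - V t x) x))"
    proof -
      have 1: "ReP (\<lambda>x. V t x + V s x) (Q s) = (\<lambda>x. ?c * ReP (\<lambda>x. V t x + V s x) (\<lambda>x. V s x - V t x) x)"
        by (rule ext) (simp add: ReP_def Q_def diff_divide_distrib add_divide_distrib)
      have 2: "ImP (Q s) (\<lambda>x. V1 t x + V1 s x) = (\<lambda>x. ?c * ImP (\<lambda>x. V s x - V t x) (\<lambda>x. V1 t x + V1 s x) x)"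
        by (rule ext) (simp add: ImP_def Q_def diff_divide_distrib add_divide_distrib)
      have 3: "(\<lambda>x. mass (V t) x * ImP (V t) (Q s) x) = (\<lambda>x. ?c * (mass (V t) x * ImP (V t) (\<lambda>x. V s x - V t x) x))"
        by (rule ext) (simp add: ImP_def Q_def diff_divide_distrib add_divide_distrib algebra_simps)
      show ?thesis unfolding 1 2 3 sgn_form_cmult_left sgn_form_cmult_right integral_mult_right_zero
        by (simp only: distrib_left right_diff_distrib mult.left_commute)
    qed
    then show "?R s = ?c *\<^sub>R (morawetz (V s) (V1 s) - morawetz (V t) (V1 t))"
      unfolding morawetz_diff[OF V V] by simp
  qed
  from Lim_transform_eventually[OF R this] 
  have "((\<lambda>s. (1 / (s - t)) *\<^sub>R (morawetz (V s) (V1 s) - morawetz (V t) (V1 t))) \<longlongrightarrow> morawetz_deriv (V t) (V1 t) P) ?F" .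
  then show ?thesis
    by (simp add: has_field_derivative_iff has_real_derivative_iff_has_vector_derivative[symmetric])
qed

section \<open>The virial identity\<close>

text \<open>The contribution of \<open>G\<close> to the derivative of the action along the
  equation \<open>\<i> V\<^sub>t + V\<^sub>x\<^sub>x = G\<close>.\<close>
definition forcing :: "(real \<Rightarrow> complex) \<Rightarrow> (real \<Rightarrow> complex) \<Rightarrow> (real \<Rightarrow> complex) \<Rightarrow> real" where
  "forcing V V1 G = 2 * sgn_form (ImP V G) (ImP V V1) + 2 * sgn_form (mass V) (ReP G V1)
     + 2 * (LINT x|lborel. mass V x * ReP V G x)"

lemma mass_le: "cmod (V x) \<le> K \<Longrightarrow> \<bar>mass V x\<bar> \<le> K\<^sup>2"
  unfolding mass_def by (simp add: power_mono)

lemma ReP_ImP_square: "(ReP V W x)\<^sup>2 + (ImP V W x)\<^sup>2 = mass V x * mass W x"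
proof -
  have "(ReP V W x)\<^sup>2 + (ImP V W x)\<^sup>2 = (cmod (cnj (V x) * W x))\<^sup>2"
    unfolding ReP_def ImP_def cmod_power2 ..
  then show ?thesis by (simp add: mass_def norm_mult power_mult_distrib)
qed

lemma ReP_square_integrable:
  assumes L: "V \<in> L2" "W \<in> L2" and K: "\<And>x. cmod (V x) \<le> K"
  shows "integrable lborel (\<lambda>x. (ReP V W x)\<^sup>2)" "integrable lborel (\<lambda>x. (ImP V W x)\<^sup>2)" "integrable lborel (\<lambda>x. mass V x * mass W x)"
proof -
  have mm: "mass V \<in> borel_measurable borel" using integrable_borel[OF mass_integrable[OF L(1)]] .
  have [measurable]: "ReP V W \<in> borel_measurable borel" "ImP V W \<in> borel_measurable borel"
    using integrable_borel[OF ReP_integrable[OF L]] integrable_borel[OF ImP_integrable[OF L]] .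
  show i: "integrable lborel (\<lambda>x. mass V x * mass W x)"
    using integrable_mult_bounded(1)[OF mass_integrable[OF L(2)] mm mass_le[OF K]] by (simp add: mult.commute)
  have le: "(ReP V W x)\<^sup>2 \<le> mass V x * mass W x" "(ImP V W x)\<^sup>2 \<le> mass V x * mass W x" for x
    unfolding ReP_ImP_square[symmetric] by simp_all
  show "integrable lborel (\<lambda>x. (ReP V W x)\<^sup>2)"
    by (rule Bochner_Integration.integrable_bound[OF i]) (use le in auto)
  show "integrable lborel (\<lambda>x. (ImP V W x)\<^sup>2)"
    by (rule Bochner_Integration.integrable_bound[OF i]) (use le in auto)
qed

lemma mass_mult_integrable:
  assumes L: "V \<in> L2" and K: "\<And>x. cmod (V x) \<le> K" and f: "integrable lborel f"
  shows "integrable lborel (\<lambda>x. mass V x * f x)" "\<bar>LINT x|lborel. mass V x * f x\<bar> \<le> K\<^sup>2 * (LINT x|lborel. \<bar>f x\<bar>)"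
proof -
  have mm: "mass V \<in> borel_measurable borel" using integrable_borel[OF mass_integrable[OF L(1)]] .
  from integrable_mult_bounded(1,3)[OF f mm mass_le[OF K]] 
  show "integrable lborel (\<lambda>x. mass V x * f x)" "\<bar>LINT x|lborel. mass V x * f x\<bar> \<le> K\<^sup>2 * (LINT x|lborel. \<bar>f x\<bar>)"
    by (simp_all add: mult.commute)
qed

text \<open>The computation behind the interaction Morawetz estimate, for the velocity \<open>P =
  \<i> V2 - \<i> G\<close>. Write \<open>m\<close>, \<open>j\<close> and \<open>r\<close> for
  \<open>mass V\<close>, \<open>ImP V V1\<close> and \<open>ReP V V1\<close>. The three terms of
  \<open>morawetz_deriv\<close> contribute the integrals of \<open>- 4 j\<^sup>2\<close>, of
  \<open>2 m |V1|\<^sup>2\<close> and of \<open>4 r\<^sup>2 + 2 m |V1|\<^sup>2\<close>, and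
  \<open>m |V1|\<^sup>2 = r\<^sup>2 + j\<^sup>2\<close> makes the negative term disappear.\<close>
lemma morawetz_virial:
  assumes V: "has_L2_deriv V V1" and V1: "has_L2_deriv V1 V2" and G: "G \<in> L2" and K: "\<And>x. cmod (V x) \<le> K"
  shows "morawetz_deriv V V1 (\<lambda>x. \<i> * V2 x - \<i> * G x) = 8 * (LINT x|lborel. (ReP V V1 x)\<^sup>2) + forcing V V1 G"
proof -
  let ?P = "\<lambda>x. \<i> * V2 x - \<i> * G x"
  note L = has_L2_deriv_imp(1,2)[OF V] has_L2_deriv_imp(2)[OF V1]
  note d = has_L2_deriv_imp(3)[OF V] has_L2_deriv_imp(3)[OF V1]
  have ji: "integrable lborel (ImP V V1)" and mi: "integrable lborel (mass V)" "integrable lborel (mass V1)"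
    using L by auto
  have RP: "ReP V ?P = (\<lambda>x. ImP V G x - ImP V V2 x)" by (rule ext) (simp add: ReP_def ImP_def algebra_simps)
  have IP1: "ImP ?P V1 = (\<lambda>x. ReP G V1 x - ReP V1 V2 x)" by (rule ext) (simp add: ReP_def ImP_def algebra_simps)
  have IP: "ImP V ?P = (\<lambda>x. ReP V V2 x - ReP V G x)" by (rule ext) (simp add: ReP_def ImP_def algebra_simps)
  \<comment> \<open>Mass flux: apart from \<open>G\<close>, the mass density moves with velocity \<open>- 2 j\<^sub>x\<close>.\<close>
  have jd: "(ImP V V1 has_vector_derivative ImP V V2 x) (at x)" for x
  proof -
    have "(ImP V V1 has_vector_derivative ImP V V2 x + ImP V1 V1 x) (at x)"
      by (rule ImP_vector_derivative[of V V1 x V1 V2]) (rule d)+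
    moreover have "ImP V1 V1 x = 0" by (simp add: ImP_def)
    ultimately show ?thesis by simp
  qed
  have sj: "sgn_conv (ImP V V2) y = - 2 * ImP V V1 y" for y
    by (rule sgn_conv_deriv[OF ji ImP_integrable[OF L(1,3)] jd])
  have "sgn_form (ImP V V2) (ImP V V1) = - sgn_form (ImP V V1) (ImP V V2)"
    by (rule sgn_form_antisym) (use L in auto)
  also have "\<dots> = - (LINT x|lborel. - 2 * (ImP V V1 x)\<^sup>2)"
    unfolding sgn_form_def sj by (simp add: power2_eq_square mult.left_commute)
  also have "\<dots> = 2 * (LINT x|lborel. (ImP V V1 x)\<^sup>2)" by simp
  finally have t1: "sgn_form (ReP V ?P) (ImP V V1) = sgn_form (ImP V G) (ImP V V1) - 2 * (LINT x|lborel. (ImP V V1 x)\<^sup>2)"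
    unfolding RP using L G ji by (subst sgn_form_diff_left) auto
  \<comment> \<open>Momentum flux: \<open>2 Re (cnj V1 V2)\<close> is the derivative of \<open>|V1|\<^sup>2\<close>.\<close>
  have md: "(mass V1 has_vector_derivative 2 * ReP V1 V2 x) (at x)" for x
    by (rule mass_vector_derivative) (rule d)
  have sm: "sgn_conv (\<lambda>x. 2 * ReP V1 V2 x) y = - 2 * mass V1 y" for y
    by (rule sgn_conv_deriv[OF mi(2) _ md]) (use L in auto)
  have "2 * sgn_form (mass V) (ReP V1 V2) = sgn_form (mass V) (\<lambda>x. 2 * ReP V1 V2 x)"
    by (rule sgn_form_cmult_right[symmetric])
  also have "\<dots> = (LINT x|lborel. - 2 * (mass V x * mass V1 x))"
    unfolding sgn_form_def sm by (simp add: mult.left_commute)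
  finally have t2': "sgn_form (mass V) (ReP V1 V2) = - (LINT x|lborel. mass V x * mass V1 x)" by simp
  have t2: "sgn_form (mass V) (ImP ?P V1) = sgn_form (mass V) (ReP G V1) + (LINT x|lborel. mass V x * mass V1 x)"
    unfolding IP1 using L G mi t2' by (subst sgn_form_diff_right) auto
  \<comment> \<open>The local term: the derivative of \<open>m r\<close> integrates to 0.\<close>
  have i1: "integrable lborel (\<lambda>x. mass V x * ReP V V1 x)" "integrable lborel (\<lambda>x. mass V x * ReP V V2 x)" "integrable lborel (\<lambda>x. mass V x * ReP V G x)"
    by (intro mass_mult_integrable(1)[OF L(1) K] ReP_integrable L G)+
  note sq = ReP_square_integrable[OF L(1,2) K]
  have "(LINT x|lborel. 2 * (ReP V V1 x)\<^sup>2 + (mass V x * ReP V V2 x + mass V x * mass V1 x)) = 0"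
  proof (rule integral_deriv_zero[OF i1(1)])
    show "integrable lborel (\<lambda>x. 2 * (ReP V V1 x)\<^sup>2 + (mass V x * ReP V V2 x + mass V x * mass V1 x))"
      using sq i1 by auto
    fix x
    have "(ReP V V1 has_vector_derivative ReP V V2 x + ReP V1 V1 x) (at x)"
      by (rule ReP_vector_derivative[of V V1 x V1 V2]) (rule d)+
    from has_vector_derivative_mult[OF mass_vector_derivative[of V V1, OF d(1)] this]
    show "((\<lambda>x. mass V x * ReP V V1 x) has_vector_derivative 2 * (ReP V V1 x)\<^sup>2 + (mass V x * ReP V V2 x + mass V x * mass V1 x)) (at x)"
      unfolding mass_eq_ReP[of V1] by (simp add: power2_eq_square algebra_simps)
  qed
  then have t3': "(LINT x|lborel. mass V x * ReP V V2 x) = - 2 * (LINT x|lborel. (ReP V V1 x)\<^sup>2) - (LINT x|lborel. mass V x * mass V1 x)"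
    using sq i1 by simp
  have t3: "(LINT x|lborel. mass V x * ImP V ?P x) = (LINT x|lborel. mass V x * ReP V V2 x) - (LINT x|lborel. mass V x * ReP V G x)"
    unfolding IP right_diff_distrib using i1 by (intro Bochner_Integration.integral_diff)
  have t4: "(LINT x|lborel. mass V x * mass V1 x) = (LINT x|lborel. (ReP V V1 x)\<^sup>2) + (LINT x|lborel. (ImP V V1 x)\<^sup>2)"
    unfolding ReP_ImP_square[symmetric] using sq by (intro Bochner_Integration.integral_add)
  show ?thesis
    unfolding morawetz_deriv_def forcing_def t1 t2 t3 t3' t4 by (simp add: algebra_simps)
qed

lemma forcing_bound:
  assumes L: "V \<in> L2" "V1 \<in> L2" "R \<in> L2" and K: "\<And>x. cmod (V x) \<le> K"
  shows "\<bar>forcing V V1 R\<bar> \<le> (4 * (nrm V)\<^sup>2 * nrm V1 + 2 * K\<^sup>2 * nrm V) * nrm R"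
proof -
  have "\<bar>sgn_form (ImP V R) (ImP V V1)\<bar> \<le> (LINT x|lborel. \<bar>ImP V R x\<bar>) * (LINT x|lborel. \<bar>ImP V V1 x\<bar>)"
    using L by (intro sgn_form_bound) auto
  also have "\<dots> \<le> (nrm V * nrm R) * (nrm V * nrm V1)"
    using L by (intro mult_mono ImP_bound) auto
  finally have 1: "\<bar>sgn_form (ImP V R) (ImP V V1)\<bar> \<le> (nrm V)\<^sup>2 * nrm V1 * nrm R" by (simp add: power2_eq_square mult_ac)
  have "\<bar>sgn_form (mass V) (ReP R V1)\<bar> \<le> (LINT x|lborel. \<bar>mass V x\<bar>) * (LINT x|lborel. \<bar>ReP R V1 x\<bar>)"
    using L by (intro sgn_form_bound) auto
  also have "\<dots> \<le> (nrm V)\<^sup>2 * (nrm R * nrm V1)"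
    unfolding mass_integral using L by (intro mult_left_mono ReP_bound) auto
  finally have 2: "\<bar>sgn_form (mass V) (ReP R V1)\<bar> \<le> (nrm V)\<^sup>2 * nrm V1 * nrm R" by (simp add: mult_ac)
  have "\<bar>LINT x|lborel. mass V x * ReP V R x\<bar> \<le> K\<^sup>2 * (LINT x|lborel. \<bar>ReP V R x\<bar>)"
    using L by (intro mass_mult_integrable(2) K) auto
  also have "\<dots> \<le> K\<^sup>2 * (nrm V * nrm R)" using L by (intro mult_left_mono ReP_bound) auto
  finally have 3: "\<bar>LINT x|lborel. mass V x * ReP V R x\<bar> \<le> K\<^sup>2 * nrm V * nrm R" by (simp add: mult_ac)
  have "(4 * (nrm V)\<^sup>2 * nrm V1 + 2 * K\<^sup>2 * nrm V) * nrm R = 2 * ((nrm V)\<^sup>2 * nrm V1 * nrm R) + 2 * ((nrm V)\<^sup>2 * nrm V1 * nrm R) + 2 * (K\<^sup>2 * nrm V * nrm R)"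
    by (simp add: algebra_simps)
  then show ?thesis unfolding forcing_def using 1 2 3 by linarith
qed

lemma forcing_add:
  assumes L: "V \<in> L2" "V1 \<in> L2" "G \<in> L2" "H \<in> L2" and K: "\<And>x. cmod (V x) \<le> K"
  shows "forcing V V1 (\<lambda>x. G x + H x) = forcing V V1 G + forcing V V1 H"
proof -
  have 1: "ImP V (\<lambda>x. G x + H x) = (\<lambda>x. ImP V G x + ImP V H x)" by (rule ext) (simp add: ImP_def algebra_simps)
  have 2: "ReP (\<lambda>x. G x + H x) V1 = (\<lambda>x. ReP G V1 x + ReP H V1 x)" by (rule ext) (simp add: ReP_def algebra_simps)
  have 3: "ReP V (\<lambda>x. G x + H x) = (\<lambda>x. ReP V G x + ReP V H x)" by (rule ext) (simp add: ReP_def algebra_simps)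
  have "sgn_form (\<lambda>x. ImP V G x + ImP V H x) (ImP V V1) = sgn_form (ImP V G) (ImP V V1) + sgn_form (ImP V H) (ImP V V1)"
    using L by (intro sgn_form_add_left) auto
  moreover have "sgn_form (mass V) (\<lambda>x. ReP G V1 x + ReP H V1 x) = sgn_form (mass V) (ReP G V1) + sgn_form (mass V) (ReP H V1)"
    using L by (intro sgn_form_add_right) auto
  moreover have "(LINT x|lborel. mass V x * (ReP V G x + ReP V H x)) = (LINT x|lborel. mass V x * ReP V G x) + (LINT x|lborel. mass V x * ReP V H x)"
    unfolding distrib_left using L by (intro Bochner_Integration.integral_add mass_mult_integrable(1)[OF L(1) K]) auto
  ultimately show ?thesis unfolding forcing_def 1 2 3 by simp
qed

section \<open>The power nonlinearity\<close>

text \<open>The modulus is there for the point 0: the chain rule for a power of the mass density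
  needs a two-sided derivative where the density vanishes.\<close>
lemma abs_powr_deriv:
  assumes r: "1 < r" and s: "0 \<le> s"
  shows "((\<lambda>s. \<bar>s\<bar> powr r) has_real_derivative r * s powr (r - 1)) (at s)"
proof (cases "s = 0")
  case True
  have "((\<lambda>h::real. \<bar>h\<bar> powr (r - 1)) \<longlongrightarrow> 0) (at 0)"
  proof -
    have "((\<lambda>h::real. \<bar>h\<bar> powr (r - 1)) \<longlongrightarrow> \<bar>0\<bar> powr (r - 1)) (at 0)"
      by (rule tendsto_powr') (use r in \<open>auto intro!: tendsto_eq_intros\<close>)
    then show ?thesis by simp
  qed
  then have "((\<lambda>h::real. \<bar>h\<bar> powr r / h) \<longlongrightarrow> 0) (at 0)"
  proof (rule Lim_null_comparison[rotated])
    show "\<forall>\<^sub>F h in at (0::real). norm (\<bar>h\<bar> powr r / h) \<le> \<bar>h\<bar> powr (r - 1)"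
      unfolding eventually_at_filter
    proof (rule always_eventually, intro allI impI)
      fix h :: real assume "h \<noteq> 0"
      then show "norm (\<bar>h\<bar> powr r / h) \<le> \<bar>h\<bar> powr (r - 1)"
        by (simp add: powr_diff abs_divide)
    qed
  qed
  then show ?thesis using r unfolding True has_field_derivative_iff by simp
next
  case False
  then have s0: "0 < s" using s by simp
  have "((\<lambda>s. s powr r) has_real_derivative r * s powr (r - 1)) (at s)"
    by (rule has_real_derivative_powr[OF s0])
  moreover have "\<forall>\<^sub>F y in nhds s. y powr r = \<bar>y\<bar> powr r"
    using eventually_nhds_in_open[of "{0<..}" s] s0 by (auto elim!: eventually_mono)
  ultimately show ?thesis by (simp add: DERIV_cong_ev)
qed

text \<open>The modulus of \<open>V\<close> need not be differentiable at a zero of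
  \<open>V\<close>, but the mass density is, so the left-hand side is treated as a power of the
  latter.\<close>
lemma cmod_powr_deriv:
  assumes p: "1 < p" and V: "(V has_vector_derivative V1 x) (at x)"
  shows "((\<lambda>x. cmod (V x) powr (p + 1)) has_vector_derivative (p + 1) * (cmod (V x) powr (p - 1) * ReP V V1 x)) (at x)"
proof -
  have e: "\<bar>mass V y\<bar> powr (a / 2) = cmod (V y) powr a" for y a
  proof (cases "V y = 0")
    case False
    have "(cmod (V y) powr 2) powr (a / 2) = cmod (V y) powr a"
      unfolding powr_powr by simp
    then show ?thesis using False by (simp add: mass_def)
  qed (simp add: mass_def)
  have "((\<lambda>s. \<bar>s\<bar> powr ((p + 1) / 2)) has_real_derivative ((p + 1) / 2) * (mass V x) powr ((p + 1) / 2 - 1)) (at (mass V x))"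
    using p by (intro abs_powr_deriv) auto
  moreover have "(mass V has_real_derivative 2 * ReP V V1 x) (at x)"
    using mass_vector_derivative[of V V1, OF V] by (simp add: has_real_derivative_iff_has_vector_derivative)
  ultimately have "((\<lambda>x. \<bar>mass V x\<bar> powr ((p + 1) / 2)) has_real_derivative (((p + 1) / 2) * (mass V x) powr ((p + 1) / 2 - 1)) * (2 * ReP V V1 x)) (at x)"
    by (rule DERIV_chain2)
  moreover have "(mass V x) powr ((p + 1) / 2 - 1) = cmod (V x) powr (p - 1)"
  proof -
    have "(p + 1) / 2 - 1 = (p - 1) / 2" by (simp add: field_simps)
    then show ?thesis using e[of x "p - 1"] by simp
  qed
  ultimately show ?thesis unfolding e has_real_derivative_iff_has_vector_derivative by (simp add: mult_ac)
qed

lemma nonlinearity_L2: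
  assumes p: "1 < p" and V: "V \<in> L2" and K: "\<And>x. cmod (V x) \<le> K"
  shows "nonlinearity p V \<in> L2" "nrm (nonlinearity p V) \<le> K powr (p - 1) * nrm V"
proof -
  note [measurable] = V
  have m: "nonlinearity p V \<in> borel_measurable borel" unfolding nonlinearity_def by measurable
  have b: "AE x in lborel. cmod (nonlinearity p V x) \<le> K powr (p - 1) * cmod (V x)"
    using p K by (intro AE_I2) (auto simp: nonlinearity_def norm_mult intro!: mult_right_mono powr_mono2)
  show "nonlinearity p V \<in> L2" by (rule L2_bound[OF V m b])
  show "nrm (nonlinearity p V) \<le> K powr (p - 1) * nrm V" by (rule nrm_bound[OF V m b]) simp
qed

lemma cmod_powr_integrable:
  assumes p: "1 < p" and V: "V \<in> L2" and K: "\<And>x. cmod (V x) \<le> K"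
  shows "integrable lborel (\<lambda>x. cmod (V x) powr (p + 1))"
proof (rule Bochner_Integration.integrable_bound)
  have [measurable]: "V \<in> borel_measurable borel" using V by (rule L2_measurable)
  show "(\<lambda>x. cmod (V x) powr (p + 1)) \<in> borel_measurable lborel" by measurable
  show "integrable lborel (\<lambda>x. K powr (p - 1) * mass V x)" using V by auto
  show "AE x in lborel. norm (cmod (V x) powr (p + 1)) \<le> norm (K powr (p - 1) * mass V x)"
  proof (rule AE_I2)
    fix x
    have "cmod (V x) powr (p + 1) = cmod (V x) powr (p - 1) * mass V x"
    proof (cases "V x = 0")
      case False
      have "cmod (V x) powr (p - 1) * cmod (V x) powr 2 = cmod (V x) powr (p + 1)"
        unfolding powr_add[symmetric] by (simp add: algebra_simps)
      then show ?thesis using False by (simp add: mass_def)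
    qed (simp add: mass_def)
    also have "\<dots> \<le> K powr (p - 1) * mass V x" using p K by (intro mult_right_mono powr_mono2) auto
    finally show "norm (cmod (V x) powr (p + 1)) \<le> norm (K powr (p - 1) * mass V x)" by simp
  qed
qed

text \<open>The nonlinearity is a real multiple of \<open>V\<close>, so the first term of
  \<open>forcing\<close> vanishes. In the second, \<open>(p + 1) |V|\<^bsup>p-1\<^esup> Re (cnj V
  V1)\<close> is the derivative of \<open>|V|\<^bsup>p+1\<^esup>\<close>, which yields the factor
  \<open>- 4 / (p + 1)\<close>; the local term yields 2. The sum is positive because \<open>p >
  1\<close>.\<close>
lemma forcing_nonlinearity:
  assumes p: "1 < p" and V: "has_L2_deriv V V1" and K: "\<And>x. cmod (V x) \<le> K"
  shows "forcing V V1 (nonlinearity p V) = 2 * (p - 1) / (p + 1) * (LINT x|lborel. mass V x * cmod (V x) powr (p + 1))"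
proof -
  note L = has_L2_deriv_imp(1,2)[OF V]
  have NL: "nonlinearity p V \<in> L2" by (rule nonlinearity_L2[OF p L(1) K])
  have 1: "ImP V (nonlinearity p V) = (\<lambda>x. 0)"
    by (rule ext) (simp add: ImP_def nonlinearity_def)
  have 2: "ReP (nonlinearity p V) V1 = (\<lambda>x. (1 / (p + 1)) * ((p + 1) * (cmod (V x) powr (p - 1) * ReP V V1 x)))"
  proof (rule ext)
    fix x
    have "(1 / (p + 1)) * ((p + 1) * y) = y" for y using p by simp
    moreover have "ReP (nonlinearity p V) V1 x = cmod (V x) powr (p - 1) * ReP V V1 x"
      by (simp add: ReP_def nonlinearity_def algebra_simps)
    ultimately show "ReP (nonlinearity p V) V1 x = (1 / (p + 1)) * ((p + 1) * (cmod (V x) powr (p - 1) * ReP V V1 x))" by simp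
  qed
  have 3: "ReP V (nonlinearity p V) = (\<lambda>x. cmod (V x) powr (p + 1))"
  proof (rule ext)
    fix x
    have "ReP V (nonlinearity p V) x = cmod (V x) powr (p - 1) * (cmod (V x))\<^sup>2"
      unfolding cmod_power2 by (simp add: ReP_def nonlinearity_def power2_eq_square algebra_simps)
    also have "\<dots> = cmod (V x) powr (p + 1)"
    proof (cases "V x = 0")
      case False
      have "cmod (V x) powr (p - 1) * cmod (V x) powr 2 = cmod (V x) powr (p + 1)"
        unfolding powr_add[symmetric] by (simp add: algebra_simps)
      then show ?thesis using False by simp
    qed simp
    finally show "ReP V (nonlinearity p V) x = cmod (V x) powr (p + 1)" .
  qed
  have pi: "integrable lborel (\<lambda>x. cmod (V x) powr (p + 1))" by (rule cmod_powr_integrable[OF p L(1) K])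
  have "integrable lborel (\<lambda>x. (p + 1) * ReP (nonlinearity p V) V1 x)"
    using L NL by auto
  then have di: "integrable lborel (\<lambda>x. (p + 1) * (cmod (V x) powr (p - 1) * ReP V V1 x))"
    unfolding 2 using p by simp
  have sc: "sgn_conv (\<lambda>x. (p + 1) * (cmod (V x) powr (p - 1) * ReP V V1 x)) y = - 2 * cmod (V y) powr (p + 1)" for y
    by (rule sgn_conv_deriv[OF pi di cmod_powr_deriv[OF p has_L2_deriv_imp(3)[OF V]]])
  have "sgn_form (mass V) (ReP (nonlinearity p V) V1) = (1 / (p + 1)) * (LINT x|lborel. - 2 * (mass V x * cmod (V x) powr (p + 1)))"
  proof -
    have "sgn_form (mass V) (ReP (nonlinearity p V) V1) = (1 / (p + 1)) * sgn_form (mass V) (\<lambda>x. (p + 1) * (cmod (V x) powr (p - 1) * ReP V V1 x))"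
      unfolding 2 by (rule sgn_form_cmult_right)
    then show ?thesis unfolding sgn_form_def[of "mass V" "\<lambda>x. (p + 1) * (cmod (V x) powr (p - 1) * ReP V V1 x)"] sc
      by (simp add: mult.left_commute)
  qed
  then have "sgn_form (mass V) (ReP (nonlinearity p V) V1) = - (2 / (p + 1)) * (LINT x|lborel. mass V x * cmod (V x) powr (p + 1))"
    by simp
  then have "forcing V V1 (nonlinearity p V) = (2 - 4 / (p + 1)) * (LINT x|lborel. mass V x * cmod (V x) powr (p + 1))"
    unfolding forcing_def 1 3 by (simp add: sgn_form_def algebra_simps)
  also have "2 - 4 / (p + 1) = 2 * (p - 1) / (p + 1)" using p by (simp add: field_simps)
  finally show ?thesis .
qed

text \<open>Mean value theorem. For \<open>q < 1\<close> the derivative \<open>q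
  z\<^bsup>q-1\<^esup>\<close> is unbounded near 0, which the factor \<open>b\<close>
  compensates.\<close>
lemma powr_diff_bound:
  fixes a b q K :: real
  assumes q: "0 < q" and ab: "0 \<le> b" "b \<le> a" "a \<le> K"
  shows "(a powr q - b powr q) * b \<le> q * K powr q * (a - b)"
proof (cases "b = 0 \<or> a = b")
  case True
  then show ?thesis using q ab by (auto intro!: mult_nonneg_nonneg)
next
  case False
  then have lt: "0 < b" "b < a" using ab by auto
  have "\<exists>z. b < z \<and> z < a \<and> a powr q - b powr q = (a - b) * (q * z powr (q - 1))"
    using lt by (intro MVT2) (auto intro!: has_real_derivative_powr)
  then obtain z where z: "b < z" "z < a" "a powr q - b powr q = (a - b) * (q * z powr (q - 1))" by blast
  have "z powr (q - 1) * b \<le> z powr (q - 1) * z" using z lt by (intro mult_left_mono) auto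
  also have "\<dots> = z powr q" using z lt by (simp add: powr_diff)
  also have "\<dots> \<le> K powr q" using z lt ab q by (intro powr_mono2) auto
  finally have "z powr (q - 1) * b \<le> K powr q" .
  then have "((a - b) * q) * (z powr (q - 1) * b) \<le> ((a - b) * q) * K powr q" 
    using lt q by (intro mult_left_mono) auto
  then show ?thesis unfolding z(3) by (simp add: mult_ac)
qed

lemma nonlinearity_Lipschitz_pointwise:
  assumes p: "1 < p" and le: "cmod b \<le> cmod a" "cmod a \<le> K"
  shows "cmod (complex_of_real (cmod a powr (p - 1)) * a - complex_of_real (cmod b powr (p - 1)) * b) \<le> p * K powr (p - 1) * cmod (a - b)"
proof -
  have eq: "complex_of_real (cmod a powr (p - 1)) * a - complex_of_real (cmod b powr (p - 1)) * b = 
    complex_of_real (cmod a powr (p - 1)) * (a - b) + complex_of_real (cmod a powr (p - 1) - cmod b powr (p - 1)) * b"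
    by (simp add: algebra_simps)
  have "cmod (complex_of_real (cmod a powr (p - 1)) * (a - b)) \<le> K powr (p - 1) * cmod (a - b)"
    unfolding norm_mult using p le by (intro mult_right_mono) (auto intro!: powr_mono2)
  moreover have "cmod (complex_of_real (cmod a powr (p - 1) - cmod b powr (p - 1)) * b) \<le> (p - 1) * K powr (p - 1) * cmod (a - b)"
  proof -
    have "cmod b powr (p - 1) \<le> cmod a powr (p - 1)" using p le by (intro powr_mono2) auto
    then have "cmod (complex_of_real (cmod a powr (p - 1) - cmod b powr (p - 1)) * b) = (cmod a powr (p - 1) - cmod b powr (p - 1)) * cmod b"
      by (simp add: norm_mult norm_of_real del: of_real_diff)
    also have "\<dots> \<le> (p - 1) * K powr (p - 1) * (cmod a - cmod b)"
      using p le by (intro powr_diff_bound) auto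
    also have "\<dots> \<le> (p - 1) * K powr (p - 1) * cmod (a - b)"
      using p norm_triangle_ineq2[of a b] by (intro mult_left_mono) auto
    finally show ?thesis .
  qed
  ultimately show ?thesis unfolding eq
    using norm_triangle_ineq[of "complex_of_real (cmod a powr (p - 1)) * (a - b)" "complex_of_real (cmod a powr (p - 1) - cmod b powr (p - 1)) * b"]
    by (simp add: algebra_simps)
qed

lemma nonlinearity_Lipschitz:
  assumes p: "1 < p" and L: "V \<in> L2" "W \<in> L2" and K: "AE x in lborel. cmod (V x) \<le> K" "AE x in lborel. cmod (W x) \<le> K"
  shows "nrm (\<lambda>x. nonlinearity p V x - nonlinearity p W x) \<le> p * K powr (p - 1) * nrm (\<lambda>x. V x - W x)"
proof (rule nrm_bound)
  note [measurable] = L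
  show "(\<lambda>x. nonlinearity p V x - nonlinearity p W x) \<in> borel_measurable borel" unfolding nonlinearity_def by measurable
  show "AE x in lborel. cmod (nonlinearity p V x - nonlinearity p W x) \<le> p * K powr (p - 1) * cmod (V x - W x)"
    using K
  proof eventually_elim
    case (elim x)
    show ?case
    proof (cases "cmod (W x) \<le> cmod (V x)")
      case True
      then show ?thesis using nonlinearity_Lipschitz_pointwise[OF p True elim(1)] by (simp add: nonlinearity_def)
    next
      case False
      then have "cmod (V x) \<le> cmod (W x)" by simp
      from nonlinearity_Lipschitz_pointwise[OF p this elim(2)] show ?thesis
        by (simp add: nonlinearity_def norm_minus_commute)
    qed
  qed
qed (use L p in auto)

section \<open>Band-limited functions\<close>

definition band :: "real \<Rightarrow> (real \<Rightarrow> complex) \<Rightarrow> bool" where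
  "band N F \<longleftrightarrow> F \<in> L2 \<and> (\<forall>\<xi>. N < \<bar>\<xi>\<bar> \<longrightarrow> F \<xi> = 0)"

lemma band_trunc: "F \<in> L2 \<Longrightarrow> band N (trunc N F)"
  unfolding band_def by (auto simp: trunc_def indicator_def)

lemma band_integrable: 
  assumes "band N F" shows "integrable lborel F"
proof -
  have "trunc N F = F"
  proof (rule ext)
    fix x show "trunc N F x = F x"
      using assms by (cases "\<bar>x\<bar> \<le> N") (auto simp: band_def trunc_def indicator_def abs_le_iff)
  qed
  then show ?thesis using trunc_integrable[of F N] assms by (simp add: band_def)
qed

lemma band_mult:
  assumes F: "band N F" and [measurable]: "m \<in> borel_measurable borel" and B: "\<And>\<xi>. \<bar>\<xi>\<bar> \<le> N \<Longrightarrow> cmod (m \<xi>) \<le> B"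
  shows "band N (\<lambda>\<xi>. m \<xi> * F \<xi>)" "0 \<le> B \<Longrightarrow> nrm (\<lambda>\<xi>. m \<xi> * F \<xi>) \<le> B * nrm F"
proof -
  have FL: "F \<in> L2" using F by (simp add: band_def)
  note [measurable] = FL
  have b: "AE \<xi> in lborel. cmod (m \<xi> * F \<xi>) \<le> B * cmod (F \<xi>)"
  proof (rule AE_I2)
    fix \<xi>
    show "cmod (m \<xi> * F \<xi>) \<le> B * cmod (F \<xi>)"
      using F B[of \<xi>] by (cases "\<bar>\<xi>\<bar> \<le> N") (auto simp: band_def norm_mult intro!: mult_right_mono)
  qed
  show "band N (\<lambda>\<xi>. m \<xi> * F \<xi>)"
    using F L2_bound[OF FL _ b] by (auto simp: band_def)
  show "0 \<le> B \<Longrightarrow> nrm (\<lambda>\<xi>. m \<xi> * F \<xi>) \<le> B * nrm F"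
    by (rule nrm_bound[OF FL _ b]) auto
qed

lemma band_deriv: "band N F \<Longrightarrow> band N (\<lambda>\<xi>. \<i> * complex_of_real \<xi> * F \<xi>)"
  by (rule band_mult(1)[where B=N]) (auto simp: norm_mult)

lemma band_has_fourier: "band N F \<Longrightarrow> has_fourier (IFT F) F"
  by (rule has_fourier_IFT[OF band_integrable]) (auto simp: band_def)

lemma IFT_eq: "IFT F x = complex_of_real (1 / sqrt (2 * pi)) * (LINT \<xi>|lborel. cis (\<xi> * x) * F \<xi>)"
  by (simp add: IFT_def FT_def)

lemma IFT_bound: "cmod (IFT F x) \<le> (1 / sqrt (2 * pi)) * (LINT \<xi>|lborel. cmod (F \<xi>))"
  unfolding IFT_def by (rule FT_bound)

lemma cis_Taylor2: "cmod (cis a - 1 - \<i> * complex_of_real a) \<le> a\<^sup>2 / 2"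
  using iexp_approx1[of a 1] by (simp add: cis_conv_exp algebra_simps power2_eq_square)

text \<open>For band-limited functions the remainder of the Taylor expansion is bounded globally,
  so this crude criterion suffices.\<close>
lemma has_vector_derivative_quadratic:
  fixes f :: "real \<Rightarrow> complex"
  assumes "\<And>h. cmod (f (x + h) - f x - h *\<^sub>R D) \<le> B * h\<^sup>2"
  shows "(f has_vector_derivative D) (at x)"
  unfolding has_vector_derivative_def has_derivative_at
proof (intro conjI bounded_linear_scaleR_left)
  have l: "((\<lambda>h::real. B * \<bar>h\<bar>) \<longlongrightarrow> 0) (at 0)" by (auto intro!: tendsto_eq_intros)
  show "(\<lambda>h. cmod (f (x + h) - f x - h *\<^sub>R D) / norm h) \<midarrow>0\<rightarrow> 0"
  proof (rule Lim_null_comparison[OF always_eventually l], rule allI)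
    fix h :: real
    show "norm (cmod (f (x + h) - f x - h *\<^sub>R D) / norm h) \<le> B * \<bar>h\<bar>"
    proof (cases "h = 0")
      case False
      have "cmod (f (x + h) - f x - h *\<^sub>R D) \<le> B * \<bar>h\<bar> * \<bar>h\<bar>"
        using assms[of h] by (simp add: power2_eq_square mult.assoc)
      then show ?thesis using False by (simp add: divide_le_eq)
    qed simp
  qed
qed

text \<open>On the band the second-order Taylor remainder of \<open>cis (\<xi> * h)\<close> is at
  most \<open>N\<^sup>2 h\<^sup>2 / 2\<close>, uniformly in the frequency.\<close>
lemma IFT_band_deriv:
  assumes F: "band N F"
  shows "has_L2_deriv (IFT F) (IFT (\<lambda>\<xi>. \<i> * complex_of_real \<xi> * F \<xi>))"
proof -
  let ?c = "complex_of_real (1 / sqrt (2 * pi))"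
  let ?F1 = "\<lambda>\<xi>. \<i> * complex_of_real \<xi> * F \<xi>"
  have i: "integrable lborel F" "integrable lborel ?F1" using F band_deriv[OF F] band_integrable by blast+
  have ic: "integrable lborel (\<lambda>\<xi>. cis (\<xi> * x) * F \<xi>)" "integrable lborel (\<lambda>\<xi>. cis (\<xi> * x) * ?F1 \<xi>)" for x
    by (rule integrable_unimodular_mult[OF i(1)], simp_all) (rule integrable_unimodular_mult[OF i(2)], simp_all)
  have N2: "(1 / sqrt (2 * pi)) \<ge> 0" by simp
  have "(IFT F has_vector_derivative IFT ?F1 x) (at x)" for x
  proof (rule has_vector_derivative_quadratic)
    fix h
    have "IFT F (x + h) - IFT F x - h *\<^sub>R IFT ?F1 x = 
      ?c * ((LINT \<xi>|lborel. cis (\<xi> * (x + h)) * F \<xi>) - (LINT \<xi>|lborel. cis (\<xi> * x) * F \<xi>) - complex_of_real h * (LINT \<xi>|lborel. cis (\<xi> * x) * ?F1 \<xi>))"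
      unfolding IFT_eq by (simp only: scaleR_conv_of_real right_diff_distrib mult.left_commute)
    also have "complex_of_real h * (LINT \<xi>|lborel. cis (\<xi> * x) * ?F1 \<xi>) = (LINT \<xi>|lborel. complex_of_real h * (cis (\<xi> * x) * ?F1 \<xi>))" by simp
    also have "(LINT \<xi>|lborel. cis (\<xi> * (x + h)) * F \<xi>) - (LINT \<xi>|lborel. cis (\<xi> * x) * F \<xi>) - (LINT \<xi>|lborel. complex_of_real h * (cis (\<xi> * x) * ?F1 \<xi>))
       = (LINT \<xi>|lborel. cis (\<xi> * (x + h)) * F \<xi> - cis (\<xi> * x) * F \<xi> - complex_of_real h * (cis (\<xi> * x) * ?F1 \<xi>))"
      using ic(1)[of "x + h"] ic(1)[of x] ic(2)[of x] by simp
    also have "cmod (?c * \<dots>) \<le> (1 / sqrt (2 * pi)) * (LINT \<xi>|lborel. (N\<^sup>2 * h\<^sup>2 / 2) * cmod (F \<xi>))"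
    proof -
      have "cmod (LINT \<xi>|lborel. cis (\<xi> * (x + h)) * F \<xi> - cis (\<xi> * x) * F \<xi> - complex_of_real h * (cis (\<xi> * x) * ?F1 \<xi>)) \<le>
        (LINT \<xi>|lborel. cmod (cis (\<xi> * (x + h)) * F \<xi> - cis (\<xi> * x) * F \<xi> - complex_of_real h * (cis (\<xi> * x) * ?F1 \<xi>)))"
        by (rule integral_norm_bound)
      also have "\<dots> \<le> (LINT \<xi>|lborel. (N\<^sup>2 * h\<^sup>2 / 2) * cmod (F \<xi>))"
      proof (rule integral_mono)
        show "integrable lborel (\<lambda>\<xi>. cmod (cis (\<xi> * (x + h)) * F \<xi> - cis (\<xi> * x) * F \<xi> - complex_of_real h * (cis (\<xi> * x) * ?F1 \<xi>)))"
          by (intro integrable_norm Bochner_Integration.integrable_diff ic integrable_mult_right)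
        show "integrable lborel (\<lambda>\<xi>. (N\<^sup>2 * h\<^sup>2 / 2) * cmod (F \<xi>))" using i by simp
        fix \<xi>
        have "cis (\<xi> * (x + h)) = cis (\<xi> * x) * cis (\<xi> * h)" by (simp add: cis_mult algebra_simps)
        then have "cis (\<xi> * (x + h)) * F \<xi> - cis (\<xi> * x) * F \<xi> - complex_of_real h * (cis (\<xi> * x) * ?F1 \<xi>) = 
          cis (\<xi> * x) * F \<xi> * (cis (\<xi> * h) - 1 - \<i> * complex_of_real (\<xi> * h))"
          by (simp add: algebra_simps)
        then have "cmod (cis (\<xi> * (x + h)) * F \<xi> - cis (\<xi> * x) * F \<xi> - complex_of_real h * (cis (\<xi> * x) * ?F1 \<xi>)) = 
           cmod (cis (\<xi> * h) - 1 - \<i> * complex_of_real (\<xi> * h)) * cmod (F \<xi>)"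
          by (simp add: norm_mult)
        also have "\<dots> \<le> (N\<^sup>2 * h\<^sup>2 / 2) * cmod (F \<xi>)"
        proof (cases "\<bar>\<xi>\<bar> \<le> N")
          case True
          have "cmod (cis (\<xi> * h) - 1 - \<i> * complex_of_real (\<xi> * h)) \<le> (\<xi> * h)\<^sup>2 / 2" by (rule cis_Taylor2)
          also have "\<dots> = \<bar>\<xi>\<bar>\<^sup>2 * h\<^sup>2 / 2" by (simp add: power_mult_distrib)
          also have "\<dots> \<le> N\<^sup>2 * h\<^sup>2 / 2" using True by (intro divide_right_mono mult_right_mono power_mono) auto
          finally show ?thesis by (rule mult_right_mono) simp
        next
          case False
          then show ?thesis using F by (simp add: band_def)
        qed
        finally show "cmod (cis (\<xi> * (x + h)) * F \<xi> - cis (\<xi> * x) * F \<xi> - complex_of_real h * (cis (\<xi> * x) * ?F1 \<xi>)) \<le> (N\<^sup>2 * h\<^sup>2 / 2) * cmod (F \<xi>)" .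
      qed
      finally have *: "cmod (LINT \<xi>|lborel. cis (\<xi> * (x + h)) * F \<xi> - cis (\<xi> * x) * F \<xi> - complex_of_real h * (cis (\<xi> * x) * ?F1 \<xi>)) \<le>
        (LINT \<xi>|lborel. (N\<^sup>2 * h\<^sup>2 / 2) * cmod (F \<xi>))" .
      have cc: "cmod ?c = 1 / sqrt (2 * pi)" unfolding norm_of_real by simp
      show ?thesis unfolding norm_mult[of ?c] cc by (rule mult_left_mono[OF * N2])
    qed
    also have "\<dots> = ((1 / sqrt (2 * pi)) * (N\<^sup>2 / 2) * (LINT \<xi>|lborel. cmod (F \<xi>))) * h\<^sup>2" by (simp add: mult_ac)
    finally show "cmod (IFT F (x + h) - IFT F x - h *\<^sub>R IFT ?F1 x) \<le> ((1 / sqrt (2 * pi)) * (N\<^sup>2 / 2) * (LINT \<xi>|lborel. cmod (F \<xi>))) * h\<^sup>2" .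
  qed
  moreover have "IFT F \<in> L2" "IFT ?F1 \<in> L2"
    using has_fourier_L2(1)[OF band_has_fourier] F band_deriv[OF F] by blast+
  ultimately show ?thesis by (simp add: has_L2_deriv_def)
qed

section \<open>The low-pass cutoff\<close>

text \<open>The value 0 outside \<open>L2\<close> puts \<open>fourier f\<close> into
  \<open>L2\<close> for every \<open>f\<close>, so the low-pass versions of a curve are smooth in
  space at all times, including those outside its time interval.\<close>
definition fourier :: "(real \<Rightarrow> complex) \<Rightarrow> (real \<Rightarrow> complex)" where
  "fourier f = (if f \<in> L2 then SOME F. has_fourier f F else (\<lambda>\<xi>. 0))"

lemma has_fourier_fourier: "f \<in> L2 \<Longrightarrow> has_fourier f (fourier f)"
  unfolding fourier_def by (simp add: someI_ex[OF has_fourier_exists])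

lemma fourier_L2 [simp]: "fourier f \<in> L2"
  using has_fourier_fourier[of f] has_fourier_L2 by (cases "f \<in> L2") (auto simp: fourier_def)

lemma fourier_measurable [measurable]: "fourier f \<in> borel_measurable borel"
  by (rule L2_measurable) simp

lemma fourier_nrm: "f \<in> L2 \<Longrightarrow> nrm (fourier f) = nrm f"
  by (rule has_fourier_nrm[OF has_fourier_fourier])

definition lowpass :: "real \<Rightarrow> (real \<Rightarrow> complex) \<Rightarrow> (real \<Rightarrow> complex)" where
  "lowpass N f = IFT (trunc N (fourier f))"

definition lowpass_dx :: "real \<Rightarrow> (real \<Rightarrow> complex) \<Rightarrow> (real \<Rightarrow> complex)" where
  "lowpass_dx N f = IFT (\<lambda>\<xi>. \<i> * complex_of_real \<xi> * trunc N (fourier f) \<xi>)"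

definition lowpass_dxx :: "real \<Rightarrow> (real \<Rightarrow> complex) \<Rightarrow> (real \<Rightarrow> complex)" where
  "lowpass_dxx N f = IFT (\<lambda>\<xi>. \<i> * complex_of_real \<xi> * (\<i> * complex_of_real \<xi> * trunc N (fourier f) \<xi>))"

lemma lowpass_deriv: "has_L2_deriv (lowpass N f) (lowpass_dx N f)" "has_L2_deriv (lowpass_dx N f) (lowpass_dxx N f)"
  unfolding lowpass_def lowpass_dx_def lowpass_dxx_def
  by (intro IFT_band_deriv[of N] band_deriv band_trunc fourier_L2)+

lemma lowpass_has_fourier:
  "has_fourier (lowpass N f) (trunc N (fourier f))"
  "has_fourier (lowpass_dx N f) (\<lambda>\<xi>. \<i> * complex_of_real \<xi> * trunc N (fourier f) \<xi>)"
  "has_fourier (lowpass_dxx N f) (\<lambda>\<xi>. \<i> * complex_of_real \<xi> * (\<i> * complex_of_real \<xi> * trunc N (fourier f) \<xi>))"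
  unfolding lowpass_def lowpass_dx_def lowpass_dxx_def
  by (intro band_has_fourier[of N] band_deriv band_trunc fourier_L2)+

lemma lowpass_L2 [simp, intro]: "lowpass N f \<in> L2" "lowpass_dx N f \<in> L2" "lowpass_dxx N f \<in> L2"
  using lowpass_has_fourier has_fourier_L2 by blast+

lemma trunc_le: "cmod (trunc N F x) \<le> cmod (F x)"
  by (simp add: trunc_def indicator_def)

lemma lowpass_nrm: "f \<in> L2 \<Longrightarrow> nrm (lowpass N f) \<le> nrm f"
  using nrm_mono[OF fourier_L2[of f], of "trunc N (fourier f)"] has_fourier_nrm[OF lowpass_has_fourier(1)[of N f]]
  by (simp add: trunc_le fourier_nrm trunc_L2 L2_measurable)

lemma lowpass_tendsto:
  assumes f: "f \<in> L2" shows "(\<lambda>n. nrm (\<lambda>x. lowpass (real n) f x - f x)) \<longlonglongrightarrow> 0"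
proof -
  have "((\<lambda>n. nrm (\<lambda>\<xi>. fourier f \<xi> - trunc (real n) (fourier f) \<xi>)) \<longlonglongrightarrow> 0)"
    by (rule filterlim_compose[OF trunc_tendsto[OF fourier_L2] filterlim_real_sequentially])
  moreover have "nrm (\<lambda>x. lowpass (real n) f x - f x) = nrm (\<lambda>\<xi>. fourier f \<xi> - trunc (real n) (fourier f) \<xi>)" for n
    using has_fourier_nrm[OF has_fourier_diff[OF lowpass_has_fourier(1)[of "real n" f] has_fourier_fourier[OF f]]]
    by (simp add: nrm_minus_commute[of "fourier f"])
  ultimately show ?thesis by simp
qed

section \<open>Functions in H1\<close>

text \<open>The Fourier weight of \<open>H_norm 1\<close>.\<close>
definition bracket :: "real \<Rightarrow> real" where "bracket \<xi> = (1 + \<xi>\<^sup>2) powr (1 / 2)"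

lemma bracket_sqrt: "bracket \<xi> = sqrt (1 + \<xi>\<^sup>2)"
  unfolding bracket_def by (rule powr_half_sqrt) simp

lemma bracket_measurable [measurable]: "bracket \<in> borel_measurable borel"
  unfolding bracket_def[abs_def] by measurable

lemma bracket_ge: "1 \<le> bracket \<xi>" "\<bar>\<xi>\<bar> \<le> bracket \<xi>" "0 < bracket \<xi>"
proof -
  show "1 \<le> bracket \<xi>" unfolding bracket_sqrt by simp
  then show "0 < bracket \<xi>" by linarith
  show "\<bar>\<xi>\<bar> \<le> bracket \<xi>" unfolding bracket_sqrt by (rule real_le_rsqrt) simp
qed

definition H1 :: "(real \<Rightarrow> complex) \<Rightarrow> bool" where
  "H1 f \<longleftrightarrow> f \<in> L2 \<and> (\<lambda>\<xi>. complex_of_real (bracket \<xi>) * fourier f \<xi>) \<in> L2"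

definition H1_nrm :: "(real \<Rightarrow> complex) \<Rightarrow> real" where
  "H1_nrm f = nrm (\<lambda>\<xi>. complex_of_real (bracket \<xi>) * fourier f \<xi>)"

definition Hdot1_nrm :: "(real \<Rightarrow> complex) \<Rightarrow> real" where
  "Hdot1_nrm f = nrm (\<lambda>\<xi>. complex_of_real \<xi> * fourier f \<xi>)"

lemma H_norm_H1: "H_norm 1 f < \<infinity> \<Longrightarrow> H1 f" "H1 f \<Longrightarrow> H_norm 1 f = ennreal (H1_nrm f)"
proof -
  have m: "(\<lambda>\<xi>. complex_of_real ((1 + \<xi>\<^sup>2) powr (1 / 2))) \<in> borel_measurable borel" by measurable
  show "H1 f" if "H_norm 1 f < \<infinity>"
    using multiplier_norm_finite[OF that[unfolded H_norm_def] m] has_fourier_fourier[of f]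
    unfolding H1_def bracket_def by blast
  show "H_norm 1 f = ennreal (H1_nrm f)" if "H1 f"
    using multiplier_norm_eq[OF has_fourier_fourier _ m] that unfolding H1_def H1_nrm_def bracket_def H_norm_def by blast
qed

lemma H1_L2: "H1 f \<Longrightarrow> f \<in> L2" by (simp add: H1_def)

lemma H1_bounds:
  assumes "H1 f" shows "(\<lambda>\<xi>. complex_of_real \<xi> * fourier f \<xi>) \<in> L2" "Hdot1_nrm f \<le> H1_nrm f" "nrm f \<le> H1_nrm f"
proof -
  have L: "(\<lambda>\<xi>. complex_of_real (bracket \<xi>) * fourier f \<xi>) \<in> L2" using assms by (simp add: H1_def)
  have b: "AE \<xi> in lborel. cmod (complex_of_real \<xi> * fourier f \<xi>) \<le> 1 * cmod (complex_of_real (bracket \<xi>) * fourier f \<xi>)"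
    using bracket_ge(2,3) by (intro AE_I2) (simp add: norm_mult mult_right_mono abs_of_pos)
  show "(\<lambda>\<xi>. complex_of_real \<xi> * fourier f \<xi>) \<in> L2" by (rule L2_bound[OF L _ b]) measurable
  show "Hdot1_nrm f \<le> H1_nrm f" unfolding Hdot1_nrm_def H1_nrm_def using nrm_bound[OF L _ b] by simp
  have "nrm (fourier f) \<le> nrm (\<lambda>\<xi>. complex_of_real (bracket \<xi>) * fourier f \<xi>)"
  proof (rule nrm_mono[OF L])
    show "AE \<xi> in lborel. cmod (fourier f \<xi>) \<le> cmod (complex_of_real (bracket \<xi>) * fourier f \<xi>)"
    proof (rule AE_I2)
      fix \<xi>
      have "1 * cmod (fourier f \<xi>) \<le> bracket \<xi> * cmod (fourier f \<xi>)" using bracket_ge(1) by (intro mult_right_mono) auto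
      then show "cmod (fourier f \<xi>) \<le> cmod (complex_of_real (bracket \<xi>) * fourier f \<xi>)" using bracket_ge(3)[of \<xi>] by (simp add: norm_mult)
    qed
  qed measurable
  then show "nrm f \<le> H1_nrm f" using fourier_nrm[of f] assms by (simp add: H1_def H1_nrm_def)
qed

lemma Hdot_norm_eq:
  assumes "H1 f" shows "Hdot_norm 1 f = ennreal (Hdot1_nrm f)"
proof -
  let ?m = "\<lambda>\<xi>. complex_of_real (\<bar>\<xi>\<bar> powr 1)"
  have m: "?m \<in> borel_measurable borel" by measurable
  have L: "(\<lambda>\<xi>. ?m \<xi> * fourier f \<xi>) \<in> L2"
    by (rule L2_bound[OF H1_bounds(1)[OF assms], where C=1]) (auto simp: norm_mult)
  have "nrm (\<lambda>\<xi>. ?m \<xi> * fourier f \<xi>) = Hdot1_nrm f"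
    unfolding Hdot1_nrm_def nrm_def by (simp add: norm_mult)
  then show ?thesis unfolding Hdot_norm_def
    using multiplier_norm_eq[OF has_fourier_fourier L m] assms by (simp add: H1_def)
qed

text \<open>The constant of the embedding of H1 into the bounded functions. It comes from
  Cauchy--Schwarz applied to \<open>fourier f = (1 / bracket) * (bracket * fourier
  f)\<close>.\<close>
definition sobolev_const :: real where
  "sobolev_const = (1 / sqrt (2 * pi)) * nrm (\<lambda>\<xi>. complex_of_real (1 / bracket \<xi>))"

lemma inverse_bracket_L2: "(\<lambda>\<xi>. complex_of_real (1 / bracket \<xi>)) \<in> L2"
proof -
  have "integrable lborel (\<lambda>x::real. inverse (1 + x\<^sup>2))"
    using integrable_inverse_1_plus_square by (simp add: set_integrable_def)
  moreover have "(cmod (complex_of_real (1 / bracket \<xi>)))\<^sup>2 = inverse (1 + \<xi>\<^sup>2)" for \<xi>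
  proof -
    have "(cmod (complex_of_real (1 / bracket \<xi>)))\<^sup>2 = (1 / bracket \<xi>)\<^sup>2" by (simp only: norm_of_real power2_abs)
    then show ?thesis by (simp add: bracket_sqrt power_divide inverse_eq_divide)
  qed
  ultimately show ?thesis by (simp add: L2_iff)
qed

lemma H1_fourier_integrable:
  assumes "H1 f" shows "integrable lborel (fourier f)" 
   "(1 / sqrt (2 * pi)) * (LINT \<xi>|lborel. cmod (fourier f \<xi>)) \<le> sobolev_const * H1_nrm f"
proof -
  have L: "(\<lambda>\<xi>. complex_of_real (bracket \<xi>) * fourier f \<xi>) \<in> L2" using assms by (simp add: H1_def)
  have eq: "complex_of_real (1 / bracket \<xi>) * (complex_of_real (bracket \<xi>) * fourier f \<xi>) = fourier f \<xi>" for \<xi>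
    using bracket_ge(3)[of \<xi>] by simp
  show "integrable lborel (fourier f)" using L2_mult_integrable[OF inverse_bracket_L2 L] unfolding eq .
  have "(LINT \<xi>|lborel. cmod (fourier f \<xi>)) \<le> nrm (\<lambda>\<xi>. complex_of_real (1 / bracket \<xi>)) * H1_nrm f"
    using L2_mult_integral_bound(1)[OF inverse_bracket_L2 L] unfolding eq H1_nrm_def .
  then have "(1 / sqrt (2 * pi)) * (LINT \<xi>|lborel. cmod (fourier f \<xi>)) \<le> (1 / sqrt (2 * pi)) * (nrm (\<lambda>\<xi>. complex_of_real (1 / bracket \<xi>)) * H1_nrm f)"
    by (intro mult_left_mono) auto
  then show "(1 / sqrt (2 * pi)) * (LINT \<xi>|lborel. cmod (fourier f \<xi>)) \<le> sobolev_const * H1_nrm f"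
    by (simp add: sobolev_const_def mult.assoc)
qed

lemma sobolev_const_nonneg: "0 \<le> sobolev_const" unfolding sobolev_const_def by simp

lemma lowpass_bound:
  assumes "H1 f" shows "cmod (lowpass N f x) \<le> sobolev_const * H1_nrm f"
proof -
  have "cmod (lowpass N f x) \<le> (1 / sqrt (2 * pi)) * (LINT \<xi>|lborel. cmod (trunc N (fourier f) \<xi>))"
    unfolding lowpass_def by (rule IFT_bound)
  also have "\<dots> \<le> (1 / sqrt (2 * pi)) * (LINT \<xi>|lborel. cmod (fourier f \<xi>))"
    using H1_fourier_integrable(1)[OF assms] trunc_le
    by (intro mult_left_mono integral_mono integrable_norm trunc_integrable) auto
  also have "\<dots> \<le> sobolev_const * H1_nrm f" by (rule H1_fourier_integrable(2)[OF assms])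
  finally show ?thesis .
qed

lemma H1_bound:
  assumes "H1 f" shows "AE x in lborel. cmod (f x) \<le> sobolev_const * H1_nrm f"
proof -
  have "AE x in lborel. f x = IFT (fourier f) x"
    using assms by (intro fourier_inversion has_fourier_fourier H1_fourier_integrable) (auto simp: H1_def)
  then show ?thesis
  proof (rule eventually_mono)
    fix x assume "f x = IFT (fourier f) x"
    then show "cmod (f x) \<le> sobolev_const * H1_nrm f"
      using IFT_bound[of "fourier f" x] H1_fourier_integrable(2)[OF assms] by simp
  qed
qed

lemma lowpass_pointwise:
  assumes "H1 f" shows "AE x in lborel. (\<lambda>n. lowpass (real n) f x) \<longlonglongrightarrow> f x"
proof -
  have i: "integrable lborel (fourier f)" by (rule H1_fourier_integrable(1)[OF assms])
  have "(\<lambda>n. lowpass (real n) f x) \<longlonglongrightarrow> IFT (fourier f) x" for x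
    unfolding lowpass_def IFT_eq
  proof (intro tendsto_mult tendsto_const integral_dominated_convergence[where w="\<lambda>\<xi>. cmod (fourier f \<xi>)"])
    show "AE \<xi> in lborel. (\<lambda>n. cis (\<xi> * x) * trunc (real n) (fourier f) \<xi>) \<longlonglongrightarrow> cis (\<xi> * x) * fourier f \<xi>"
    proof (rule AE_I2)
      fix \<xi> :: real
      obtain n0 :: nat where n0: "\<bar>\<xi>\<bar> \<le> real n0" using real_arch_simple by blast
      have "\<forall>\<^sub>F n in sequentially. cis (\<xi> * x) * trunc (real n) (fourier f) \<xi> = cis (\<xi> * x) * fourier f \<xi>"
        using n0 by (intro eventually_sequentiallyI[of n0]) (auto simp: trunc_def indicator_def)
      then show "(\<lambda>n. cis (\<xi> * x) * trunc (real n) (fourier f) \<xi>) \<longlonglongrightarrow> cis (\<xi> * x) * fourier f \<xi>"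
        by (rule tendsto_eventually)
    qed
    show "AE \<xi> in lborel. norm (cis (\<xi> * x) * trunc (real n) (fourier f) \<xi>) \<le> cmod (fourier f \<xi>)" for n
      by (intro AE_I2) (simp add: norm_mult trunc_le)
    show "(\<lambda>\<xi>. cis (\<xi> * x) * trunc (real n) (fourier f) \<xi>) \<in> borel_measurable lborel" for n
      unfolding trunc_def by measurable
  qed (use i in auto)
  moreover have "AE x in lborel. f x = IFT (fourier f) x"
    using assms i by (intro fourier_inversion has_fourier_fourier) (auto simp: H1_def)
  ultimately show ?thesis by auto
qed

text \<open>The weak derivative of an H1 function.\<close>
definition dx :: "(real \<Rightarrow> complex) \<Rightarrow> (real \<Rightarrow> complex)" where
  "dx f = fourier_multiplier (\<lambda>\<xi>. \<i> * complex_of_real \<xi>) f"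

lemma dx_has_fourier:
  assumes "H1 f" shows "has_fourier (dx f) (\<lambda>\<xi>. \<i> * complex_of_real \<xi> * fourier f \<xi>)"
  unfolding dx_def
proof (rule fourier_multiplier_has_fourier)
  show "(\<lambda>\<xi>. \<i> * complex_of_real \<xi> * fourier f \<xi>) \<in> L2"
    using L2_cmult[OF H1_bounds(1)[OF assms], of \<i>] by (simp add: mult.assoc)
qed (use assms in \<open>auto simp: H1_def intro: has_fourier_fourier\<close>)

lemma dx_L2: "H1 f \<Longrightarrow> dx f \<in> L2"
  using dx_has_fourier has_fourier_L2 by blast

lemma lowpass_dx_tendsto:
  assumes f: "H1 f" shows "(\<lambda>n. nrm (\<lambda>x. lowpass_dx (real n) f x - dx f x)) \<longlonglongrightarrow> 0"
proof -
  let ?G = "\<lambda>\<xi>. \<i> * complex_of_real \<xi> * fourier f \<xi>"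
  have GL: "?G \<in> L2" using has_fourier_L2[OF dx_has_fourier[OF f]] by simp
  have "((\<lambda>n. nrm (\<lambda>\<xi>. ?G \<xi> - trunc (real n) ?G \<xi>)) \<longlonglongrightarrow> 0)"
    by (rule filterlim_compose[OF trunc_tendsto[OF GL] filterlim_real_sequentially])
  moreover have "nrm (\<lambda>x. lowpass_dx (real n) f x - dx f x) = nrm (\<lambda>\<xi>. ?G \<xi> - trunc (real n) ?G \<xi>)" for n
  proof -
    have "trunc (real n) ?G = (\<lambda>\<xi>. \<i> * complex_of_real \<xi> * trunc (real n) (fourier f) \<xi>)"
      by (auto simp: trunc_def)
    then show ?thesis
      using has_fourier_nrm[OF has_fourier_diff[OF lowpass_has_fourier(2)[of "real n" f] dx_has_fourier[OF f]]]
      by (simp add: nrm_minus_commute[of ?G])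
  qed
  ultimately show ?thesis by simp
qed

lemma lowpass_dx_nrm:
  assumes f: "H1 f" shows "nrm (lowpass_dx N f) \<le> Hdot1_nrm f"
proof -
  have "nrm (lowpass_dx N f) = nrm (\<lambda>\<xi>. \<i> * complex_of_real \<xi> * trunc N (fourier f) \<xi>)"
    using has_fourier_nrm[OF lowpass_has_fourier(2)[of N f]] by simp
  also have "\<dots> \<le> Hdot1_nrm f"
    unfolding Hdot1_nrm_def
  proof (rule nrm_mono[OF H1_bounds(1)[OF f]])
    show "AE \<xi> in lborel. cmod (\<i> * complex_of_real \<xi> * trunc N (fourier f) \<xi>) \<le> cmod (complex_of_real \<xi> * fourier f \<xi>)"
      by (intro AE_I2) (simp add: norm_mult mult_left_mono trunc_le)
  qed (unfold trunc_def, measurable)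
  finally show ?thesis .
qed

section \<open>Removing the cutoff\<close>

text \<open>Both factors converge in L2, which alone gives convergence of the product in L1 only.
  Convergence in L2 holds because the low-pass functions are bounded uniformly in the cutoff and
  converge almost everywhere.\<close>
lemma ReP_lowpass_tendsto:
  assumes f: "H1 f"
  shows "(\<lambda>n. LINT x|lborel. (ReP (lowpass (real n) f) (lowpass_dx (real n) f) x)\<^sup>2) \<longlonglongrightarrow> (LINT x|lborel. (ReP f (dx f) x)\<^sup>2)"
    "(\<lambda>x. complex_of_real (ReP f (dx f) x)) \<in> L2"
proof -
  let ?V = "\<lambda>n. lowpass (real n) f" and ?V1 = "\<lambda>n. lowpass_dx (real n) f"
  let ?K = "sobolev_const * H1_nrm f"
  have K0: "0 \<le> ?K" using sobolev_const_nonneg by (simp add: H1_nrm_def)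
  have L: "f \<in> L2" "dx f \<in> L2" using f by (auto simp: H1_def dx_L2)
  have [measurable]: "f \<in> borel_measurable borel" "dx f \<in> borel_measurable borel" using L by (auto intro: L2_measurable)
  have [measurable]: "lowpass N f \<in> borel_measurable borel" "lowpass_dx N f \<in> borel_measurable borel" for N by (auto intro!: L2_measurable)
  have bf: "AE x in lborel. cmod (f x) \<le> ?K" by (rule H1_bound[OF f])
  have RM[measurable]: "ReP U W \<in> borel_measurable borel" if "U \<in> borel_measurable borel" "W \<in> borel_measurable borel" for U W
    unfolding ReP_def[abs_def] using that by measurable
  show RL: "(\<lambda>x. complex_of_real (ReP f (dx f) x)) \<in> L2"
  proof (rule L2_bound[OF L(2), where C="?K"])
    show "AE x in lborel. cmod (complex_of_real (ReP f (dx f) x)) \<le> ?K * cmod (dx f x)"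
      using bf
    proof (rule eventually_mono)
      fix x assume "cmod (f x) \<le> ?K"
      then show "cmod (complex_of_real (ReP f (dx f) x)) \<le> ?K * cmod (dx f x)"
        using abs_Re_le_cmod[of "cnj (f x) * dx f x"] mult_right_mono[of "cmod (f x)" ?K "cmod (dx f x)"]
        unfolding ReP_def norm_of_real by (simp add: norm_mult del: times_complex.sel)
    qed
  qed measurable
  have VL: "(\<lambda>x. complex_of_real (ReP (?V n) (?V1 n) x)) \<in> L2" for n
  proof (rule L2_bound[where g="?V1 n" and C="?K"])
    show "AE x in lborel. cmod (complex_of_real (ReP (?V n) (?V1 n) x)) \<le> ?K * cmod (?V1 n x)"
    proof (rule AE_I2)
      fix x
      show "cmod (complex_of_real (ReP (?V n) (?V1 n) x)) \<le> ?K * cmod (?V1 n x)"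
        using abs_Re_le_cmod[of "cnj (?V n x) * ?V1 n x"] mult_right_mono[OF lowpass_bound[OF f, of "real n" x], of "cmod (?V1 n x)"]
        unfolding ReP_def norm_of_real by (simp add: norm_mult del: times_complex.sel)
    qed
  qed (auto, measurable)
  let ?A = "\<lambda>n x. complex_of_real ?K * (?V1 n x - dx f x)" and ?B = "\<lambda>n x. cnj (?V n x - f x) * dx f x"
  have AL: "?A n \<in> L2" for n using L by auto
  have Bb: "AE x in lborel. cmod (?B n x) \<le> cmod (complex_of_real (2 * ?K) * dx f x)" for n
    using bf
  proof (rule eventually_mono)
    fix x assume "cmod (f x) \<le> ?K"
    then have "cmod (?V n x - f x) \<le> 2 * ?K"
      using lowpass_bound[OF f, of "real n" x] norm_triangle_ineq4[of "?V n x" "f x"] by linarith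
    then have "cmod (?V n x - f x) * cmod (dx f x) \<le> (2 * ?K) * cmod (dx f x)" by (rule mult_right_mono) simp
    moreover have "cmod (?B n x) = cmod (?V n x - f x) * cmod (dx f x)"
      unfolding norm_mult complex_mod_cnj ..
    moreover have "cmod (complex_of_real (2 * ?K) * dx f x) = (2 * ?K) * cmod (dx f x)"
      unfolding norm_mult norm_of_real using K0 by simp
    ultimately show "cmod (?B n x) \<le> cmod (complex_of_real (2 * ?K) * dx f x)" by simp
  qed
  have BL: "?B n \<in> L2" for n
    by (rule L2_bound[OF L2_cmult[OF L(2)], where C=1]) (use Bb in auto)
  have Bl: "(\<lambda>n. nrm (?B n)) \<longlonglongrightarrow> 0"
  proof (rule nrm_dominated_convergence[OF L2_cmult[OF L(2)] _ _ Bb])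
    show "?B n \<in> borel_measurable borel" for n by measurable
    show "AE x in lborel. (\<lambda>n. ?B n x) \<longlonglongrightarrow> 0"
      using lowpass_pointwise[OF f]
    proof (rule eventually_mono)
      fix x assume "(\<lambda>n. ?V n x) \<longlonglongrightarrow> f x"
      then have "(\<lambda>n. ?B n x) \<longlonglongrightarrow> cnj (f x - f x) * dx f x" by (intro tendsto_intros)
      then show "(\<lambda>n. ?B n x) \<longlonglongrightarrow> 0" by simp
    qed
  qed
  have "(\<lambda>n. ?K * nrm (\<lambda>x. ?V1 n x - dx f x) + nrm (?B n)) \<longlonglongrightarrow> ?K * 0 + 0"
    by (intro tendsto_intros Bl lowpass_dx_tendsto f)
  then have l: "(\<lambda>n. ?K * nrm (\<lambda>x. ?V1 n x - dx f x) + nrm (?B n)) \<longlonglongrightarrow> 0" by simp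
  have "(\<lambda>n. nrm (\<lambda>x. complex_of_real (ReP (?V n) (?V1 n) x) - complex_of_real (ReP f (dx f) x))) \<longlonglongrightarrow> 0"
  proof (rule Lim_null_comparison[OF always_eventually l], rule allI)
    fix n
    let ?C = "\<lambda>x. cnj (?V n x) * (?V1 n x - dx f x)"
    have Cb: "AE x in lborel. cmod (?C x) \<le> ?K * cmod (?V1 n x - dx f x)"
      using lowpass_bound[OF f, of "real n"] by (intro AE_I2) (simp add: norm_mult mult_right_mono)
    have dL: "(\<lambda>x. ?V1 n x - dx f x) \<in> L2" using L by auto
    have CL: "?C \<in> L2" by (rule L2_bound[OF dL _ Cb]) measurable
    have "nrm (\<lambda>x. complex_of_real (ReP (?V n) (?V1 n) x) - complex_of_real (ReP f (dx f) x)) \<le> nrm (\<lambda>x. ?C x + ?B n x)"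
    proof (rule nrm_mono)
      show "(\<lambda>x. ?C x + ?B n x) \<in> L2" by (intro L2_add CL BL)
      show "AE x in lborel. cmod (complex_of_real (ReP (?V n) (?V1 n) x) - complex_of_real (ReP f (dx f) x)) \<le> cmod (?C x + ?B n x)"
      proof (rule AE_I2)
        fix x
        have "ReP (?V n) (?V1 n) x - ReP f (dx f) x = Re (?C x + ?B n x)"
          unfolding ReP_def by (simp add: algebra_simps)
        then show "cmod (complex_of_real (ReP (?V n) (?V1 n) x) - complex_of_real (ReP f (dx f) x)) \<le> cmod (?C x + ?B n x)"
          unfolding of_real_diff[symmetric] norm_of_real by (simp only: abs_Re_le_cmod)
      qed
    qed measurable
    also have "\<dots> \<le> nrm ?C + nrm (?B n)" by (rule nrm_triangle[OF CL BL])
    also have "nrm ?C \<le> ?K * nrm (\<lambda>x. ?V1 n x - dx f x)" by (rule nrm_bound[OF dL _ Cb K0]) measurable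
    finally show "norm (nrm (\<lambda>x. complex_of_real (ReP (?V n) (?V1 n) x) - complex_of_real (ReP f (dx f) x))) \<le> ?K * nrm (\<lambda>x. ?V1 n x - dx f x) + nrm (?B n)"
      by simp
  qed
  from nrm_tendsto[OF this RL] have "(\<lambda>n. nrm (\<lambda>x. complex_of_real (ReP (?V n) (?V1 n) x))) \<longlonglongrightarrow> nrm (\<lambda>x. complex_of_real (ReP f (dx f) x))"
    using VL by auto
  from tendsto_power[OF this, of 2]
  show "(\<lambda>n. LINT x|lborel. (ReP (?V n) (?V1 n) x)\<^sup>2) \<longlonglongrightarrow> (LINT x|lborel. (ReP f (dx f) x)\<^sup>2)"
    by (simp add: nrm_sq)
qed

lemma cmod_powr_eq: "mass V x * cmod (V x) powr (p + 1) = cmod (V x) powr (p + 3)"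
proof (cases "V x = 0")
  case False
  have "cmod (V x) powr 2 * cmod (V x) powr (p + 1) = cmod (V x) powr (p + 3)"
    unfolding powr_add[symmetric] by (simp add: algebra_simps)
  then show ?thesis using False by (simp add: mass_def)
qed (simp add: mass_def)

lemma nonlinearity_H1:
  assumes p: "1 < p" and f: "H1 f"
  shows "nonlinearity p f \<in> L2" "nrm (nonlinearity p f) \<le> (sobolev_const * H1_nrm f) powr (p - 1) * nrm f"
proof -
  have L: "f \<in> L2" using f by (simp add: H1_def)
  note [measurable] = L2_measurable[OF L]
  have m: "nonlinearity p f \<in> borel_measurable borel" unfolding nonlinearity_def by measurable
  have b: "AE x in lborel. cmod (nonlinearity p f x) \<le> (sobolev_const * H1_nrm f) powr (p - 1) * cmod (f x)"
    using H1_bound[OF f] by (rule eventually_mono) (use p in \<open>auto simp: nonlinearity_def norm_mult intro!: mult_right_mono powr_mono2\<close>)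
  show "nonlinearity p f \<in> L2" by (rule L2_bound[OF L m b])
  show "nrm (nonlinearity p f) \<le> (sobolev_const * H1_nrm f) powr (p - 1) * nrm f" by (rule nrm_bound[OF L m b]) simp
qed

lemma nonlinearity_lowpass_tendsto:
  assumes p: "1 < p" and f: "H1 f"
  shows "(\<lambda>n. nrm (\<lambda>x. nonlinearity p (lowpass (real n) f) x - nonlinearity p f x)) \<longlonglongrightarrow> 0"
proof -
  let ?K = "sobolev_const * H1_nrm f"
  have L: "f \<in> L2" using f by (simp add: H1_def)
  have "(\<lambda>n. p * ?K powr (p - 1) * nrm (\<lambda>x. lowpass (real n) f x - f x)) \<longlonglongrightarrow> p * ?K powr (p - 1) * 0"
    by (intro tendsto_intros lowpass_tendsto L)
  then have l: "(\<lambda>n. p * ?K powr (p - 1) * nrm (\<lambda>x. lowpass (real n) f x - f x)) \<longlonglongrightarrow> 0" by simp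
  show ?thesis
  proof (rule Lim_null_comparison[OF always_eventually l], rule allI)
    fix n
    have "nrm (\<lambda>x. nonlinearity p (lowpass (real n) f) x - nonlinearity p f x) \<le> p * ?K powr (p - 1) * nrm (\<lambda>x. lowpass (real n) f x - f x)"
      by (rule nonlinearity_Lipschitz[OF p _ L _ H1_bound[OF f]]) (auto intro: lowpass_bound[OF f])
    then show "norm (nrm (\<lambda>x. nonlinearity p (lowpass (real n) f) x - nonlinearity p f x)) \<le> p * ?K powr (p - 1) * nrm (\<lambda>x. lowpass (real n) f x - f x)" by simp
  qed
qed

text \<open>As a product of two square-integrable functions the potential energy density converges
  in L1 as soon as the factors converge in L2; the second factor is the nonlinearity with exponent
  \<open>p + 2\<close>.\<close>
lemma potential_as_product:
  assumes "nonlinearity (p + 2) V \<in> L2" "V \<in> L2"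
  shows "complex_of_real (LINT x|lborel. cmod (V x) powr (p + 3)) = (LINT x|lborel. cnj (V x) * nonlinearity (p + 2) V x)"
    "integrable lborel (\<lambda>x. cmod (V x) powr (p + 3))"
proof -
  have eq: "cnj (V x) * nonlinearity (p + 2) V x = complex_of_real (cmod (V x) powr (p + 3))" for x
  proof -
    have "cnj (V x) * nonlinearity (p + 2) V x = complex_of_real (cmod (V x) powr (p + 1)) * (V x * cnj (V x))"
      unfolding nonlinearity_def by (simp add: algebra_simps)
    also have "\<dots> = complex_of_real (cmod (V x) powr (p + 1)) * complex_of_real (mass V x)"
      unfolding mass_def complex_norm_square ..
    also have "\<dots> = complex_of_real (cmod (V x) powr (p + 3))"
      unfolding of_real_mult[symmetric] cmod_powr_eq[symmetric] by (simp add: mult.commute)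
    finally show ?thesis .
  qed
  have "integrable lborel (\<lambda>x. cnj (V x) * nonlinearity (p + 2) V x)"
    using assms by (intro cnj_mult_integrable)
  from integrable_norm[OF this] show "integrable lborel (\<lambda>x. cmod (V x) powr (p + 3))" unfolding eq by simp
  show "complex_of_real (LINT x|lborel. cmod (V x) powr (p + 3)) = (LINT x|lborel. cnj (V x) * nonlinearity (p + 2) V x)"
    unfolding eq by simp
qed

lemma potential_lowpass_tendsto:
  assumes p: "1 < p" and f: "H1 f"
  shows "(\<lambda>n. LINT x|lborel. mass (lowpass (real n) f) x * cmod (lowpass (real n) f x) powr (p + 1)) \<longlonglongrightarrow> (LINT x|lborel. cmod (f x) powr (p + 3))"
    "integrable lborel (\<lambda>x. cmod (f x) powr (p + 3))"
proof -
  have p2: "1 < p + 2" using p by simp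
  have L: "f \<in> L2" using f by (simp add: H1_def)
  have NL: "nonlinearity (p + 2) f \<in> L2" by (rule nonlinearity_H1(1)[OF p2 f])
  have NLn: "nonlinearity (p + 2) (lowpass N f) \<in> L2" for N by (rule nonlinearity_L2(1)[OF p2 _ lowpass_bound[OF f]]) auto
  show "integrable lborel (\<lambda>x. cmod (f x) powr (p + 3))" by (rule potential_as_product(2)[OF NL L])
  have "(\<lambda>n. nrm (\<lambda>x. cnj (lowpass (real n) f x) - cnj (f x))) \<longlonglongrightarrow> 0"
    using lowpass_tendsto[OF L] by (simp flip: complex_cnj_diff)
  then have "(\<lambda>n. LINT x|lborel. cnj (lowpass (real n) f x) * nonlinearity (p + 2) (lowpass (real n) f) x) \<longlonglongrightarrow> (LINT x|lborel. cnj (f x) * nonlinearity (p + 2) f x)"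
    using L NL NLn by (intro L2_mult_integral_tendsto nonlinearity_lowpass_tendsto p2 f) auto
  then have "(\<lambda>n. complex_of_real (LINT x|lborel. cmod (lowpass (real n) f x) powr (p + 3))) \<longlonglongrightarrow> complex_of_real (LINT x|lborel. cmod (f x) powr (p + 3))"
    unfolding potential_as_product(1)[OF NL L] potential_as_product(1)[OF NLn lowpass_L2(1)] .
  then show "(\<lambda>n. LINT x|lborel. mass (lowpass (real n) f) x * cmod (lowpass (real n) f x) powr (p + 1)) \<longlonglongrightarrow> (LINT x|lborel. cmod (f x) powr (p + 3))"
    unfolding cmod_powr_eq tendsto_of_real_iff .
qed

section \<open>Integrals of L2-valued curves\<close>

text \<open>Compare \<open>w\<close> with a Riemann sum over a fine tagged division. Its weights
  are the lengths of the subintervals, which add up to \<open>b - a\<close>.\<close>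
lemma has_L2_integral_on_estimate:
  assumes w: "has_L2_integral_on v w a b" and ab: "a \<le> b"
    and v: "\<And>s. s \<in> {a..b} \<Longrightarrow> v s \<in> L2" and g: "g \<in> L2" and e: "\<And>s. s \<in> {a..b} \<Longrightarrow> nrm (\<lambda>x. v s x - g x) \<le> \<epsilon>"
  shows "nrm (\<lambda>x. w x - (b - a) *\<^sub>R g x) \<le> (b - a) * \<epsilon>"
proof (rule field_le_epsilon)
  fix d :: real assume d: "0 < d"
  have wL: "w \<in> L2" using w by (simp add: has_L2_integral_on_def)
  obtain \<gamma> where \<gamma>: "gauge \<gamma>" "\<And>D. D tagged_division_of {a..b} \<Longrightarrow> \<gamma> fine D \<Longrightarrow>
     Lx_norm 2 (\<lambda>x. (\<Sum>(s, K)\<in>D. measure lborel K *\<^sub>R v s x) - w x) < ennreal d"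
    using w d unfolding has_L2_integral_on_def by meson
  obtain D where D: "D tagged_division_of {a..b}" "\<gamma> fine D"
    using fine_division_exists[OF \<gamma>(1), of a b] by auto
  have fin: "finite D" and tag: "\<And>s K. (s, K) \<in> D \<Longrightarrow> s \<in> {a..b}" 
    using D(1) tagged_division_ofD(1,2,3)[OF D(1)] by blast+
  define S where "S x = (\<Sum>(s, K)\<in>D. measure lborel K *\<^sub>R v s x)" for x
  have SL: "S \<in> L2" unfolding S_def[abs_def] using v tag fin by (intro L2_sum) auto
  have "Lx_norm 2 (\<lambda>x. S x - w x) < ennreal d" unfolding S_def by (rule \<gamma>(2)[OF D])
  then have Sw: "nrm (\<lambda>x. S x - w x) < d" using Lx_norm_L2[OF L2_diff[OF SL wL]] d by (simp add: ennreal_less_iff)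
  have cont: "(\<Sum>(s, K)\<in>D. measure lborel K) = b - a"
    using additive_content_tagged_division[of D a b] D(1) ab by simp
  have "nrm (\<lambda>x. S x - (b - a) *\<^sub>R g x) = nrm (\<lambda>x. \<Sum>z\<in>D. measure lborel (snd z) *\<^sub>R (v (fst z) x - g x))"
  proof (rule arg_cong[where f=nrm], rule ext)
    fix x
    have "(b - a) *\<^sub>R g x = (\<Sum>z\<in>D. measure lborel (snd z) *\<^sub>R g x)"
      unfolding cont[symmetric] by (simp add: scaleR_sum_left split_beta)
    then show "S x - (b - a) *\<^sub>R g x = (\<Sum>z\<in>D. measure lborel (snd z) *\<^sub>R (v (fst z) x - g x))"
      unfolding S_def by (simp add: split_beta sum_subtractf scaleR_diff_right)
  qed
  also have "\<dots> \<le> (\<Sum>z\<in>D. nrm (\<lambda>x. measure lborel (snd z) *\<^sub>R (v (fst z) x - g x)))"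
    using fin tag v g by (intro nrm_sum) auto
  also have "\<dots> \<le> (\<Sum>z\<in>D. measure lborel (snd z) * \<epsilon>)"
  proof (rule sum_mono)
    fix z assume "z \<in> D"
    then have "fst z \<in> {a..b}" using tag[of "fst z" "snd z"] by simp
    then show "nrm (\<lambda>x. measure lborel (snd z) *\<^sub>R (v (fst z) x - g x)) \<le> measure lborel (snd z) * \<epsilon>"
      unfolding nrm_scaleR using e by (simp add: mult_left_mono)
  qed
  also have "\<dots> = (b - a) * \<epsilon>" unfolding cont[symmetric] by (simp add: sum_distrib_right split_beta)
  finally have "nrm (\<lambda>x. S x - (b - a) *\<^sub>R g x) \<le> (b - a) * \<epsilon>" .
  then show "nrm (\<lambda>x. w x - (b - a) *\<^sub>R g x) \<le> (b - a) * \<epsilon> + d"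
    using nrm_triangle3[OF wL SL L2_scaleR[OF g], of "b - a"] Sw nrm_minus_commute[of w S] by linarith
qed

lemma has_L2_integral_estimate:
  assumes w: "has_L2_integral v w a b"
    and v: "\<And>s. min a b \<le> s \<Longrightarrow> s \<le> max a b \<Longrightarrow> v s \<in> L2" and g: "g \<in> L2" 
    and e: "\<And>s. min a b \<le> s \<Longrightarrow> s \<le> max a b \<Longrightarrow> nrm (\<lambda>x. v s x - g x) \<le> \<epsilon>"
  shows "w \<in> L2" "nrm (\<lambda>x. w x - (b - a) *\<^sub>R g x) \<le> \<bar>b - a\<bar> * \<epsilon>"
proof -
  have "w \<in> L2 \<and> nrm (\<lambda>x. w x - (b - a) *\<^sub>R g x) \<le> \<bar>b - a\<bar> * \<epsilon>"
  proof (cases "a \<le> b")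
    case True
    then have w': "has_L2_integral_on v w a b" using w by (simp add: has_L2_integral_def)
    then have "w \<in> L2" by (simp add: has_L2_integral_on_def)
    moreover have "nrm (\<lambda>x. w x - (b - a) *\<^sub>R g x) \<le> (b - a) * \<epsilon>"
      by (rule has_L2_integral_on_estimate[OF w' True _ g]) (use True v e in auto)
    ultimately show ?thesis using True by simp
  next
    case False
    then have w': "has_L2_integral_on v (\<lambda>x. - w x) b a" using w by (simp add: has_L2_integral_def)
    then have "(\<lambda>x. - w x) \<in> L2" by (simp add: has_L2_integral_on_def)
    from L2_uminus[OF this] have wL: "w \<in> L2" by simp
    have "nrm (\<lambda>x. - w x - (a - b) *\<^sub>R g x) \<le> (a - b) * \<epsilon>"
      by (rule has_L2_integral_on_estimate[OF w' _ _ g]) (use False v e in auto)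
    moreover have "(\<lambda>x. - w x - (a - b) *\<^sub>R g x) = (\<lambda>x. - (w x - (b - a) *\<^sub>R g x))" by (auto simp: algebra_simps)
    ultimately show ?thesis using False wL by (simp add: nrm_minus_commute[of w])
  qed
  then show "w \<in> L2" "nrm (\<lambda>x. w x - (b - a) *\<^sub>R g x) \<le> \<bar>b - a\<bar> * \<epsilon>" by blast+
qed

section \<open>Solutions in H1 as curves in time\<close>

lemma H1_diff:
  assumes "H1 f" "H1 g"
  shows "H1 (\<lambda>x. f x - g x)" "H1_nrm f \<le> H1_nrm g + H1_nrm (\<lambda>x. f x - g x)" "nrm (\<lambda>\<xi>. fourier f \<xi> - fourier g \<xi>) = nrm (\<lambda>x. f x - g x)"
proof -
  have L: "f \<in> L2" "g \<in> L2" using assms by (auto simp: H1_def)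
  have hf: "has_fourier (\<lambda>x. f x - g x) (\<lambda>\<xi>. fourier f \<xi> - fourier g \<xi>)"
    by (intro has_fourier_diff has_fourier_fourier L)
  show "nrm (\<lambda>\<xi>. fourier f \<xi> - fourier g \<xi>) = nrm (\<lambda>x. f x - g x)" by (rule has_fourier_nrm[OF hf])
  have dL: "(\<lambda>x. f x - g x) \<in> L2" using L by auto
  have ae: "AE \<xi> in lborel. fourier (\<lambda>x. f x - g x) \<xi> = fourier f \<xi> - fourier g \<xi>"
    by (rule has_fourier_unique[OF has_fourier_fourier[OF dL] hf])
  let ?w = "\<lambda>\<xi>. complex_of_real (bracket \<xi>)"
  have wL: "(\<lambda>\<xi>. ?w \<xi> * fourier f \<xi>) \<in> L2" "(\<lambda>\<xi>. ?w \<xi> * fourier g \<xi>) \<in> L2" using assms by (auto simp: H1_def)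
  have ae2: "AE \<xi> in lborel. ?w \<xi> * fourier (\<lambda>x. f x - g x) \<xi> = ?w \<xi> * fourier f \<xi> - ?w \<xi> * fourier g \<xi>"
    using ae by (rule eventually_mono) (simp add: right_diff_distrib)
  have dwL: "(\<lambda>\<xi>. ?w \<xi> * fourier f \<xi> - ?w \<xi> * fourier g \<xi>) \<in> L2" by (rule L2_diff[OF wL])
  show "H1 (\<lambda>x. f x - g x)" unfolding H1_def using dL L2_cong_AE[OF ae2 _ dwL] by auto
  have "nrm (\<lambda>\<xi>. ?w \<xi> * fourier (\<lambda>x. f x - g x) \<xi>) = nrm (\<lambda>\<xi>. ?w \<xi> * fourier f \<xi> - ?w \<xi> * fourier g \<xi>)"
    by (rule nrm_cong_AE[OF ae2]) measurable
  then show "H1_nrm f \<le> H1_nrm g + H1_nrm (\<lambda>x. f x - g x)"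
    using nrm_diff_abs[OF wL] unfolding H1_nrm_def by linarith
qed

lemma C_H1_imp:
  assumes "C_H1 I u"
  shows "t \<in> I \<Longrightarrow> H1 (u t)" "t \<in> I \<Longrightarrow> ((\<lambda>s. H1_nrm (\<lambda>x. u s x - u t x)) \<longlongrightarrow> 0) (at t within I)"
proof -
  show H: "H1 (u t)" if "t \<in> I" for t using assms that H_norm_H1(1) unfolding C_H1_def by blast
  assume t: "t \<in> I"
  have "((\<lambda>s. H_norm 1 (\<lambda>x. u s x - u t x)) \<longlongrightarrow> 0) (at t within I)" using assms t unfolding C_H1_def by blast
  moreover have "\<forall>\<^sub>F s in at t within I. H_norm 1 (\<lambda>x. u s x - u t x) = ennreal (H1_nrm (\<lambda>x. u s x - u t x))"
    unfolding eventually_at_filter by (rule always_eventually) (use H_norm_H1(2) H1_diff(1) H t in blast)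
  ultimately have "((\<lambda>s. ennreal (H1_nrm (\<lambda>x. u s x - u t x))) \<longlongrightarrow> ennreal 0) (at t within I)"
    by (simp add: Lim_transform_eventually)
  then show "((\<lambda>s. H1_nrm (\<lambda>x. u s x - u t x)) \<longlongrightarrow> 0) (at t within I)"
    by (rule tendsto_ennrealD) (auto simp: H1_nrm_def)
qed

lemma C_H1_continuous:
  assumes "C_H1 I u" shows "continuous_on I (\<lambda>t. H1_nrm (u t))"
  unfolding continuous_on_def
proof
  fix t assume t: "t \<in> I"
  note H = C_H1_imp[OF assms]
  have "((\<lambda>s. H1_nrm (u s) - H1_nrm (u t)) \<longlongrightarrow> 0) (at t within I)"
  proof (rule Lim_null_comparison[OF _ H(2)[OF t]])
    show "\<forall>\<^sub>F s in at t within I. norm (H1_nrm (u s) - H1_nrm (u t)) \<le> H1_nrm (\<lambda>x. u s x - u t x)"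
      unfolding eventually_at_filter
    proof (rule always_eventually, intro allI impI)
      fix s assume "s \<noteq> t" "s \<in> I"
      have L: "H1 (u s)" "H1 (u t)" using H t \<open>s \<in> I\<close> by auto
      have sym: "H1_nrm (\<lambda>x. u t x - u s x) = H1_nrm (\<lambda>x. u s x - u t x)"
      proof -
        have d: "(\<lambda>x. u s x - u t x) \<in> L2" "(\<lambda>x. u t x - u s x) \<in> L2" using L by (auto simp: H1_def)
        have "has_fourier (\<lambda>x. u t x - u s x) (\<lambda>\<xi>. (-1) * fourier (\<lambda>x. u s x - u t x) \<xi>)"
          using has_fourier_cmult[OF has_fourier_fourier[OF d(1)], of "-1"] by simp
        from has_fourier_unique[OF has_fourier_fourier[OF d(2)] this]
        have "AE \<xi> in lborel. complex_of_real (bracket \<xi>) * fourier (\<lambda>x. u t x - u s x) \<xi> = - (complex_of_real (bracket \<xi>) * fourier (\<lambda>x. u s x - u t x) \<xi>)"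
          by (rule eventually_mono) simp
        from nrm_cong_AE[OF this] show ?thesis unfolding H1_nrm_def by simp
      qed
      show "norm (H1_nrm (u s) - H1_nrm (u t)) \<le> H1_nrm (\<lambda>x. u s x - u t x)"
        using H1_diff(2)[OF L] H1_diff(2)[OF L(2,1)] sym by simp
    qed
  qed
  then show "((\<lambda>s. H1_nrm (u s)) \<longlongrightarrow> H1_nrm (u t)) (at t within I)" by (simp add: LIM_zero_iff)
qed

lemma schroedinger_L2: "f \<in> L2 \<Longrightarrow> schroedinger t f \<in> L2"
  using has_fourier_L2(1)[OF schroedinger_has_fourier[OF has_fourier_fourier]] .

lemma schroedinger_isometry:
  assumes "f \<in> L2" "g \<in> L2"
  shows "nrm (\<lambda>x. schroedinger t f x - schroedinger t g x) = nrm (\<lambda>x. f x - g x)"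
proof -
  have "nrm (\<lambda>x. schroedinger t f x - schroedinger t g x) = nrm (\<lambda>\<xi>. cis (- (t * \<xi>\<^sup>2)) * fourier f \<xi> - cis (- (t * \<xi>\<^sup>2)) * fourier g \<xi>)"
    by (intro has_fourier_nrm[symmetric] has_fourier_diff schroedinger_has_fourier has_fourier_fourier assms)
  also have "\<dots> = nrm (\<lambda>\<xi>. fourier f \<xi> - fourier g \<xi>)"
    unfolding right_diff_distrib[symmetric] by (simp add: nrm_def norm_mult)
  also have "\<dots> = nrm (\<lambda>x. f x - g x)"
    by (intro has_fourier_nrm has_fourier_diff has_fourier_fourier assms)
  finally show ?thesis .
qed

lemma isCont_cis: "isCont cis a"
proof -
  have "continuous_on UNIV cis" by (intro continuous_intros)
  then show ?thesis by (simp add: continuous_on_eq_continuous_at)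
qed

text \<open>Dominated convergence on the Fourier side.\<close>
lemma schroedinger_continuous_0:
  assumes f: "f \<in> L2" and e: "0 < e"
  shows "\<exists>\<delta>>0. \<forall>\<tau>. \<bar>\<tau>\<bar> < \<delta> \<longrightarrow> nrm (\<lambda>x. schroedinger \<tau> f x - f x) < e"
proof -
  let ?F = "fourier f"
  have eq: "nrm (\<lambda>x. schroedinger \<tau> f x - f x) = nrm (\<lambda>\<xi>. cis (- (\<tau> * \<xi>\<^sup>2)) * ?F \<xi> - ?F \<xi>)" for \<tau>
    by (intro has_fourier_nrm[symmetric] has_fourier_diff schroedinger_has_fourier has_fourier_fourier f)
  have "((\<lambda>\<tau>. nrm (\<lambda>\<xi>. cis (- (\<tau> * \<xi>\<^sup>2)) * ?F \<xi> - ?F \<xi>)) \<longlongrightarrow> 0) (at 0)"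
    unfolding tendsto_at_iff_sequentially o_def
  proof (intro allI impI)
    fix X :: "nat \<Rightarrow> real" assume X: "X \<longlonglongrightarrow> 0"
    show "(\<lambda>n. nrm (\<lambda>\<xi>. cis (- (X n * \<xi>\<^sup>2)) * ?F \<xi> - ?F \<xi>)) \<longlonglongrightarrow> 0"
    proof (rule nrm_dominated_convergence[where g="\<lambda>\<xi>. 2 * ?F \<xi>"])
      show "AE \<xi> in lborel. (\<lambda>n. cis (- (X n * \<xi>\<^sup>2)) * ?F \<xi> - ?F \<xi>) \<longlonglongrightarrow> 0"
      proof (rule AE_I2)
        fix \<xi> :: real
        have "(\<lambda>n. cis (- (X n * \<xi>\<^sup>2))) \<longlonglongrightarrow> cis (- (0 * \<xi>\<^sup>2))"
          by (intro isCont_tendsto_compose[OF isCont_cis] tendsto_intros X)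
        then have "(\<lambda>n. cis (- (X n * \<xi>\<^sup>2)) * ?F \<xi> - ?F \<xi>) \<longlonglongrightarrow> cis (- (0 * \<xi>\<^sup>2)) * ?F \<xi> - ?F \<xi>"
          by (intro tendsto_intros X)
        then show "(\<lambda>n. cis (- (X n * \<xi>\<^sup>2)) * ?F \<xi> - ?F \<xi>) \<longlonglongrightarrow> 0" by simp
      qed
      show "AE \<xi> in lborel. cmod (cis (- (X n * \<xi>\<^sup>2)) * ?F \<xi> - ?F \<xi>) \<le> cmod (2 * ?F \<xi>)" for n
      proof (rule AE_I2)
        fix \<xi>
        show "cmod (cis (- (X n * \<xi>\<^sup>2)) * ?F \<xi> - ?F \<xi>) \<le> cmod (2 * ?F \<xi>)"
          using norm_triangle_ineq4[of "cis (- (X n * \<xi>\<^sup>2)) * ?F \<xi>" "?F \<xi>"] by (simp add: norm_mult)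
      qed
    qed (auto intro: L2_cmult)
  qed
  then have "\<forall>\<^sub>F \<tau> in at 0. nrm (\<lambda>x. schroedinger \<tau> f x - f x) < e"
    unfolding eq using e by (rule order_tendstoD(2))
  then obtain \<delta> where d: "\<delta> > 0" "\<And>\<tau>. \<tau> \<noteq> 0 \<Longrightarrow> \<bar>\<tau>\<bar> < \<delta> \<Longrightarrow> nrm (\<lambda>x. schroedinger \<tau> f x - f x) < e"
    unfolding eventually_at by (auto simp: dist_real_def)
  have "nrm (\<lambda>x. schroedinger 0 f x - f x) < e" unfolding eq using e by (simp add: cis_zero)
  then have "nrm (\<lambda>x. schroedinger \<tau> f x - f x) < e" if "\<bar>\<tau>\<bar> < \<delta>" for \<tau>
    using d(2)[of \<tau>] that by (cases "\<tau> = 0") auto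
  then show ?thesis using d(1) by blast
qed

lemma C_H1_L2_continuous:
  assumes u: "C_H1 I u" and t: "t \<in> I"
  shows "((\<lambda>s. nrm (\<lambda>x. u s x - u t x)) \<longlongrightarrow> 0) (at t within I)"
proof (rule Lim_null_comparison[OF _ C_H1_imp(2)[OF u t]])
  show "\<forall>\<^sub>F s in at t within I. norm (nrm (\<lambda>x. u s x - u t x)) \<le> H1_nrm (\<lambda>x. u s x - u t x)"
    unfolding eventually_at_filter
  proof (rule always_eventually, intro allI impI)
    fix s assume "s \<in> I"
    then have "H1 (\<lambda>x. u s x - u t x)" using H1_diff(1)[of "u s" "u t"] C_H1_imp(1)[OF u] t by blast
    from H1_bounds(3)[OF this] show "norm (nrm (\<lambda>x. u s x - u t x)) \<le> H1_nrm (\<lambda>x. u s x - u t x)" by simp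
  qed
qed

lemma nonlinearity_continuous:
  assumes p: "1 < p" and u: "C_H1 I u" and t: "t \<in> I"
  shows "((\<lambda>s. nrm (\<lambda>x. nonlinearity p (u s) x - nonlinearity p (u t) x)) \<longlongrightarrow> 0) (at t within I)"
proof -
  \<comment> \<open>a bound on \<open>u s\<close> for all \<open>s\<close> near
    \<open>t\<close>\<close>
  let ?K = "sobolev_const * (H1_nrm (u t) + 1)"
  have "((\<lambda>s. p * ?K powr (p - 1) * nrm (\<lambda>x. u s x - u t x)) \<longlongrightarrow> p * ?K powr (p - 1) * 0) (at t within I)"
    by (intro tendsto_intros C_H1_L2_continuous[OF u t])
  then have l: "((\<lambda>s. p * ?K powr (p - 1) * nrm (\<lambda>x. u s x - u t x)) \<longlongrightarrow> 0) (at t within I)" by simp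
  have "\<forall>\<^sub>F s in at t within I. H1_nrm (u s) < H1_nrm (u t) + 1"
    using C_H1_continuous[OF u] t unfolding continuous_on_def by (intro order_tendstoD(2)) auto
  moreover have "\<forall>\<^sub>F s in at t within I. s \<in> I" by (simp add: eventually_at_filter)
  ultimately have "\<forall>\<^sub>F s in at t within I. norm (nrm (\<lambda>x. nonlinearity p (u s) x - nonlinearity p (u t) x)) \<le> p * ?K powr (p - 1) * nrm (\<lambda>x. u s x - u t x)"
  proof eventually_elim
    case (elim s)
    have H: "H1 (u s)" "H1 (u t)" using C_H1_imp(1)[OF u] t elim by auto
    have b: "AE x in lborel. cmod (u s x) \<le> ?K"
      using H1_bound[OF H(1)]
    proof (rule eventually_mono)
      fix x assume "cmod (u s x) \<le> sobolev_const * H1_nrm (u s)"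
      also have "\<dots> \<le> ?K" using elim sobolev_const_nonneg by (intro mult_left_mono) auto
      finally show "cmod (u s x) \<le> ?K" .
    qed
    have b2: "AE x in lborel. cmod (u t x) \<le> ?K"
      using H1_bound[OF H(2)]
    proof (rule eventually_mono)
      fix x assume "cmod (u t x) \<le> sobolev_const * H1_nrm (u t)"
      also have "\<dots> \<le> ?K" using sobolev_const_nonneg by (intro mult_left_mono) auto
      finally show "cmod (u t x) \<le> ?K" .
    qed
    show ?case using nonlinearity_Lipschitz[OF p H1_L2[OF H(1)] H1_L2[OF H(2)] b b2] by simp
  qed
  then show ?thesis by (rule Lim_null_comparison[OF _ l])
qed

text \<open>Replacing the integrand of Duhamel's formula by its value at \<open>t\<close> costs at
  most \<open>|s - t| \<epsilon>\<close>; on the Fourier side the free evolution is multiplication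
  by a phase.\<close>
lemma Duhamel_fourier:
  assumes p: "1 < p" and sol: "H1_solution p I u" and I: "is_interval I" and t: "t \<in> I" and s: "s \<in> I"
    and e: "\<And>r. r \<in> I \<Longrightarrow> \<bar>r - t\<bar> \<le> \<bar>s - t\<bar> \<Longrightarrow> \<bar>s - r\<bar> \<le> \<bar>s - t\<bar> \<Longrightarrow> 
       nrm (\<lambda>x. schroedinger (s - r) (nonlinearity p (u r)) x - nonlinearity p (u t) x) \<le> \<epsilon>"
  shows "nrm (\<lambda>\<xi>. fourier (u s) \<xi> - cis (- ((s - t) * \<xi>\<^sup>2)) * fourier (u t) \<xi> + (s - t) *\<^sub>R (\<i> * fourier (nonlinearity p (u t)) \<xi>)) \<le> \<bar>s - t\<bar> * \<epsilon>"
proof -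
  have u: "C_H1 I u" using sol by (simp add: H1_solution_def)
  have H: "H1 (u r)" "u r \<in> L2" "nonlinearity p (u r) \<in> L2" if "r \<in> I" for r
    using C_H1_imp(1)[OF u that] H1_L2 nonlinearity_H1(1)[OF p] by auto
  from sol have "\<forall>t0\<in>I. \<forall>t\<in>I. \<exists>w. has_L2_integral (\<lambda>s. schroedinger (t - s) (nonlinearity p (u s))) w t0 t \<and>
     (AE x in lborel. u t x = schroedinger (t - t0) (u t0) x - \<i> * w x)"
    unfolding H1_solution_def by (rule conjunct2)
  from bspec[OF bspec[OF this t] s] obtain w where w: "has_L2_integral (\<lambda>r. schroedinger (s - r) (nonlinearity p (u r))) w t s"
    "AE x in lborel. u s x = schroedinger (s - t) (u t) x - \<i> * w x"
    by (elim exE conjE)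
  let ?Nt = "nonlinearity p (u t)"
  have mem: "r \<in> I" "\<bar>r - t\<bar> \<le> \<bar>s - t\<bar>" "\<bar>s - r\<bar> \<le> \<bar>s - t\<bar>" if "min t s \<le> r" "r \<le> max t s" for r
  proof -
    show "r \<in> I"
    proof (cases "t \<le> s")
      case True then show ?thesis using mem_is_interval_1_I[OF I t s] that by simp
    next
      case False then show ?thesis using mem_is_interval_1_I[OF I s t] that by simp
    qed
    show "\<bar>r - t\<bar> \<le> \<bar>s - t\<bar>" "\<bar>s - r\<bar> \<le> \<bar>s - t\<bar>" using that by (cases "t \<le> s"; simp; linarith)+
  qed
  have vL: "schroedinger (s - r) (nonlinearity p (u r)) \<in> L2" if "min t s \<le> r" "r \<le> max t s" for r
    by (rule schroedinger_L2[OF H(3)[OF mem(1)[OF that]]])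
  have ve: "nrm (\<lambda>x. schroedinger (s - r) (nonlinearity p (u r)) x - ?Nt x) \<le> \<epsilon>" if "min t s \<le> r" "r \<le> max t s" for r
    by (rule e[OF mem[OF that]])
  note w_est = has_L2_integral_estimate[OF w(1) vL H(3)[OF t] ve]
  have hs: "has_fourier (\<lambda>x. schroedinger (s - t) (u t) x - \<i> * w x) (\<lambda>\<xi>. cis (- ((s - t) * \<xi>\<^sup>2)) * fourier (u t) \<xi> - \<i> * fourier w \<xi>)"
    by (intro has_fourier_diff has_fourier_cmult schroedinger_has_fourier has_fourier_fourier H t w_est)
  have "has_fourier (u s) (\<lambda>\<xi>. cis (- ((s - t) * \<xi>\<^sup>2)) * fourier (u t) \<xi> - \<i> * fourier w \<xi>)"
    by (rule has_fourier_cong_AE[OF hs]) (use w(2) H s in \<open>auto simp: eq_commute intro: L2_measurable\<close>)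
  from has_fourier_unique[OF has_fourier_fourier[OF H(2)[OF s]] this]
  have ae: "AE \<xi> in lborel. fourier (u s) \<xi> = cis (- ((s - t) * \<xi>\<^sup>2)) * fourier (u t) \<xi> - \<i> * fourier w \<xi>" .
  have "nrm (\<lambda>\<xi>. fourier (u s) \<xi> - cis (- ((s - t) * \<xi>\<^sup>2)) * fourier (u t) \<xi> + (s - t) *\<^sub>R (\<i> * fourier ?Nt \<xi>)) =
    nrm (\<lambda>\<xi>. - \<i> * (fourier w \<xi> - complex_of_real (s - t) * fourier ?Nt \<xi>))"
  proof (rule nrm_cong_AE)
    show "AE \<xi> in lborel. fourier (u s) \<xi> - cis (- ((s - t) * \<xi>\<^sup>2)) * fourier (u t) \<xi> + (s - t) *\<^sub>R (\<i> * fourier ?Nt \<xi>) = - \<i> * (fourier w \<xi> - complex_of_real (s - t) * fourier ?Nt \<xi>)"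
      using ae by (rule eventually_mono) (simp add: scaleR_conv_of_real algebra_simps)
  qed measurable
  also have "\<dots> = nrm (\<lambda>\<xi>. fourier w \<xi> - complex_of_real (s - t) * fourier ?Nt \<xi>)"
    unfolding nrm_cmult by simp
  also have "\<dots> = nrm (\<lambda>x. w x - complex_of_real (s - t) * ?Nt x)"
    by (intro has_fourier_nrm has_fourier_diff has_fourier_cmult has_fourier_fourier w_est H t)
  also have "\<dots> = nrm (\<lambda>x. w x - (s - t) *\<^sub>R ?Nt x)" by (simp add: scaleR_conv_of_real)
  also have "\<dots> \<le> \<bar>s - t\<bar> * \<epsilon>" by (rule w_est)
  finally show ?thesis .
qed

text \<open>The integrand of Duhamel's formula is close to the nonlinearity at time
  \<open>t\<close> because the nonlinearity is continuous along \<open>u\<close> and the free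
  evolution is strongly continuous.\<close>
lemma Duhamel_derivative:
  assumes p: "1 < p" and sol: "H1_solution p I u" and I: "is_interval I" and t: "t \<in> I" and \<epsilon>: "0 < \<epsilon>"
  shows "\<forall>\<^sub>F s in at t within I. nrm (\<lambda>\<xi>. fourier (u s) \<xi> - cis (- ((s - t) * \<xi>\<^sup>2)) * fourier (u t) \<xi> + (s - t) *\<^sub>R (\<i> * fourier (nonlinearity p (u t)) \<xi>)) \<le> \<bar>s - t\<bar> * \<epsilon>"
proof -
  have u: "C_H1 I u" using sol by (simp add: H1_solution_def)
  have H: "H1 (u r)" "u r \<in> L2" "nonlinearity p (u r) \<in> L2" if "r \<in> I" for r
    using C_H1_imp(1)[OF u that] H1_L2 nonlinearity_H1(1)[OF p] by auto
  let ?Nt = "nonlinearity p (u t)"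
  obtain d1 where d1: "d1 > 0" "\<And>\<tau>. \<bar>\<tau>\<bar> < d1 \<Longrightarrow> nrm (\<lambda>x. schroedinger \<tau> ?Nt x - ?Nt x) < \<epsilon> / 2"
    using schroedinger_continuous_0[OF H(3)[OF t], of "\<epsilon>/2"] \<epsilon> by auto
  have "\<forall>\<^sub>F s in at t within I. nrm (\<lambda>x. nonlinearity p (u s) x - ?Nt x) < \<epsilon> / 2"
    using nonlinearity_continuous[OF p u t] \<epsilon> by (intro order_tendstoD(2)) auto
  then obtain d2 where d2: "d2 > 0" "\<And>s. s \<in> I \<Longrightarrow> s \<noteq> t \<Longrightarrow> \<bar>s - t\<bar> < d2 \<Longrightarrow> nrm (\<lambda>x. nonlinearity p (u s) x - ?Nt x) < \<epsilon> / 2"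
    unfolding eventually_at by (auto simp: dist_real_def)
  have main: "nrm (\<lambda>\<xi>. fourier (u s) \<xi> - cis (- ((s - t) * \<xi>\<^sup>2)) * fourier (u t) \<xi> + (s - t) *\<^sub>R (\<i> * fourier ?Nt \<xi>)) \<le> \<bar>s - t\<bar> * \<epsilon>"
    if s: "s \<in> I" "\<bar>s - t\<bar> < min d1 d2" for s
  proof (rule Duhamel_fourier[OF p sol I t s(1)])
    fix r assume r: "r \<in> I" "\<bar>r - t\<bar> \<le> \<bar>s - t\<bar>" "\<bar>s - r\<bar> \<le> \<bar>s - t\<bar>"
    have "nrm (\<lambda>x. nonlinearity p (u r) x - ?Nt x) \<le> \<epsilon> / 2"
      using d2(2)[OF r(1)] r s \<epsilon> by (cases "r = t") (auto simp: less_imp_le)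
    moreover have "nrm (\<lambda>x. schroedinger (s - r) ?Nt x - ?Nt x) < \<epsilon> / 2" using r s by (intro d1) auto
    moreover have "nrm (\<lambda>x. schroedinger (s - r) (nonlinearity p (u r)) x - schroedinger (s - r) ?Nt x) = nrm (\<lambda>x. nonlinearity p (u r) x - ?Nt x)"
      by (rule schroedinger_isometry[OF H(3)[OF r(1)] H(3)[OF t]])
    ultimately show "nrm (\<lambda>x. schroedinger (s - r) (nonlinearity p (u r)) x - ?Nt x) \<le> \<epsilon>"
      using nrm_triangle3[OF schroedinger_L2[OF H(3)[OF r(1)], of "s - r"] schroedinger_L2[OF H(3)[OF t], of "s - r"] H(3)[OF t]] by linarith
  qed
  show ?thesis unfolding eventually_at
    by (rule exI[of _ "min d1 d2"]) (use d1(1) d2(1) main in \<open>auto simp: dist_real_def\<close>)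
qed

lemma schroedinger_quotient_algebra:
  fixes c d A F G E x :: complex
  assumes "c * d = 1"
  shows "c * (A - F) - (\<i> * (\<i> * x * (\<i> * x * F)) - \<i> * G) = c * (A - E * F + d * (\<i> * G)) + (c * (E - 1) + \<i> * x\<^sup>2) * F"
proof -
  have 1: "c * (d * (\<i> * G)) = \<i> * G" using assms by (simp flip: mult.assoc)
  have 2: "\<i> * (\<i> * x * (\<i> * x * F)) = - (\<i> * x\<^sup>2 * F)"
  proof -
    have ii: "\<i> * \<i> = -1" by simp
    have "\<i> * (\<i> * x * (\<i> * x * F)) = (\<i> * \<i>) * (\<i> * x\<^sup>2 * F)" by (simp only: power2_eq_square mult_ac)
    then show ?thesis unfolding ii by simp
  qed
  show ?thesis unfolding 2 distrib_left[of c "A - E * F"] 1 by (simp add: algebra_simps)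
qed

text \<open>On the Fourier side the error consists of the Duhamel error and of the second-order
  Taylor remainder of the phase \<open>cis (- (s - t) \<xi>\<^sup>2)\<close>. On the band the
  remainder, divided by \<open>s - t\<close>, is at most \<open>|s - t| N^4 / 2\<close>. Without
  the cutoff the difference quotient would converge only in a space of negative order.\<close>
lemma lowpass_time_derivative:
  assumes p: "1 < p" and sol: "H1_solution p I u" and I: "is_interval I" and t: "t \<in> I" and N: "0 \<le> N"
  shows "((\<lambda>s. nrm (\<lambda>x. (1 / (s - t)) *\<^sub>R (lowpass N (u s) x - lowpass N (u t) x)
    - (\<i> * lowpass_dxx N (u t) x - \<i> * lowpass N (nonlinearity p (u t)) x))) \<longlongrightarrow> 0) (at t within I)"
proof (rule tendstoI)
  fix e :: real assume e: "0 < e"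
  let ?Nt = "nonlinearity p (u t)" and ?Ft = "fourier (u t)"
  define R where "R s \<xi> = fourier (u s) \<xi> - cis (- ((s - t) * \<xi>\<^sup>2)) * ?Ft \<xi> + (s - t) *\<^sub>R (\<i> * fourier ?Nt \<xi>)" for s \<xi>
  \<comment> \<open>\<open>|s - t| C\<close> bounds the norm of the phase remainder, divided
    by \<open>s - t\<close>\<close>
  define C where "C = N^4 / 2 * nrm ?Ft"
  have C0: "0 \<le> C" using N by (simp add: C_def)
  have "\<forall>\<^sub>F s in at t within I. \<bar>s - t\<bar> < e / (2 * (C + 1))"
    unfolding eventually_at by (rule exI[of _ "e / (2 * (C + 1))"]) (use e C0 in \<open>auto simp: dist_real_def\<close>)
  moreover have "\<forall>\<^sub>F s in at t within I. nrm (R s) \<le> \<bar>s - t\<bar> * (e / 2)"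
    using Duhamel_derivative[OF p sol I t, of "e/2"] e unfolding R_def by simp
  moreover have "\<forall>\<^sub>F s in at t within I. s \<noteq> t" by (simp add: eventually_at_filter)
  ultimately show "\<forall>\<^sub>F s in at t within I. dist (nrm (\<lambda>x. (1 / (s - t)) *\<^sub>R (lowpass N (u s) x - lowpass N (u t) x)
    - (\<i> * lowpass_dxx N (u t) x - \<i> * lowpass N ?Nt x))) 0 < e"
  proof eventually_elim
    case (elim s)
    let ?c = "complex_of_real (1 / (s - t))"
    have RL: "R s \<in> L2"
    proof -
      have "(\<lambda>\<xi>. cis (- ((s - t) * \<xi>\<^sup>2)) * ?Ft \<xi>) \<in> L2"
        by (rule L2_bound[OF fourier_L2[of "u t"], where C=1]) (auto simp: norm_mult)
      then show ?thesis unfolding R_def[abs_def] by auto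
    qed
    \<comment> \<open>the phase remainder; the error is \<open>trunc N (R s) / (s - t) +
      B\<close>\<close>
    define B where "B \<xi> = (?c * (cis (- ((s - t) * \<xi>\<^sup>2)) - 1) + \<i> * complex_of_real (\<xi>\<^sup>2)) * trunc N ?Ft \<xi>" for \<xi>
    have Bb: "AE \<xi> in lborel. cmod (B \<xi>) \<le> (\<bar>s - t\<bar> * (N^4 / 2)) * cmod (?Ft \<xi>)"
    proof (rule AE_I2)
      fix \<xi>
      show "cmod (B \<xi>) \<le> (\<bar>s - t\<bar> * (N^4 / 2)) * cmod (?Ft \<xi>)"
      proof (cases "\<bar>\<xi>\<bar> \<le> N")
        case True
        let ?a = "- ((s - t) * \<xi>\<^sup>2)"
        have "?c * (cis ?a - 1) + \<i> * complex_of_real (\<xi>\<^sup>2) = ?c * (cis ?a - 1 - \<i> * complex_of_real ?a)"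
          using elim(3) by (simp add: field_simps)
        then have "cmod (?c * (cis ?a - 1) + \<i> * complex_of_real (\<xi>\<^sup>2)) = (1 / \<bar>s - t\<bar>) * cmod (cis ?a - 1 - \<i> * complex_of_real ?a)"
          by (simp only: norm_mult norm_of_real abs_divide abs_one)
        also have "\<dots> \<le> (1 / \<bar>s - t\<bar>) * (?a\<^sup>2 / 2)" by (intro mult_left_mono cis_Taylor2) simp
        also have "?a\<^sup>2 = \<bar>s - t\<bar> * \<bar>s - t\<bar> * \<bar>\<xi>\<bar>^4"
          by (simp add: power2_eq_square power4_eq_xxxx mult_ac abs_mult_self_eq)
        also have "(1 / \<bar>s - t\<bar>) * (\<bar>s - t\<bar> * \<bar>s - t\<bar> * \<bar>\<xi>\<bar>^4 / 2) = \<bar>s - t\<bar> * (\<bar>\<xi>\<bar>^4 / 2)"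
        proof -
          have gen: "(1 / d) * (d * d * y / 2) = d * (y / 2)" if "d \<noteq> 0" for d y :: real using that by simp
          show ?thesis by (rule gen) (use elim(3) in simp)
        qed
        also have "\<dots> \<le> \<bar>s - t\<bar> * (N^4 / 2)" using True by (intro mult_left_mono divide_right_mono power_mono) auto
        finally show ?thesis unfolding B_def norm_mult using trunc_le by (intro mult_mono) auto
      next
        case False
        then have "trunc N ?Ft \<xi> = 0" by (auto simp: trunc_def indicator_def)
        then show ?thesis using N by (simp add: B_def)
      qed
    qed
    have BM: "B \<in> borel_measurable borel" unfolding B_def[abs_def] trunc_def by measurable
    have BL: "B \<in> L2" by (rule L2_bound[OF fourier_L2 BM Bb])
    have Bn: "nrm B \<le> \<bar>s - t\<bar> * C"
      using nrm_bound[OF fourier_L2 BM Bb] N by (simp add: C_def mult.assoc)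
    have hf: "has_fourier (\<lambda>x. ?c * (lowpass N (u s) x - lowpass N (u t) x)
    - (\<i> * lowpass_dxx N (u t) x - \<i> * lowpass N ?Nt x)) (\<lambda>\<xi>. ?c * (trunc N (fourier (u s)) \<xi> - trunc N ?Ft \<xi>) - 
       (\<i> * (\<i> * complex_of_real \<xi> * (\<i> * complex_of_real \<xi> * trunc N ?Ft \<xi>)) - \<i> * trunc N (fourier ?Nt) \<xi>))"
      by (intro has_fourier_diff has_fourier_cmult lowpass_has_fourier)
    have Zeq: "?c * (trunc N (fourier (u s)) \<xi> - trunc N ?Ft \<xi>) - 
       (\<i> * (\<i> * complex_of_real \<xi> * (\<i> * complex_of_real \<xi> * trunc N ?Ft \<xi>)) - \<i> * trunc N (fourier ?Nt) \<xi>) = ?c * trunc N (R s) \<xi> + B \<xi>" for \<xi>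
    proof (cases "\<xi> \<in> {-N..N}")
      case True
      have "?c * complex_of_real (s - t) = 1" using elim(3) by (simp flip: of_real_mult)
      from schroedinger_quotient_algebra[OF this] True show ?thesis
        unfolding B_def R_def trunc_def scaleR_conv_of_real of_real_power by simp
    qed (simp add: B_def trunc_def)
    have tRL: "trunc N (R s) \<in> L2" by (rule trunc_L2[OF RL])
    have "nrm (\<lambda>x. (1 / (s - t)) *\<^sub>R (lowpass N (u s) x - lowpass N (u t) x)
    - (\<i> * lowpass_dxx N (u t) x - \<i> * lowpass N ?Nt x)) = nrm (\<lambda>\<xi>. ?c * trunc N (R s) \<xi> + B \<xi>)"
      using has_fourier_nrm[OF hf] unfolding Zeq scaleR_conv_of_real by simp
    also have "\<dots> \<le> nrm (\<lambda>\<xi>. ?c * trunc N (R s) \<xi>) + nrm B"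
      by (rule nrm_triangle[OF L2_cmult[OF tRL] BL])
    also have "nrm (\<lambda>\<xi>. ?c * trunc N (R s) \<xi>) = (1 / \<bar>s - t\<bar>) * nrm (trunc N (R s))"
      unfolding nrm_cmult norm_of_real by simp
    also have "(1 / \<bar>s - t\<bar>) * nrm (trunc N (R s)) \<le> e / 2"
    proof -
      have "nrm (trunc N (R s)) \<le> nrm (R s)" by (rule nrm_mono[OF RL L2_measurable[OF tRL]]) (simp add: trunc_le)
      then have "nrm (trunc N (R s)) \<le> \<bar>s - t\<bar> * (e / 2)" using elim(2) by linarith
      then have "(1 / \<bar>s - t\<bar>) * nrm (trunc N (R s)) \<le> (1 / \<bar>s - t\<bar>) * (\<bar>s - t\<bar> * (e / 2))"
        by (rule mult_left_mono) simp
      also have "\<dots> = e / 2" using elim(3) by simp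
      finally show ?thesis .
    qed
    finally have "nrm (\<lambda>x. (1 / (s - t)) *\<^sub>R (lowpass N (u s) x - lowpass N (u t) x)
    - (\<i> * lowpass_dxx N (u t) x - \<i> * lowpass N ?Nt x)) \<le> e / 2 + nrm B" by simp
    moreover have "nrm B < e / 2"
    proof -
      have "nrm B \<le> \<bar>s - t\<bar> * (C + 1)" using Bn by (simp add: algebra_simps)
      also have "\<dots> < e / (2 * (C + 1)) * (C + 1)" using elim(1) C0 by (intro mult_strict_right_mono) auto
      also have "\<dots> = e / 2" using C0 by (simp add: field_simps)
      finally show ?thesis .
    qed
    ultimately show ?case by simp
  qed
qed

text \<open>On the band a derivative costs at most the factor \<open>N\<close>.\<close>
lemma lowpass_dx_time_continuous:
  assumes u: "C_H1 I u" and t: "t \<in> I" and N: "0 \<le> N"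
  shows "((\<lambda>s. nrm (\<lambda>x. lowpass_dx N (u s) x - lowpass_dx N (u t) x)) \<longlongrightarrow> 0) (at t within I)"
proof -
  have "((\<lambda>s. N * nrm (\<lambda>x. u s x - u t x)) \<longlongrightarrow> N * 0) (at t within I)"
    by (intro tendsto_intros C_H1_L2_continuous[OF u t])
  then have l: "((\<lambda>s. N * nrm (\<lambda>x. u s x - u t x)) \<longlongrightarrow> 0) (at t within I)" by simp
  show ?thesis
  proof (rule Lim_null_comparison[OF _ l])
    show "\<forall>\<^sub>F s in at t within I. norm (nrm (\<lambda>x. lowpass_dx N (u s) x - lowpass_dx N (u t) x)) \<le> N * nrm (\<lambda>x. u s x - u t x)"
      unfolding eventually_at_filter
    proof (rule always_eventually, intro allI impI)
      fix s assume "s \<in> I"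
      let ?D = "\<lambda>\<xi>. fourier (u s) \<xi> - fourier (u t) \<xi>"
      have "has_fourier (\<lambda>x. lowpass_dx N (u s) x - lowpass_dx N (u t) x) (\<lambda>\<xi>. \<i> * complex_of_real \<xi> * trunc N (fourier (u s)) \<xi> - \<i> * complex_of_real \<xi> * trunc N (fourier (u t)) \<xi>)"
        by (intro has_fourier_diff lowpass_has_fourier)
      from has_fourier_nrm[OF this]
      have "nrm (\<lambda>x. lowpass_dx N (u s) x - lowpass_dx N (u t) x) = nrm (\<lambda>\<xi>. \<i> * complex_of_real \<xi> * trunc N ?D \<xi>)"
        by (simp add: trunc_def algebra_simps)
      also have "\<dots> \<le> N * nrm (trunc N ?D)"
        by (rule band_mult(2)[OF band_trunc _ _ N]) (auto simp: norm_mult)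
      also have "nrm (trunc N ?D) \<le> nrm ?D"
        by (rule nrm_mono[OF _ L2_measurable[OF trunc_L2] AE_I2[OF trunc_le]]) auto
      also have "nrm ?D = nrm (\<lambda>x. u s x - u t x)"
        using H1_diff(3) C_H1_imp(1)[OF u] t \<open>s \<in> I\<close> by blast
      finally show "norm (nrm (\<lambda>x. lowpass_dx N (u s) x - lowpass_dx N (u t) x)) \<le> N * nrm (\<lambda>x. u s x - u t x)"
        using N by (simp add: mult_left_mono)
    qed
  qed
qed

section \<open>The estimate integrated in time\<close>

text \<open>\<open>ReP f (dx f)\<close> is half the derivative of \<open>|f|\<^sup>2\<close>, so
  the first term is twice the squared norm of that derivative.\<close>
definition virial_density :: "real \<Rightarrow> (real \<Rightarrow> complex) \<Rightarrow> real" where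
  "virial_density p f = 8 * (LINT x|lborel. (ReP f (dx f) x)\<^sup>2) + 2 * (p - 1) / (p + 1) * (LINT x|lborel. cmod (f x) powr (p + 3))"

definition lowpass_virial :: "real \<Rightarrow> real \<Rightarrow> (real \<Rightarrow> complex) \<Rightarrow> real" where
  "lowpass_virial p N f = morawetz_deriv (lowpass N f) (lowpass_dx N f) (\<lambda>x. \<i> * lowpass_dxx N f x - \<i> * lowpass N (nonlinearity p f) x)"

lemma morawetz_lowpass_has_derivative:
  assumes p: "1 < p" and sol: "H1_solution p I u" and I: "is_interval I" and t: "t \<in> I" and N: "0 \<le> N"
  shows "((\<lambda>s. morawetz (lowpass N (u s)) (lowpass_dx N (u s))) has_vector_derivative lowpass_virial p N (u t)) (at t within I)"
  unfolding lowpass_virial_def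
proof (rule morawetz_has_derivative)
  have u: "C_H1 I u" using sol by (simp add: H1_solution_def)
  have H: "H1 (u t)" using C_H1_imp(1)[OF u t] .
  show "has_L2_deriv (lowpass N (u s)) (lowpass_dx N (u s))" for s by (rule lowpass_deriv)
  show "(\<lambda>x. \<i> * lowpass_dxx N (u t) x - \<i> * lowpass N (nonlinearity p (u t)) x) \<in> L2" by auto
  show "mass (lowpass N (u t)) x \<le> (sobolev_const * H1_nrm (u t))\<^sup>2" for x
    unfolding mass_def using lowpass_bound[OF H] by (intro power_mono) auto
  show "((\<lambda>s. nrm (\<lambda>x. lowpass_dx N (u s) x - lowpass_dx N (u t) x)) \<longlongrightarrow> 0) (at t within I)"
    by (rule lowpass_dx_time_continuous[OF u t N])
  show "((\<lambda>s. nrm (\<lambda>x. (1 / (s - t)) *\<^sub>R (lowpass N (u s) x - lowpass N (u t) x)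
    - (\<i> * lowpass_dxx N (u t) x - \<i> * lowpass N (nonlinearity p (u t)) x))) \<longlongrightarrow> 0) (at t within I)"
    by (rule lowpass_time_derivative[OF p sol I t N])
qed

text \<open>The low-pass function solves the equation up to the commutator of the cutoff with the
  nonlinearity.\<close>
lemma lowpass_virial_eq:
  assumes p: "1 < p" and f: "H1 f"
  shows "lowpass_virial p N f = 8 * (LINT x|lborel. (ReP (lowpass N f) (lowpass_dx N f) x)\<^sup>2) 
    + 2 * (p - 1) / (p + 1) * (LINT x|lborel. mass (lowpass N f) x * cmod (lowpass N f x) powr (p + 1))
    + forcing (lowpass N f) (lowpass_dx N f) (\<lambda>x. lowpass N (nonlinearity p f) x - nonlinearity p (lowpass N f) x)"
proof -
  let ?V = "lowpass N f" and ?G = "lowpass N (nonlinearity p f)"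
  note K = lowpass_bound[OF f, of N]
  have NL: "nonlinearity p ?V \<in> L2" by (rule nonlinearity_L2(1)[OF p lowpass_L2(1) K])
  have "forcing ?V (lowpass_dx N f) ?G = forcing ?V (lowpass_dx N f) (\<lambda>x. nonlinearity p ?V x + (?G x - nonlinearity p ?V x))"
    by simp
  also have "\<dots> = forcing ?V (lowpass_dx N f) (nonlinearity p ?V) + forcing ?V (lowpass_dx N f) (\<lambda>x. ?G x - nonlinearity p ?V x)"
    by (rule forcing_add[OF _ _ NL _ K]) (use NL in auto)
  finally show ?thesis
    unfolding lowpass_virial_def morawetz_virial[OF lowpass_deriv(1) lowpass_deriv(2) lowpass_L2(1) K] forcing_nonlinearity[OF p lowpass_deriv(1) K] 
    by simp
qed

lemma lowpass_le_H1_nrm: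
  assumes f: "H1 f" shows "nrm (lowpass N f) \<le> H1_nrm f" "nrm (lowpass_dx N f) \<le> H1_nrm f"
  using lowpass_nrm[OF H1_L2[OF f], of N] H1_bounds(2,3)[OF f] lowpass_dx_nrm[OF f, of N] by linarith+

lemma lowpass_error_bound:
  assumes p: "1 < p" and f: "H1 f"
  shows "\<bar>forcing (lowpass N f) (lowpass_dx N f) (\<lambda>x. lowpass N (nonlinearity p f) x - nonlinearity p (lowpass N f) x)\<bar>
    \<le> (4 * (H1_nrm f)^2 * H1_nrm f + 2 * (sobolev_const * H1_nrm f)\<^sup>2 * H1_nrm f) * nrm (\<lambda>x. lowpass N (nonlinearity p f) x - nonlinearity p (lowpass N f) x)"
proof -
  let ?V = "lowpass N f" and ?R = "\<lambda>x. lowpass N (nonlinearity p f) x - nonlinearity p (lowpass N f) x"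
  note K = lowpass_bound[OF f, of N]
  have NL: "nonlinearity p ?V \<in> L2" by (rule nonlinearity_L2(1)[OF p lowpass_L2(1) K])
  have "\<bar>forcing ?V (lowpass_dx N f) ?R\<bar> \<le> (4 * (nrm ?V)\<^sup>2 * nrm (lowpass_dx N f) + 2 * (sobolev_const * H1_nrm f)\<^sup>2 * nrm ?V) * nrm ?R"
    by (rule forcing_bound[OF _ _ _ K]) (use NL in auto)
  also have "\<dots> \<le> (4 * (H1_nrm f)^2 * H1_nrm f + 2 * (sobolev_const * H1_nrm f)\<^sup>2 * H1_nrm f) * nrm ?R"
    using lowpass_le_H1_nrm[OF f, of N] by (intro mult_right_mono add_mono mult_mono mult_left_mono power_mono) (auto simp: H1_nrm_def)
  finally show ?thesis .
qed

lemma lowpass_virial_tendsto: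
  assumes p: "1 < p" and f: "H1 f"
  shows "(\<lambda>n. lowpass_virial p (real n) f) \<longlonglongrightarrow> virial_density p f"
proof -
  let ?R = "\<lambda>n x. lowpass (real n) (nonlinearity p f) x - nonlinearity p (lowpass (real n) f) x"
  let ?E = "\<lambda>n. forcing (lowpass (real n) f) (lowpass_dx (real n) f) (?R n)"
  let ?C = "4 * (H1_nrm f)^2 * H1_nrm f + 2 * (sobolev_const * H1_nrm f)\<^sup>2 * H1_nrm f"
  have NL: "nonlinearity p f \<in> L2" by (rule nonlinearity_H1(1)[OF p f])
  have NLn: "nonlinearity p (lowpass (real n) f) \<in> L2" for n by (rule nonlinearity_L2(1)[OF p lowpass_L2(1) lowpass_bound[OF f]])
  have "(\<lambda>n. nrm (\<lambda>x. lowpass (real n) (nonlinearity p f) x - nonlinearity p f x) + nrm (\<lambda>x. nonlinearity p (lowpass (real n) f) x - nonlinearity p f x)) \<longlonglongrightarrow> 0 + 0"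
    by (intro tendsto_add lowpass_tendsto nonlinearity_lowpass_tendsto p f NL)
  then have l: "(\<lambda>n. nrm (\<lambda>x. lowpass (real n) (nonlinearity p f) x - nonlinearity p f x) + nrm (\<lambda>x. nonlinearity p (lowpass (real n) f) x - nonlinearity p f x)) \<longlonglongrightarrow> 0" by simp
  have Rl: "(\<lambda>n. nrm (?R n)) \<longlonglongrightarrow> 0"
  proof (rule Lim_null_comparison[OF always_eventually l], rule allI)
    fix n
    show "norm (nrm (?R n)) \<le> nrm (\<lambda>x. lowpass (real n) (nonlinearity p f) x - nonlinearity p f x) + nrm (\<lambda>x. nonlinearity p (lowpass (real n) f) x - nonlinearity p f x)"
      using nrm_triangle3[OF lowpass_L2(1)[of "real n" "nonlinearity p f"] NL NLn[of n]] nrm_minus_commute[of "nonlinearity p f" "nonlinearity p (lowpass (real n) f)"] by simp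
  qed
  have "(\<lambda>n. ?C * nrm (?R n)) \<longlonglongrightarrow> ?C * 0" by (intro tendsto_mult tendsto_const Rl)
  then have Cl: "(\<lambda>n. ?C * nrm (?R n)) \<longlonglongrightarrow> 0" by simp
  have El: "?E \<longlonglongrightarrow> 0"
    by (rule Lim_null_comparison[OF always_eventually Cl]) (use lowpass_error_bound[OF p f] in simp)
  have "(\<lambda>n. 8 * (LINT x|lborel. (ReP (lowpass (real n) f) (lowpass_dx (real n) f) x)\<^sup>2) 
    + 2 * (p - 1) / (p + 1) * (LINT x|lborel. mass (lowpass (real n) f) x * cmod (lowpass (real n) f x) powr (p + 1)) + ?E n) \<longlonglongrightarrow> 
      8 * (LINT x|lborel. (ReP f (dx f) x)\<^sup>2) + 2 * (p - 1) / (p + 1) * (LINT x|lborel. cmod (f x) powr (p + 3)) + 0"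
    by (intro tendsto_add tendsto_mult tendsto_const El ReP_lowpass_tendsto(1) potential_lowpass_tendsto(1) p f)
  then show ?thesis unfolding lowpass_virial_eq[OF p f] virial_density_def by simp
qed

text \<open>A bound on the regularised derivative of the action that is independent of the cutoff,
  as dominated convergence in time requires.\<close>
definition virial_bound :: "real \<Rightarrow> real \<Rightarrow> real" where
  "virial_bound p H = 8 * ((sobolev_const * H)\<^sup>2 * H\<^sup>2) + 2 * (p - 1) / (p + 1) * (H\<^sup>2 * (sobolev_const * H) powr (p + 1))
     + (4 * H^2 * H + 2 * (sobolev_const * H)\<^sup>2 * H) * (2 * (sobolev_const * H) powr (p - 1) * H)"

lemma lowpass_virial_bound:
  assumes p: "1 < p" and f: "H1 f" and H: "H1_nrm f \<le> H"
  shows "\<bar>lowpass_virial p N f\<bar> \<le> virial_bound p H"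
proof -
  let ?V = "lowpass N f" and ?V1 = "lowpass_dx N f" and ?K = "sobolev_const * H"
  have h0: "0 \<le> H1_nrm f" by (simp add: H1_nrm_def)
  then have H0: "0 \<le> H" using H by linarith
  have KK: "sobolev_const * H1_nrm f \<le> ?K" using H sobolev_const_nonneg by (rule mult_left_mono)
  have K: "cmod (?V x) \<le> ?K" for x using lowpass_bound[OF f, of N x] KK by linarith
  have K0: "0 \<le> ?K" using K[of 0] norm_ge_zero order_trans by blast
  have n: "nrm ?V \<le> H" "nrm ?V1 \<le> H" using lowpass_le_H1_nrm[OF f, of N] H by linarith+
  have n2: "(nrm ?V)\<^sup>2 \<le> H\<^sup>2" "(nrm ?V1)\<^sup>2 \<le> H\<^sup>2" using n by (auto intro!: power_mono)
  have NV: "nonlinearity p ?V \<in> L2" "nrm (nonlinearity p ?V) \<le> ?K powr (p - 1) * nrm ?V"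
    by (rule nonlinearity_L2[OF p lowpass_L2(1) K])+
  have Nf: "nonlinearity p f \<in> L2" "nrm (nonlinearity p f) \<le> (sobolev_const * H1_nrm f) powr (p - 1) * nrm f"
    by (rule nonlinearity_H1[OF p f])+
  have i1: "integrable lborel (\<lambda>x. mass ?V x * mass ?V1 x)" "integrable lborel (\<lambda>x. (ReP ?V ?V1 x)\<^sup>2)"
    by (rule ReP_square_integrable[OF lowpass_L2(1) lowpass_L2(2) K])+
  have A: "0 \<le> (LINT x|lborel. (ReP ?V ?V1 x)\<^sup>2)" "(LINT x|lborel. (ReP ?V ?V1 x)\<^sup>2) \<le> ?K\<^sup>2 * H\<^sup>2"
  proof -
    show "0 \<le> (LINT x|lborel. (ReP ?V ?V1 x)\<^sup>2)" by simp
    have "(LINT x|lborel. (ReP ?V ?V1 x)\<^sup>2) \<le> (LINT x|lborel. mass ?V x * mass ?V1 x)"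
      using i1 by (intro integral_mono) (auto simp flip: ReP_ImP_square)
    also have "\<dots> \<le> ?K\<^sup>2 * (LINT x|lborel. \<bar>mass ?V1 x\<bar>)"
      using mass_mult_integrable(2)[OF lowpass_L2(1) K mass_integrable[OF lowpass_L2(2)]] by (meson abs_le_D1)
    also have "\<dots> \<le> ?K\<^sup>2 * H\<^sup>2" unfolding mass_integral using n2 by (intro mult_left_mono) auto
    finally show "(LINT x|lborel. (ReP ?V ?V1 x)\<^sup>2) \<le> ?K\<^sup>2 * H\<^sup>2" .
  qed
  have B: "0 \<le> (LINT x|lborel. mass ?V x * cmod (?V x) powr (p + 1))" "(LINT x|lborel. mass ?V x * cmod (?V x) powr (p + 1)) \<le> H\<^sup>2 * ?K powr (p + 1)"
  proof -
    show "0 \<le> (LINT x|lborel. mass ?V x * cmod (?V x) powr (p + 1))" by simp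
    have m: "(\<lambda>x. cmod (?V x) powr (p + 1)) \<in> borel_measurable borel" using L2_measurable[OF lowpass_L2(1), of N f] by measurable
    have "\<bar>LINT x|lborel. mass ?V x * cmod (?V x) powr (p + 1)\<bar> \<le> (LINT x|lborel. \<bar>mass ?V x\<bar>) * ?K powr (p + 1)"
      by (rule integrable_mult_bounded(3)[OF mass_integrable[OF lowpass_L2(1)] m]) (use p K in \<open>auto intro!: powr_mono2\<close>)
    also have "\<dots> \<le> H\<^sup>2 * ?K powr (p + 1)" unfolding mass_integral using n2 by (intro mult_right_mono) auto
    finally show "(LINT x|lborel. mass ?V x * cmod (?V x) powr (p + 1)) \<le> H\<^sup>2 * ?K powr (p + 1)" by simp
  qed
  let ?R = "\<lambda>x. lowpass N (nonlinearity p f) x - nonlinearity p ?V x"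
  have R: "nrm ?R \<le> 2 * ?K powr (p - 1) * H"
  proof -
    have "nrm ?R \<le> nrm (lowpass N (nonlinearity p f)) + nrm (nonlinearity p ?V)"
      by (rule nrm_triangle_diff[OF lowpass_L2(1) NV(1)])
    moreover have "nrm (lowpass N (nonlinearity p f)) \<le> nrm (nonlinearity p f)" by (rule lowpass_nrm[OF Nf(1)])
    moreover have "(sobolev_const * H1_nrm f) powr (p - 1) * nrm f \<le> ?K powr (p - 1) * H"
      using KK p H H1_bounds(3)[OF f] sobolev_const_nonneg h0 by (intro mult_mono powr_mono2) auto
    moreover have "?K powr (p - 1) * nrm ?V \<le> ?K powr (p - 1) * H" using n by (intro mult_left_mono) auto
    ultimately show ?thesis using NV(2) Nf(2) by linarith
  qed
  have Eb: "\<bar>forcing ?V ?V1 ?R\<bar> \<le> (4 * H^2 * H + 2 * ?K\<^sup>2 * H) * (2 * ?K powr (p - 1) * H)"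
  proof -
    have "\<bar>forcing ?V ?V1 ?R\<bar> \<le> (4 * (nrm ?V)\<^sup>2 * nrm ?V1 + 2 * ?K\<^sup>2 * nrm ?V) * nrm ?R"
      by (rule forcing_bound[OF _ _ _ K]) (use NV in auto)
    also have "\<dots> \<le> (4 * H^2 * H + 2 * ?K\<^sup>2 * H) * (2 * ?K powr (p - 1) * H)"
      using n n2 R H0 by (intro mult_mono[OF _ R] add_mono mult_mono mult_left_mono) auto
    finally show ?thesis .
  qed
  have c0: "0 \<le> 2 * (p - 1) / (p + 1)" using p by simp
  have "\<bar>lowpass_virial p N f\<bar> \<le> 8 * (LINT x|lborel. (ReP ?V ?V1 x)\<^sup>2) + 2 * (p - 1) / (p + 1) * (LINT x|lborel. mass ?V x * cmod (?V x) powr (p + 1)) + \<bar>forcing ?V ?V1 ?R\<bar>"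
  proof -
    have gen: "\<bar>8 * a + y + z\<bar> \<le> 8 * a + y + \<bar>z\<bar>" if "0 \<le> a" "0 \<le> y" for a y z :: real using that by linarith
    show ?thesis unfolding lowpass_virial_eq[OF p f] by (rule gen[OF A(1) mult_nonneg_nonneg[OF c0 B(1)]])
  qed
  also have "\<dots> \<le> virial_bound p H"
    unfolding virial_bound_def using A(2) mult_left_mono[OF B(2) c0] Eb by linarith
  finally show ?thesis .
qed

text \<open>Integrate the derivative of the regularised action. The action at the end points is
  bounded uniformly in the cutoff, and the integrand converges boundedly as the cutoff is
  removed.\<close>
lemma virial_estimate:
  assumes p: "1 < p" and sol: "H1_solution p I u" and I: "is_interval I" and ab: "a \<in> I" "b \<in> I" "a \<le> b"
  shows "\<exists>J. ((\<lambda>t. virial_density p (u t)) has_integral J) {a..b} \<and> J \<le> (nrm (u a))^3 * Hdot1_nrm (u a) + (nrm (u b))^3 * Hdot1_nrm (u b)"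
proof -
  have u: "C_H1 I u" using sol by (simp add: H1_solution_def)
  have sub: "{a..b} \<subseteq> I" using mem_is_interval_1_I[OF I ab(1,2)] by auto
  have Hu: "H1 (u t)" if "t \<in> {a..b}" for t using C_H1_imp(1)[OF u] that sub by blast
  let ?M = "\<lambda>n t. morawetz (lowpass (real n) (u t)) (lowpass_dx (real n) (u t))"
  let ?E = "\<lambda>n t. lowpass_virial p (real n) (u t)"
  have ftc: "(?E n has_integral (?M n b - ?M n a)) {a..b}" for n
  proof (rule fundamental_theorem_of_calculus[OF ab(3)])
    fix t assume "t \<in> {a..b}"
    then have "(?M n has_vector_derivative ?E n t) (at t within I)"
      using sub by (intro morawetz_lowpass_has_derivative[OF p sol I]) auto
    then show "(?M n has_vector_derivative ?E n t) (at t within {a..b})"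
      by (rule has_vector_derivative_within_subset[OF _ sub])
  qed
  have "continuous_on {a..b} (\<lambda>t. H1_nrm (u t))" using C_H1_continuous[OF u] sub by (rule continuous_on_subset)
  then have "\<exists>t0\<in>{a..b}. \<forall>t\<in>{a..b}. H1_nrm (u t) \<le> H1_nrm (u t0)"
    by (intro continuous_attains_sup) (use ab(3) in auto)
  then obtain t0 where "\<forall>t\<in>{a..b}. H1_nrm (u t) \<le> H1_nrm (u t0)" by blast
  then have b: "norm (?E n t) \<le> virial_bound p (H1_nrm (u t0))" if "t \<in> {a..b}" for n t
    using lowpass_virial_bound[OF p Hu[OF that]] that by simp
  have int: "?E n integrable_on {a..b}" for n using ftc by blast
  have ci: "(\<lambda>t::real. virial_bound p (H1_nrm (u t0))) integrable_on {a..b}" by (rule integrable_const_ivl)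
  have lim: "(\<lambda>n. ?E n t) \<longlonglongrightarrow> virial_density p (u t)" if "t \<in> {a..b}" for t
    by (rule lowpass_virial_tendsto[OF p Hu[OF that]])
  have vi: "(\<lambda>t. virial_density p (u t)) integrable_on {a..b}"
    by (rule dominated_convergence(1)[OF int ci b lim])
  have vl: "(\<lambda>n. integral {a..b} (?E n)) \<longlonglongrightarrow> integral {a..b} (\<lambda>t. virial_density p (u t))"
    by (rule dominated_convergence(2)[OF int ci b lim])
  have Mb: "\<bar>?M n t\<bar> \<le> (nrm (u t))^3 * Hdot1_nrm (u t)" if "t \<in> {a..b}" for n t
  proof -
    have "\<bar>?M n t\<bar> \<le> (nrm (lowpass (real n) (u t)))^3 * nrm (lowpass_dx (real n) (u t))"
      by (rule morawetz_bound) auto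
    also have "\<dots> \<le> (nrm (u t))^3 * Hdot1_nrm (u t)"
      using lowpass_nrm[OF H1_L2[OF Hu[OF that]]] lowpass_dx_nrm[OF Hu[OF that]] by (intro mult_mono power_mono) auto
    finally show ?thesis .
  qed
  have "integral {a..b} (\<lambda>t. virial_density p (u t)) \<le> (nrm (u a))^3 * Hdot1_nrm (u a) + (nrm (u b))^3 * Hdot1_nrm (u b)"
  proof (rule LIMSEQ_le_const2[OF vl], intro exI allI impI)
    fix n
    have "integral {a..b} (?E n) = ?M n b - ?M n a" using ftc by (rule integral_unique)
    then show "integral {a..b} (?E n) \<le> (nrm (u a))^3 * Hdot1_nrm (u a) + (nrm (u b))^3 * Hdot1_nrm (u b)"
      using Mb[of a n] Mb[of b n] ab(3) by auto
  qed
  then show ?thesis using vi integrable_integral by blast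
qed

section \<open>Smooth bump functions\<close>

text \<open>For the polynomial 1 this is the standard smooth function \<open>exp (- 1 /
  s)\<close>; polynomials in \<open>1 / s\<close> make the family closed under
  differentiation.\<close>
definition expinv :: "real poly \<Rightarrow> real \<Rightarrow> real" where
  "expinv P s = (if 0 < s then poly P (1 / s) * exp (- (1 / s)) else 0)"

lemma poly_exp_tendsto_0: "((\<lambda>y. poly P y * exp (- y)) \<longlongrightarrow> (0::real)) at_top"
proof -
  have "((\<lambda>y. \<Sum>i\<le>degree P. coeff P i * (y ^ i / exp y)) \<longlongrightarrow> (\<Sum>i\<le>degree P. coeff P i * 0)) at_top"
    by (intro tendsto_sum tendsto_mult tendsto_const tendsto_power_div_exp_0)
  then show ?thesis by (simp add: poly_altdef sum_distrib_right exp_minus divide_inverse mult.assoc)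
qed

lemma expinv_tendsto_0: "(expinv P \<longlongrightarrow> 0) (at 0)"
proof -
  have "((\<lambda>s. poly P (inverse s) * exp (- inverse s)) \<longlongrightarrow> 0) (at_right 0)"
    by (rule filterlim_compose[OF poly_exp_tendsto_0 filterlim_inverse_at_top_right])
  moreover have "\<forall>\<^sub>F s in at_right 0. poly P (inverse s) * exp (- inverse s) = expinv P s"
    unfolding eventually_at_filter by (rule always_eventually) (simp add: expinv_def inverse_eq_divide)
  ultimately have r: "(expinv P \<longlongrightarrow> 0) (at_right 0)" by (rule Lim_transform_eventually)
  have "\<forall>\<^sub>F s in at_left 0. expinv P s = 0"
    unfolding eventually_at_filter by (rule always_eventually) (simp add: expinv_def)
  then have "(expinv P \<longlongrightarrow> 0) (at_left 0)" by (rule tendsto_eventually)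
  with r show ?thesis by (simp add: filterlim_split_at)
qed

definition expinv_D :: "real poly \<Rightarrow> real poly" where
  "expinv_D P = pCons 0 (pCons 0 (P - pderiv P))"

text \<open>Away from 0 this is a computation. At 0 the difference quotient is again of the form
  \<open>expinv\<close> and tends to 0.\<close>
lemma expinv_deriv: "(expinv P has_real_derivative expinv (expinv_D P) s) (at s)"
proof -
  consider "0 < s" | "s < 0" | "s = 0" by linarith
  then show ?thesis
  proof cases
    case 1
    have "((\<lambda>s. poly P (1 / s) * exp (- (1 / s))) has_real_derivative expinv (expinv_D P) s) (at s)"
    proof -
      have d: "((\<lambda>s. 1 / s) has_real_derivative - (1 / s\<^sup>2)) (at s)"
        using 1 by (auto intro!: derivative_eq_intros simp: power2_eq_square)
      have "((\<lambda>s. poly P (1 / s)) has_real_derivative poly (pderiv P) (1 / s) * (- (1 / s\<^sup>2))) (at s)"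
        by (rule DERIV_chain2[OF poly_DERIV d])
      moreover have "((\<lambda>s. exp (- (1 / s))) has_real_derivative exp (- (1 / s)) * (1 / s\<^sup>2)) (at s)"
        using DERIV_chain2[OF DERIV_exp DERIV_minus[OF d]] by simp
      ultimately have "((\<lambda>s. poly P (1 / s) * exp (- (1 / s))) has_real_derivative 
        poly (pderiv P) (1 / s) * (- (1 / s\<^sup>2)) * exp (- (1 / s)) + exp (- (1 / s)) * (1 / s\<^sup>2) * poly P (1 / s)) (at s)"
        by (rule DERIV_mult)
      moreover have "poly (pderiv P) (1 / s) * (- (1 / s\<^sup>2)) * exp (- (1 / s)) + exp (- (1 / s)) * (1 / s\<^sup>2) * poly P (1 / s) = expinv (expinv_D P) s"
        using 1 by (simp add: expinv_def expinv_D_def algebra_simps power2_eq_square)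
      ultimately show ?thesis by simp
    qed
    moreover have "\<forall>\<^sub>F y in nhds s. poly P (1 / y) * exp (- (1 / y)) = expinv P y"
      by (rule eventually_mono[OF eventually_nhds_in_open[of "{0<..}" s]]) (use 1 in \<open>simp_all add: expinv_def\<close>)
    ultimately show ?thesis by (simp add: DERIV_cong_ev)
  next
    case 2
    have "\<forall>\<^sub>F y in nhds s. 0 = expinv P y"
      by (rule eventually_mono[OF eventually_nhds_in_open[of "{..<0}" s]]) (use 2 in \<open>simp_all add: expinv_def\<close>)
    moreover have "((\<lambda>s. 0) has_real_derivative 0) (at s)" by simp
    moreover have "expinv (expinv_D P) s = 0" using 2 by (simp add: expinv_def)
    ultimately show ?thesis using DERIV_cong_ev[of s s "\<lambda>_. 0" "expinv P" 0 0] by simp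
  next
    case 3
    have "\<forall>\<^sub>F h in at 0. expinv (pCons 0 P) h = expinv P h / h"
      unfolding eventually_at_filter by (rule always_eventually) (simp add: expinv_def)
    from Lim_transform_eventually[OF expinv_tendsto_0 this]
    have "((\<lambda>h. expinv P h / h) \<longlongrightarrow> 0) (at 0)" .
    then show ?thesis unfolding 3 has_field_derivative_iff by (simp add: expinv_def)
  qed
qed

text \<open>The linear span of products of two such functions, one at each end of the interval
  from \<open>a\<close> to \<open>b\<close>. It is closed under differentiation, so all its
  members are smooth.\<close>
inductive_set bumps :: "real \<Rightarrow> real \<Rightarrow> real \<Rightarrow> (real \<Rightarrow> real) set" for a b k where
  base: "(\<lambda>x. expinv P (k * (x - a)) * expinv Q (k * (b - x))) \<in> bumps a b k"
| add: "f \<in> bumps a b k \<Longrightarrow> g \<in> bumps a b k \<Longrightarrow> (\<lambda>x. f x + g x) \<in> bumps a b k"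
| cmult: "f \<in> bumps a b k \<Longrightarrow> (\<lambda>x. c * f x) \<in> bumps a b k"

lemma bumps_deriv: "f \<in> bumps a b k \<Longrightarrow> \<exists>g\<in>bumps a b k. \<forall>x. (f has_real_derivative g x) (at x)"
proof (induction rule: bumps.induct)
  case (base P Q)
  let ?g = "\<lambda>x. k * (expinv (expinv_D P) (k * (x - a)) * expinv Q (k * (b - x))) + (- k) * (expinv P (k * (x - a)) * expinv (expinv_D Q) (k * (b - x)))"
  have "?g \<in> bumps a b k" by (intro bumps.add bumps.cmult bumps.base)
  moreover have "((\<lambda>x. expinv P (k * (x - a)) * expinv Q (k * (b - x))) has_real_derivative ?g x) (at x)" for x
  proof -
    have 1: "((\<lambda>x. k * (x - a)) has_real_derivative k) (at x)" and 2: "((\<lambda>x. k * (b - x)) has_real_derivative - k) (at x)"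
      by (auto intro!: derivative_eq_intros)
    from DERIV_mult[OF DERIV_chain2[OF expinv_deriv[of P] 1] DERIV_chain2[OF expinv_deriv[of Q] 2]]
    show ?thesis by (simp add: algebra_simps)
  qed
  ultimately show ?case by (intro bexI[of _ ?g] allI)
next
  case (add f g)
  then obtain f' g' where "f' \<in> bumps a b k" "g' \<in> bumps a b k" "\<And>x. (f has_real_derivative f' x) (at x)" "\<And>x. (g has_real_derivative g' x) (at x)"
    by blast
  then show ?case by (intro bexI[of _ "\<lambda>x. f' x + g' x"] allI DERIV_add bumps.add)
next
  case (cmult f c)
  then obtain f' where "f' \<in> bumps a b k" "\<And>x. (f has_real_derivative f' x) (at x)" by blast
  then show ?case by (intro bexI[of _ "\<lambda>x. c * f' x"] allI DERIV_cmult bumps.cmult)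
qed

lemma bumps_iterated_deriv: "f \<in> bumps a b k \<Longrightarrow> (deriv ^^ n) f \<in> bumps a b k"
proof (induction n)
  case (Suc n)
  then obtain g where g: "g \<in> bumps a b k" "\<And>x. ((deriv ^^ n) f has_real_derivative g x) (at x)" using bumps_deriv by blast
  then have "deriv ((deriv ^^ n) f) = g" by (intro ext DERIV_imp_deriv)
  then show ?case using g by simp
qed simp

lemma bumps_support: "f \<in> bumps a b k \<Longrightarrow> 0 < k \<Longrightarrow> x \<notin> {a..b} \<Longrightarrow> f x = 0"
  by (induction rule: bumps.induct) (auto simp: expinv_def zero_less_mult_iff)

lemma bumps_test_function:
  assumes f: "f \<in> bumps a b k" and k: "0 < k" shows "test_function f"
  unfolding test_function_def
proof (intro conjI allI exI impI)
  fix n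
  obtain g where "\<And>x. ((deriv ^^ n) f has_real_derivative g x) (at x)"
    using bumps_deriv[OF bumps_iterated_deriv[OF f]] by blast
  then show "(deriv ^^ n) f differentiable_on UNIV"
    unfolding differentiable_on_def by (auto simp: real_differentiable_def)
next
  fix x assume "\<bar>a\<bar> + \<bar>b\<bar> < \<bar>x\<bar>"
  then show "f x = 0" by (intro bumps_support[OF f k]) auto
qed

section \<open>Weak derivatives\<close>

lemma locally_integrable_diff:
  assumes "locally_integrable f" "locally_integrable g" shows "locally_integrable (\<lambda>x. f x - g x)"
  using assms unfolding locally_integrable_def by (auto intro: set_integral_diff)

lemma test_function_props:
  assumes \<phi>: "test_function \<phi>"
  shows "(\<phi> has_real_derivative deriv \<phi> x) (at x)" 
    "\<phi> \<in> borel_measurable borel" "deriv \<phi> \<in> borel_measurable borel"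
    "\<exists>K. \<forall>x. \<bar>\<phi> x\<bar> \<le> K" "\<exists>K. \<forall>x. \<bar>deriv \<phi> x\<bar> \<le> K" "\<exists>R. \<forall>x. R < \<bar>x\<bar> \<longrightarrow> \<phi> x = 0"
proof -
  obtain R where R: "\<And>x. R < \<bar>x\<bar> \<Longrightarrow> \<phi> x = 0" using \<phi> unfolding test_function_def by blast
  then show "\<exists>R. \<forall>x. R < \<bar>x\<bar> \<longrightarrow> \<phi> x = 0" by blast
  have d: "(deriv ^^ n) \<phi> differentiable_on UNIV" for n using \<phi> unfolding test_function_def by blast
  have d0: "\<phi> differentiable_on UNIV" and d1: "deriv \<phi> differentiable_on UNIV" using d[of 0] d[of 1] by auto
  show D: "(\<phi> has_real_derivative deriv \<phi> x) (at x)" for x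
    using d0 unfolding differentiable_on_def real_differentiable_def by (metis DERIV_imp_deriv UNIV_I)
  have c0: "continuous_on UNIV \<phi>" and c1: "continuous_on UNIV (deriv \<phi>)" using d0 d1 differentiable_imp_continuous_on by blast+
  then show "\<phi> \<in> borel_measurable borel" "deriv \<phi> \<in> borel_measurable borel"
    by (auto intro: borel_measurable_continuous_onI)
  have R1: "deriv \<phi> x = 0" if "R < \<bar>x\<bar>" for x
  proof -
    have "open {y::real. R < \<bar>y\<bar>}" by (intro open_Collect_less continuous_intros)
    from eventually_nhds_in_open[OF this] that have "\<forall>\<^sub>F y in nhds x. y \<in> {y. R < \<bar>y\<bar>}" by simp
    then have "\<forall>\<^sub>F y in nhds x. 0 = \<phi> y" by (rule eventually_mono) (simp add: R)
    then have "(\<phi> has_real_derivative 0) (at x)"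
      using DERIV_cong_ev[of x x "\<lambda>_. 0" \<phi> 0 0] by simp
    then show ?thesis by (rule DERIV_imp_deriv)
  qed
  have bd: "\<exists>K. \<forall>x. \<bar>\<psi> x\<bar> \<le> K" if c: "continuous_on UNIV \<psi>" and z: "\<And>x. R < \<bar>x\<bar> \<Longrightarrow> \<psi> x = 0" for \<psi> :: "real \<Rightarrow> real"
  proof -
    have "compact (\<psi> ` {-R..R})" by (intro compact_continuous_image continuous_on_subset[OF c]) auto
    from compact_imp_bounded[OF this] obtain K where "\<forall>y\<in>\<psi> ` {-R..R}. norm y \<le> K"
      unfolding bounded_iff by blast
    then have K: "\<bar>\<psi> x\<bar> \<le> K" if "x \<in> {-R..R}" for x using that by simp
    have "\<bar>\<psi> x\<bar> \<le> max K 0" for x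
    proof (cases "R < \<bar>x\<bar>")
      case False
      then have "x \<in> {-R..R}" by (auto simp: abs_le_iff)
      from K[OF this] show ?thesis by simp
    qed (simp add: z)
    then show ?thesis by blast
  qed
  show "\<exists>K. \<forall>x. \<bar>\<phi> x\<bar> \<le> K" by (rule bd[OF c0 R])
  show "\<exists>K. \<forall>x. \<bar>deriv \<phi> x\<bar> \<le> K" by (rule bd[OF c1 R1])
qed

lemma locally_integrable_measurable:
  assumes "locally_integrable g" shows "g \<in> borel_measurable borel"
proof (rule borel_measurable_LIMSEQ_real)
  show "(\<lambda>x. indicator {- real n..real n} x * g x) \<in> borel_measurable borel" for n
  proof -
    have "integrable lborel (\<lambda>x. indicator {- real n..real n} x *\<^sub>R g x)"
      using assms unfolding locally_integrable_def set_integrable_def by blast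
    from integrable_borel[OF this] show ?thesis by simp
  qed
  show "(\<lambda>n. indicator {- real n..real n} x * g x) \<longlonglongrightarrow> g x" for x
  proof (rule tendsto_eventually)
    obtain n0 :: nat where n0: "\<bar>x\<bar> \<le> real n0" using real_arch_simple by blast
    then show "\<forall>\<^sub>F n in sequentially. indicator {- real n..real n} x * g x = g x"
      by (intro eventually_sequentiallyI[of n0]) (auto simp: indicator_def)
  qed
qed

text \<open>Test with the bump functions for \<open>P = Q = 1\<close> and \<open>k = 1, 2,
  \<dots>\<close>. They are bounded by 1 and tend to the indicator of the open interval.\<close>
lemma weak_zero_interval:
  assumes d: "locally_integrable d" and z: "\<And>\<phi>. test_function \<phi> \<Longrightarrow> (LINT x|lborel. d x * \<phi> x) = 0"
  shows "(LINT x|lborel. indicator {a<..<b} x * d x) = 0"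
proof -
  have [measurable]: "d \<in> borel_measurable borel" by (rule locally_integrable_measurable[OF d])
  \<comment> \<open>\<open>k = Suc n\<close> keeps the scaling factor positive\<close>
  define \<phi> where "\<phi> n x = expinv 1 (real (Suc n) * (x - a)) * expinv 1 (real (Suc n) * (b - x))" for n x
  have b\<phi>: "\<phi> n \<in> bumps a b (real (Suc n))" for n unfolding \<phi>_def[abs_def] by (rule bumps.base)
  have t: "test_function (\<phi> n)" for n by (rule bumps_test_function[OF b\<phi>]) simp
  have [measurable]: "\<phi> n \<in> borel_measurable borel" for n using test_function_props(2)[OF t] .
  have "(\<lambda>n. LINT x|lborel. d x * \<phi> n x) \<longlonglongrightarrow> (LINT x|lborel. indicator {a<..<b} x * d x)"
  proof (rule integral_dominated_convergence[where w="\<lambda>x. indicator {a..b} x * \<bar>d x\<bar>"])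
    have "integrable lborel (\<lambda>x. \<bar>indicator {a..b} x *\<^sub>R d x\<bar>)"
      using d unfolding locally_integrable_def set_integrable_def by (intro integrable_abs) blast
    then show "integrable lborel (\<lambda>x. indicator {a..b} x * \<bar>d x\<bar>)" by (simp add: abs_mult)
    show "AE x in lborel. (\<lambda>n. d x * \<phi> n x) \<longlonglongrightarrow> indicator {a<..<b} x * d x"
    proof (rule AE_I2)
      fix x :: real
      show "(\<lambda>n. d x * \<phi> n x) \<longlonglongrightarrow> indicator {a<..<b} x * d x"
      proof (cases "x \<in> {a<..<b}")
        case True
        have inv: "(\<lambda>n. 1 / (real (Suc n) * y)) \<longlonglongrightarrow> 0" if "0 < y" for y :: real
        proof -
          have "(\<lambda>n. inverse (real (Suc n)) * (1 / y)) \<longlonglongrightarrow> 0 * (1 / y)"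
            by (intro tendsto_mult tendsto_const LIMSEQ_inverse_real_of_nat)
          then show ?thesis by (simp add: divide_inverse)
        qed
        have e: "\<phi> n x = exp (- (1 / (real (Suc n) * (x - a)))) * exp (- (1 / (real (Suc n) * (b - x))))" for n
          using True unfolding \<phi>_def expinv_def by simp
        have "(\<lambda>n. d x * \<phi> n x) \<longlonglongrightarrow> d x * (exp (- 0) * exp (- 0))"
          unfolding e using True by (intro tendsto_intros inv) auto
        then show ?thesis using True by simp
      next
        case False
        then have "\<phi> n x = 0" for n unfolding \<phi>_def expinv_def by (auto simp: zero_less_mult_iff)
        then show ?thesis using False by simp
      qed
    qed
    show "AE x in lborel. norm (d x * \<phi> n x) \<le> indicator {a..b} x * \<bar>d x\<bar>" for n
    proof (rule AE_I2)
      fix x :: real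
      show "norm (d x * \<phi> n x) \<le> indicator {a..b} x * \<bar>d x\<bar>"
      proof (cases "x \<in> {a..b}")
        case True
        have 1: "0 \<le> expinv 1 s \<and> expinv 1 s \<le> 1" for s unfolding expinv_def by simp
        have "\<bar>\<phi> n x\<bar> \<le> 1" unfolding \<phi>_def abs_mult using 1 by (intro mult_le_one) auto
        then have "\<bar>d x\<bar> * \<bar>\<phi> n x\<bar> \<le> \<bar>d x\<bar> * 1" by (intro mult_left_mono) auto
        then show ?thesis using True by (simp add: abs_mult)
      next
        case False
        then have "\<phi> n x = 0" using bumps_support[OF b\<phi>] by simp
        then show ?thesis using False by simp
      qed
    qed
  qed measurable
  then show ?thesis unfolding z[OF t] by (simp add: LIMSEQ_const_iff)
qed

text \<open>On a bounded interval the positive and the negative part of \<open>d\<close> have the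
  same integral over every half-line, so the measures with these densities coincide.\<close>
lemma integrals_zero_AE:
  assumes d: "locally_integrable d" and z: "\<And>a b. (LINT x|lborel. indicator {a<..<b} x * d x) = (0::real)"
  shows "AE x in lborel. d x = 0"
proof -
  have [measurable]: "d \<in> borel_measurable borel" by (rule locally_integrable_measurable[OF d])
  have main: "AE x in lborel. x \<in> {-R<..<R} \<longrightarrow> d x = 0" for R :: real
  proof -
    let ?p = "\<lambda>x. ennreal (indicator {-R<..<R} x * max 0 (d x))" and ?m = "\<lambda>x. ennreal (indicator {-R<..<R} x * max 0 (- d x))"
    have i: "integrable lborel (\<lambda>x. indicator A x * (indicator {-R<..<R} x * d x))" if [measurable]: "A \<in> sets borel" for A
    proof (rule Bochner_Integration.integrable_bound)
      show "integrable lborel (\<lambda>x. indicator {-R..R} x *\<^sub>R d x)" using d unfolding locally_integrable_def set_integrable_def by blast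
      show "AE x in lborel. norm (indicator A x * (indicator {-R<..<R} x * d x)) \<le> norm (indicator {-R..R} x *\<^sub>R d x)"
        by (auto simp: indicator_def)
    qed measurable
    have ip: "integrable lborel (\<lambda>x. indicator A x * (indicator {-R<..<R} x * max 0 (d x)))" "integrable lborel (\<lambda>x. indicator A x * (indicator {-R<..<R} x * max 0 (- d x)))" 
      if [measurable]: "A \<in> sets borel" for A
      by (rule Bochner_Integration.integrable_bound[OF i[OF that]], measurable, auto simp: indicator_def)+
    have eqi: "(LINT x|lborel. indicator {y<..} x * (indicator {-R<..<R} x * max 0 (d x))) = (LINT x|lborel. indicator {y<..} x * (indicator {-R<..<R} x * max 0 (- d x)))" for y
    proof -
      have "(LINT x|lborel. indicator {y<..} x * (indicator {-R<..<R} x * max 0 (d x))) - (LINT x|lborel. indicator {y<..} x * (indicator {-R<..<R} x * max 0 (- d x)))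
       = (LINT x|lborel. indicator {max y (-R)<..<R} x * d x)"
      proof (subst Bochner_Integration.integral_diff[symmetric])
        show "(LINT x|lborel. indicator {y<..} x * (indicator {-R<..<R} x * max 0 (d x)) - indicator {y<..} x * (indicator {-R<..<R} x * max 0 (- d x)))
          = (LINT x|lborel. indicator {max y (-R)<..<R} x * d x)"
          by (intro Bochner_Integration.integral_cong refl) (auto simp: indicator_def max_def)
      qed (rule ip, simp)+
      then show ?thesis using z by simp
    qed
    have em: "emeasure (density lborel ?p) {y<..} = ennreal (LINT x|lborel. indicator {y<..} x * (indicator {-R<..<R} x * max 0 (d x)))"
      "emeasure (density lborel ?m) {y<..} = ennreal (LINT x|lborel. indicator {y<..} x * (indicator {-R<..<R} x * max 0 (- d x)))" for y
    proof -
      have "emeasure (density lborel ?p) {y<..} = (\<integral>\<^sup>+x. ennreal (indicator {y<..} x * (indicator {-R<..<R} x * max 0 (d x))) \<partial>lborel)"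
        by (subst emeasure_density) (auto intro!: nn_integral_cong simp: indicator_def)
      then show "emeasure (density lborel ?p) {y<..} = ennreal (LINT x|lborel. indicator {y<..} x * (indicator {-R<..<R} x * max 0 (d x)))"
        using ip(1)[of "{y<..}"] by (simp add: nn_integral_eq_integral)
      have "emeasure (density lborel ?m) {y<..} = (\<integral>\<^sup>+x. ennreal (indicator {y<..} x * (indicator {-R<..<R} x * max 0 (- d x))) \<partial>lborel)"
        by (subst emeasure_density) (auto intro!: nn_integral_cong simp: indicator_def)
      then show "emeasure (density lborel ?m) {y<..} = ennreal (LINT x|lborel. indicator {y<..} x * (indicator {-R<..<R} x * max 0 (- d x)))"
        using ip(2)[of "{y<..}"] by (simp add: nn_integral_eq_integral)
    qed
    have "density lborel ?p = density lborel ?m"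
      by (rule measure_eqI_lessThan) (simp_all add: em eqi)
    then have "AE x in lborel. ?p x = ?m x"
      by (intro sigma_finite_measure.density_unique[OF sigma_finite_lborel]) auto
    then show ?thesis
    proof (rule eventually_mono)
      fix x assume "?p x = ?m x"
      then have "indicator {-R<..<R} x * max 0 (d x) = indicator {-R<..<R} x * max 0 (- d x)" by simp
      then show "x \<in> {-R<..<R} \<longrightarrow> d x = 0" by (auto simp: max_def split: if_splits)
    qed
  qed
  have "AE x in lborel. \<forall>n::nat. x \<in> {- real n<..<real n} \<longrightarrow> d x = 0" unfolding AE_all_countable using main by blast
  then show ?thesis
  proof (rule eventually_mono)
    fix x assume *: "\<forall>n::nat. x \<in> {- real n<..<real n} \<longrightarrow> d x = 0"
    obtain n :: nat where "\<bar>x\<bar> < real n" using reals_Archimedean2 by blast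
    then show "d x = 0" using * by (auto simp: abs_less_iff)
  qed
qed

lemma locally_integrable_times_test:
  assumes g: "locally_integrable g" and \<phi>: "test_function \<phi>"
  shows "integrable lborel (\<lambda>x. g x * \<phi> x)"
proof -
  obtain K where K: "\<And>x. \<bar>\<phi> x\<bar> \<le> K" using test_function_props(4)[OF \<phi>] by blast
  obtain R where R: "\<And>x. R < \<bar>x\<bar> \<Longrightarrow> \<phi> x = 0" using test_function_props(6)[OF \<phi>] by blast
  have i: "integrable lborel (\<lambda>x. indicator {-R..R} x *\<^sub>R g x)" using g unfolding locally_integrable_def set_integrable_def by blast
  have "integrable lborel (\<lambda>x. (indicator {-R..R} x *\<^sub>R g x) * \<phi> x)"
    by (rule integrable_mult_bounded(1)[OF i test_function_props(2)[OF \<phi>] K])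
  moreover have "(\<lambda>x. (indicator {-R..R} x *\<^sub>R g x) * \<phi> x) = (\<lambda>x. g x * \<phi> x)"
    using R by (force simp: indicator_def abs_le_iff not_le)
  ultimately show ?thesis by simp
qed

lemma weak_deriv_unique:
  assumes "has_weak_deriv f g" "has_weak_deriv f h" shows "AE x in lborel. g x = h x"
proof -
  have L: "locally_integrable g" "locally_integrable h" using assms by (auto simp: has_weak_deriv_def)
  have d: "locally_integrable (\<lambda>x. g x - h x)" by (rule locally_integrable_diff[OF L])
  have "(LINT x|lborel. (g x - h x) * \<phi> x) = 0" if \<phi>: "test_function \<phi>" for \<phi>
  proof -
    have "(LINT x|lborel. g x * \<phi> x) = (LINT x|lborel. h x * \<phi> x)"
      using assms \<phi> unfolding has_weak_deriv_def by simp
    then show ?thesis unfolding left_diff_distrib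
      using locally_integrable_times_test[OF L(1) \<phi>] locally_integrable_times_test[OF L(2) \<phi>] by simp
  qed
  from integrals_zero_AE[OF d weak_zero_interval[OF d this]] show ?thesis by simp
qed

lemma integrable_locally_integrable: 
  fixes f :: "real \<Rightarrow> real"
  assumes "integrable lborel f" shows "locally_integrable f"
  unfolding locally_integrable_def set_integrable_def
  by (intro allI integrable_mult_indicator assms) simp

text \<open>For the low-pass functions this is integration by parts; both sides converge as the
  cutoff is removed.\<close>
lemma mass_weak_deriv:
  assumes f: "H1 f" shows "has_weak_deriv (mass f) (\<lambda>x. 2 * ReP f (dx f) x)"
  unfolding has_weak_deriv_def
proof (intro conjI allI impI)
  have L: "f \<in> L2" "dx f \<in> L2" using f by (auto simp: H1_def dx_L2)
  show "locally_integrable (mass f)" "locally_integrable (\<lambda>x. 2 * ReP f (dx f) x)"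
    using L by (auto intro!: integrable_locally_integrable integrable_mult_right)
  fix \<phi> assume \<phi>: "test_function \<phi>"
  obtain K where K: "\<And>x. \<bar>\<phi> x\<bar> \<le> K" using test_function_props(4)[OF \<phi>] by blast
  obtain K' where K': "\<And>x. \<bar>deriv \<phi> x\<bar> \<le> K'" using test_function_props(5)[OF \<phi>] by blast
  note m = test_function_props(2,3)[OF \<phi>]
  let ?V = "\<lambda>n. lowpass (real n) f" and ?V1 = "\<lambda>n. lowpass_dx (real n) f"
  have conv: "(\<lambda>n. LINT x|lborel. a n x * \<psi> x) \<longlonglongrightarrow> (LINT x|lborel. a0 x * \<psi> x)"
    if a: "\<And>n. integrable lborel (a n)" "integrable lborel a0" "(\<lambda>n. LINT x|lborel. \<bar>a n x - a0 x\<bar>) \<longlonglongrightarrow> 0"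
      and \<psi>: "\<psi> \<in> borel_measurable borel" "\<And>x. \<bar>\<psi> x\<bar> \<le> B" for a :: "nat \<Rightarrow> real \<Rightarrow> real" and a0 \<psi> B
  proof -
    have l: "(\<lambda>n. (LINT x|lborel. \<bar>a n x - a0 x\<bar>) * B) \<longlonglongrightarrow> 0" by (rule tendsto_mult_left_zero[OF a(3)])
    have "(\<lambda>n. (LINT x|lborel. a n x * \<psi> x) - (LINT x|lborel. a0 x * \<psi> x)) \<longlonglongrightarrow> 0"
    proof (rule Lim_null_comparison[OF always_eventually l], rule allI)
      fix n
      have i: "integrable lborel (\<lambda>x. a n x * \<psi> x)" "integrable lborel (\<lambda>x. a0 x * \<psi> x)"
        by (rule integrable_mult_bounded(1)[OF a(1) \<psi>], rule integrable_mult_bounded(1)[OF a(2) \<psi>])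
      have "(LINT x|lborel. a n x * \<psi> x) - (LINT x|lborel. a0 x * \<psi> x) = (LINT x|lborel. (a n x - a0 x) * \<psi> x)"
        unfolding left_diff_distrib by (rule Bochner_Integration.integral_diff[OF i, symmetric])
      then show "norm ((LINT x|lborel. a n x * \<psi> x) - (LINT x|lborel. a0 x * \<psi> x)) \<le> (LINT x|lborel. \<bar>a n x - a0 x\<bar>) * B"
        using integrable_mult_bounded(3)[OF Bochner_Integration.integrable_diff[OF a(1)[of n] a(2)] \<psi>] by simp
    qed
    then show ?thesis by (simp add: LIM_zero_iff)
  qed
  have 1: "(\<lambda>n. LINT x|lborel. mass (?V n) x * deriv \<phi> x) \<longlonglongrightarrow> (LINT x|lborel. mass f x * deriv \<phi> x)"
    using L unfolding mass_eq_ReP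
    by (intro conv[OF _ _ _ m(2) K'] ReP_ImP_tendsto(1) lowpass_tendsto) auto
  have 2: "(\<lambda>n. LINT x|lborel. ReP (?V n) (?V1 n) x * \<phi> x) \<longlonglongrightarrow> (LINT x|lborel. ReP f (dx f) x * \<phi> x)"
    using L f by (intro conv[OF _ _ _ m(1) K] ReP_ImP_tendsto(1) lowpass_tendsto lowpass_dx_tendsto) auto
  have eq: "(LINT x|lborel. mass (?V n) x * deriv \<phi> x) = - 2 * (LINT x|lborel. ReP (?V n) (?V1 n) x * \<phi> x)" for n
  proof -
    have i: "integrable lborel (\<lambda>x. mass (?V n) x * \<phi> x)" "integrable lborel (\<lambda>x. mass (?V n) x * deriv \<phi> x)" "integrable lborel (\<lambda>x. ReP (?V n) (?V1 n) x * \<phi> x)"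
      by (rule integrable_mult_bounded(1)[OF _ m(1) K], auto) (rule integrable_mult_bounded(1)[OF _ m(2) K'], auto, rule integrable_mult_bounded(1)[OF _ m(1) K], auto)
    have "(LINT x|lborel. mass (?V n) x * deriv \<phi> x + 2 * (ReP (?V n) (?V1 n) x * \<phi> x)) = 0"
    proof (rule integral_deriv_zero[OF i(1)])
      show "integrable lborel (\<lambda>x. mass (?V n) x * deriv \<phi> x + 2 * (ReP (?V n) (?V1 n) x * \<phi> x))" using i by auto
      fix x
      have "(mass (?V n) has_vector_derivative 2 * ReP (?V n) (?V1 n) x) (at x)"
        by (rule mass_vector_derivative) (rule has_L2_deriv_imp(3)[OF lowpass_deriv(1)])
      from has_vector_derivative_mult[OF this test_function_props(1)[OF \<phi>, of x, unfolded has_real_derivative_iff_has_vector_derivative]]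
      show "((\<lambda>x. mass (?V n) x * \<phi> x) has_vector_derivative mass (?V n) x * deriv \<phi> x + 2 * (ReP (?V n) (?V1 n) x * \<phi> x)) (at x)"
        by (simp add: algebra_simps)
    qed
    then show ?thesis using i by simp
  qed
  have "(\<lambda>n. LINT x|lborel. mass (?V n) x * deriv \<phi> x) \<longlonglongrightarrow> - 2 * (LINT x|lborel. ReP f (dx f) x * \<phi> x)"
    unfolding eq by (intro tendsto_mult tendsto_const 2)
  from LIMSEQ_unique[OF 1 this]
  show "(LINT x|lborel. mass f x * deriv \<phi> x) = - (LINT x|lborel. 2 * ReP f (dx f) x * \<phi> x)"
    by (simp add: mult.assoc)
qed

lemma weak_deriv_mass:
  assumes f: "H1 f" shows "AE x in lborel. weak_deriv (\<lambda>x. (cmod (f x))\<^sup>2) x = 2 * ReP f (dx f) x"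
proof -
  have w: "has_weak_deriv (\<lambda>x. (cmod (f x))\<^sup>2) (\<lambda>x. 2 * ReP f (dx f) x)"
    using mass_weak_deriv[OF f] unfolding mass_def[abs_def] .
  then have "has_weak_deriv (\<lambda>x. (cmod (f x))\<^sup>2) (weak_deriv (\<lambda>x. (cmod (f x))\<^sup>2))"
    unfolding weak_deriv_def by (rule someI[of "has_weak_deriv (\<lambda>x. (cmod (f x))\<^sup>2)"])
  from weak_deriv_unique[OF this w] show ?thesis .
qed

section \<open>Exhausting the time interval\<close>

text \<open>Let \<open>a n\<close> and \<open>b n\<close> be the minimum and maximum of the first
  points of an enumeration of a countable dense subset of \<open>T\<close>. An interior point of
  \<open>I\<close> has points of \<open>T\<close> on both sides, since \<open>T\<close> has full
  measure, and the boundary of \<open>I\<close> is a null set.\<close>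
lemma AE_interval_exhaustion:
  fixes I T :: "real set"
  assumes I: "is_interval I" and TI: "T \<subseteq> I" and ae: "AE t in lborel. t \<in> I \<longrightarrow> t \<in> T" and ne: "T \<noteq> {}"
  shows "\<exists>a b. (\<forall>n::nat. a n \<in> T \<and> b n \<in> T \<and> a n \<le> b n \<and> a (Suc n) \<le> a n \<and> b n \<le> b (Suc n)) \<and>
     (AE t in lborel. t \<in> I \<longrightarrow> (\<exists>n. t \<in> {a n..b n}))"
proof -
  obtain D where D: "countable D" "D \<subseteq> T" "T \<subseteq> closure D" using separable[of T] by blast
  have Dne: "D \<noteq> {}" using D(3) ne by auto
  define d where "d = from_nat_into D"
  have dD: "d n \<in> D" for n unfolding d_def by (rule from_nat_into[OF Dne])
  have ds: "\<exists>n. d n = x" if "x \<in> D" for x unfolding d_def using from_nat_into_surj[OF D(1) that] by blast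
  define a where "a n = Min (d ` {..n})" for n
  define b where "b n = Max (d ` {..n})" for n
  have ab: "a n \<in> d ` {..n}" "b n \<in> d ` {..n}" for n unfolding a_def b_def by (auto intro!: Min_in Max_in)
  have le: "a n \<le> d i" "d i \<le> b n" if "i \<le> n" for i n unfolding a_def b_def using that by (auto intro!: Min_le Max_ge)
  have 1: "a n \<in> T \<and> b n \<in> T \<and> a n \<le> b n \<and> a (Suc n) \<le> a n \<and> b n \<le> b (Suc n)" for n
  proof (intro conjI)
    show "a n \<in> T" "b n \<in> T" using ab[of n] dD D(2) by auto
    show "a n \<le> b n" using le[of 0 n] by simp
    show "a (Suc n) \<le> a n" "b n \<le> b (Suc n)" unfolding a_def b_def by (auto intro!: Min_antimono Max_mono)
  qed
  have near: "\<exists>n. d n \<in> {l<..<r}" if lr: "l < r" "{l<..<r} \<subseteq> I" for l r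
  proof -
    have "{l<..<r} \<inter> T \<noteq> {}"
    proof
      assume "{l<..<r} \<inter> T = {}"
      then have "t \<notin> {l<..<r}" if "t \<in> I \<longrightarrow> t \<in> T" for t using lr(2) that by blast
      with ae have "AE t in lborel. t \<notin> {l<..<r}" by (rule eventually_mono)
      then have "emeasure lborel {l<..<r} = 0" by (subst (asm) AE_iff_measurable[of "{l<..<r}"]) auto
      then show False using lr(1) by simp
    qed
    then obtain x where "x \<in> {l<..<r}" "x \<in> closure D" using D(3) by blast
    then have "D \<inter> {l<..<r} \<noteq> {}" using open_Int_closure_eq_empty[of "{l<..<r}" D] by auto
    then show ?thesis using ds by fastforce
  qed
  have int: "\<exists>n. t \<in> {a n..b n}" if t: "t \<in> interior I" for t
  proof -
    obtain e where e: "0 < e" "ball t e \<subseteq> I" using t unfolding mem_interior by blast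
    have "{t - e<..<t} \<subseteq> I" "{t<..<t + e} \<subseteq> I" using e(2) by (auto simp: subset_iff ball_def dist_real_def)
    then obtain i j where "d i \<in> {t - e<..<t}" "d j \<in> {t<..<t + e}" using near[of "t - e" t] near[of t "t + e"] e(1) by auto
    then have "t \<in> {a (max i j)..b (max i j)}" using le[of i "max i j"] le[of j "max i j"] by auto
    then show ?thesis by blast
  qed
  have "negligible (frontier I)" by (rule negligible_convex_frontier[OF is_interval_convex[OF I]])
  then have "AE t in lebesgue. t \<notin> frontier I" unfolding negligible_iff_null_sets by (rule AE_not_in)
  then have "AE t in lborel. t \<notin> frontier I" by (simp add: AE_completion_iff)
  then have "AE t in lborel. t \<in> I \<longrightarrow> (\<exists>n. t \<in> {a n..b n})"
  proof (rule eventually_mono)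
    fix t assume "t \<notin> frontier I"
    then show "t \<in> I \<longrightarrow> (\<exists>n. t \<in> {a n..b n})" using int closure_subset[of I] unfolding frontier_def by blast
  qed
  then show ?thesis using 1 by blast
qed

text \<open>An essential supremum bounds a function at almost every time only, so the estimate on
  subintervals is assumed just for end points in a set \<open>T\<close> of full measure.\<close>
lemma nn_integral_interval_bound:
  fixes f :: "real \<Rightarrow> real"
  assumes I: "is_interval I" and TI: "T \<subseteq> I" and ae: "AE t in lborel. t \<in> I \<longrightarrow> t \<in> T"
    and f0: "\<And>t. t \<in> I \<Longrightarrow> 0 \<le> f t"
    and est: "\<And>a b. a \<in> T \<Longrightarrow> b \<in> T \<Longrightarrow> a \<le> b \<Longrightarrow> \<exists>J. (f has_integral J) {a..b} \<and> ennreal J \<le> K"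
  shows "(\<integral>\<^sup>+t. ennreal (f t) \<partial>restrict_space lborel I) \<le> K"
proof -
  have IM: "I \<inter> space lborel \<in> sets lborel" using I by (simp add: real_interval_borel_measurable)
  have eq: "(\<integral>\<^sup>+t. ennreal (f t) \<partial>restrict_space lborel I) = (\<integral>\<^sup>+t. ennreal (f t) * indicator I t \<partial>lborel)"
    by (rule nn_integral_restrict_space[OF IM])
  show ?thesis
  proof (cases "T = {}")
    case True
    then have "(\<integral>\<^sup>+t. ennreal (f t) * indicator I t \<partial>lborel) = (\<integral>\<^sup>+t. 0 \<partial>(lborel::real measure))"
      by (intro nn_integral_cong_AE eventually_mono[OF ae]) simp
    then show ?thesis unfolding eq by simp
  next
    case False
    obtain a b where ab: "\<And>n::nat. a n \<in> T \<and> b n \<in> T \<and> a n \<le> b n \<and> a (Suc n) \<le> a n \<and> b n \<le> b (Suc n)"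
      "AE t in lborel. t \<in> I \<longrightarrow> (\<exists>n. t \<in> {a n..b n})"
      using AE_interval_exhaustion[OF I TI ae False] by blast
    define g where "g n t = ennreal (indicator {a n..b n} t * f t)" for n t
    have sub: "{a n..b n} \<subseteq> I" for n
    proof
      fix t assume t: "t \<in> {a n..b n}"
      have "a n \<in> I" "b n \<in> I" using ab(1)[of n] TI by blast+
      from mem_is_interval_1_I[OF I this] t show "t \<in> I" by simp
    qed
    have gm: "g n \<in> borel_measurable lebesgue" and gi: "(\<integral>\<^sup>+t. g n t \<partial>lborel) \<le> K" for n
    proof -
      obtain J where J: "(f has_integral J) {a n..b n}" "ennreal J \<le> K" using est[of "a n" "b n"] ab(1)[of n] by blast
      have "(\<lambda>t. indicator {a n..b n} t *\<^sub>R f t) \<in> lebesgue \<rightarrow>\<^sub>M borel" by (rule has_integral_implies_lebesgue_measurable[OF J(1)])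
      then show "g n \<in> borel_measurable lebesgue" unfolding g_def[abs_def] by simp
      have "(\<integral>\<^sup>+t. g n t \<partial>lborel) = ennreal J" unfolding g_def
        by (rule nn_integral_has_integral_lebesgue[OF f0 J(1)]) (use sub in blast)
      then show "(\<integral>\<^sup>+t. g n t \<partial>lborel) \<le> K" using J(2) by simp
    qed
    have inc: "incseq g"
    proof (rule incseq_SucI, rule le_funI)
      fix n t
      show "g n t \<le> g (Suc n) t"
        using ab(1)[of n] f0[of t] sub[of "Suc n"] unfolding g_def by (auto simp: indicator_def intro!: ennreal_leI)
    qed
    have "(\<integral>\<^sup>+t. ennreal (f t) * indicator I t \<partial>lborel) \<le> (\<integral>\<^sup>+t. (SUP n. g n t) \<partial>lborel)"
    proof (intro nn_integral_mono_AE eventually_mono[OF ab(2)])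
      fix t assume *: "t \<in> I \<longrightarrow> (\<exists>n. t \<in> {a n..b n})"
      show "ennreal (f t) * indicator I t \<le> (SUP n. g n t)"
      proof (cases "t \<in> I")
        case True
        then obtain n where "t \<in> {a n..b n}" using * by blast
        then have "ennreal (f t) * indicator I t = g n t" using True by (simp add: g_def)
        also have "\<dots> \<le> (SUP n. g n t)" by (rule SUP_upper) simp
        finally show ?thesis .
      qed simp
    qed
    also have "\<dots> = (\<integral>\<^sup>+t. (SUP n. g n t) \<partial>lebesgue)" by (simp add: nn_integral_completion)
    also have "\<dots> = (SUP n. \<integral>\<^sup>+t. g n t \<partial>lebesgue)" by (rule nn_integral_monotone_convergence_SUP[OF inc gm])
    also have "\<dots> \<le> K" using gi by (intro SUP_least) (simp add: nn_integral_completion)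
    finally show ?thesis unfolding eq .
  qed
qed

section \<open>Space-time norms\<close>

lemma epowr_mono: "x \<le> y \<Longrightarrow> 0 \<le> a \<Longrightarrow> x epowr a \<le> y epowr a"
  unfolding ennreal_pow_def
  by (auto simp: top_unique less_top intro!: ennreal_leI powr_mono2 enn2real_mono)

lemma epowr_inverse: "0 < q \<Longrightarrow> (x epowr (1 / q)) epowr q = x"
  by (cases x) (auto simp: ennreal_pow_def powr_powr)

text \<open>The cases with an infinite factor have to be checked against \<open>0 * \<infinity> =
  0\<close>.\<close>
lemma epowr_half_product: "(A ^ 3 * B) epowr (1 / 2) = B epowr (1 / 2) * A epowr (3 / 2)"
proof (cases A)
  case (real r)
  note A = this
  show ?thesis
  proof (cases B)
    case (real s)
    have "(r ^ 3 * s) powr (1 / 2) = s powr (1 / 2) * r powr (3 / 2)"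
    proof -
      have "r ^ 3 = r powr 3" if "r \<noteq> 0" using A that by (simp add: powr_numeral)
      then have "(r ^ 3) powr (1 / 2) = r powr (3 / 2)" by (cases "r = 0") (auto simp: powr_powr)
      then show ?thesis using A real by (simp add: powr_mult)
    qed
    then show ?thesis using A real
      by (simp add: ennreal_power ennreal_mult[symmetric] ennreal_epowr)
  next
    case top
    then show ?thesis using A by (cases "r = 0") (auto simp: ennreal_pow_def ennreal_power ennreal_mult_top ennreal_top_mult)
  qed
next
  case top
  show ?thesis
  proof (cases "B = 0")
    case True then show ?thesis by (simp add: ennreal_pow_def)
  next
    case False
    then have "B epowr (1 / 2) \<noteq> 0" by (cases B) (auto simp: ennreal_pow_def)
    then show ?thesis using top False by (simp add: ennreal_pow_def ennreal_mult_top power3_eq_cube)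
  qed
qed

text \<open>Almost every time may serve as an end point in \<open>virial_estimate\<close>, because
  there the norms of \<open>u\<close> are bounded by their essential suprema. The two end points
  account for the factor 2 that \<open>k / 2\<close> cancels.\<close>
lemma virial_space_time_bound:
  assumes p: "1 < p" and I: "is_interval I" and sol: "H1_solution p I u" and k: "0 \<le> k"
  shows "(\<integral>\<^sup>+t. ennreal (k / 2 * virial_density p (u t)) \<partial>restrict_space lborel I) \<le> 
    ennreal k * (mixed_norm \<infinity> 2 I u ^ 3 * Lt_norm \<infinity> I (\<lambda>t. Hdot_norm 1 (u t)))"
proof -
  have u: "C_H1 I u" using sol by (simp add: H1_solution_def)
  have H: "H1 (u t)" if "t \<in> I" for t using C_H1_imp(1)[OF u that] .
  let ?A = "mixed_norm \<infinity> 2 I u" and ?B = "Lt_norm \<infinity> I (\<lambda>t. Hdot_norm 1 (u t))"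
  let ?T = "{t \<in> I. ennreal (nrm (u t)) \<le> ?A \<and> ennreal (Hdot1_nrm (u t)) \<le> ?B}"
  have IM: "I \<inter> space lborel \<in> sets lborel" using I by (simp add: real_interval_borel_measurable)
  have A: "AE t in restrict_space lborel I. Lx_norm 2 (u t) \<le> ?A"
    unfolding mixed_norm_def Lt_norm_def Lp_norm_def by (simp add: esssup_AE)
  have B: "AE t in restrict_space lborel I. Hdot_norm 1 (u t) \<le> ?B"
    unfolding Lt_norm_def Lp_norm_def by (simp add: esssup_AE)
  have ae: "AE t in lborel. t \<in> I \<longrightarrow> t \<in> ?T"
    using A B unfolding AE_restrict_space_iff[OF IM]
    by eventually_elim (use H in \<open>auto simp: Lx_norm_L2 H1_L2 Hdot_norm_eq\<close>)
  have c0: "0 \<le> 2 * (p - 1) / (p + 1)" using p by simp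
  have v0: "0 \<le> virial_density p f" for f
    unfolding virial_density_def using c0 by (intro add_nonneg_nonneg mult_nonneg_nonneg) auto
  show ?thesis
  proof (rule nn_integral_interval_bound[OF I _ ae])
    show "?T \<subseteq> I" by blast
    show "0 \<le> k / 2 * virial_density p (u t)" for t using k v0 by simp
    fix a b assume ab: "a \<in> ?T" "b \<in> ?T" "a \<le> b"
    obtain J where J: "((\<lambda>t. virial_density p (u t)) has_integral J) {a..b}" "J \<le> (nrm (u a))^3 * Hdot1_nrm (u a) + (nrm (u b))^3 * Hdot1_nrm (u b)"
      using virial_estimate[OF p sol I _ _ ab(3)] ab by blast
    have one: "ennreal ((nrm (u t))^3 * Hdot1_nrm (u t)) \<le> ?A ^ 3 * ?B" if "t \<in> ?T" for t
    proof -
      have h: "0 \<le> Hdot1_nrm (u t)" by (simp add: Hdot1_nrm_def)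
      then have "ennreal ((nrm (u t))^3 * Hdot1_nrm (u t)) = ennreal (nrm (u t)) ^ 3 * ennreal (Hdot1_nrm (u t))"
        by (simp add: ennreal_mult ennreal_power)
      also have "\<dots> \<le> ?A ^ 3 * ?B" using that by (intro mult_mono power_mono) auto
      finally show ?thesis .
    qed
    have h: "0 \<le> Hdot1_nrm f" for f by (simp add: Hdot1_nrm_def)
    have "ennreal (k / 2 * J) \<le> ennreal (k / 2 * ((nrm (u a))^3 * Hdot1_nrm (u a) + (nrm (u b))^3 * Hdot1_nrm (u b)))"
      using J(2) k by (intro ennreal_leI mult_left_mono) auto
    also have "\<dots> = ennreal (k / 2) * (ennreal ((nrm (u a))^3 * Hdot1_nrm (u a)) + ennreal ((nrm (u b))^3 * Hdot1_nrm (u b)))"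
    proof -
      have "ennreal (k / 2 * (x + y)) = ennreal (k / 2) * (ennreal x + ennreal y)" if "0 \<le> x" "0 \<le> y" for x y
        using k that by (simp only: ennreal_plus[symmetric] ennreal_mult add_nonneg_nonneg divide_nonneg_nonneg zero_le_numeral)
      then show ?thesis using h by simp
    qed
    also have "\<dots> \<le> ennreal (k / 2) * (?A ^ 3 * ?B + ?A ^ 3 * ?B)" using ab by (intro mult_left_mono add_mono one) auto
    also have "\<dots> = ennreal (k / 2) * (ennreal 2 * (?A ^ 3 * ?B))" by (simp add: mult_2)
    also have "\<dots> = ennreal k * (?A ^ 3 * ?B)"
    proof -
      have "ennreal (k / 2) * ennreal 2 = ennreal k" using k by (subst ennreal_mult[symmetric]) auto
      then show ?thesis by (simp only: mult.assoc[symmetric])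
    qed
    finally have "ennreal (k / 2 * J) \<le> ennreal k * (?A ^ 3 * ?B)" .
    moreover have "((\<lambda>t. k / 2 * virial_density p (u t)) has_integral (k / 2 * J)) {a..b}"
      by (rule has_integral_mult_right[OF J(1)])
    ultimately show "\<exists>J. ((\<lambda>t. k / 2 * virial_density p (u t)) has_integral J) {a..b} \<and> ennreal J \<le> ennreal k * (?A ^ 3 * ?B)" by blast
  qed
qed

lemma weak_deriv_norm_bound:
  assumes p: "1 < p" and f: "H1 f"
  shows "Lx_norm 2 (weak_deriv (\<lambda>x. (cmod (f x))\<^sup>2)) epowr 2 \<le> ennreal (1 / 2 * virial_density p f)"
proof -
  have c0: "0 \<le> 2 * (p - 1) / (p + 1)" using p by simp
  have L: "(\<lambda>x. complex_of_real (ReP f (dx f) x)) \<in> L2" by (rule ReP_lowpass_tendsto(2)[OF f])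
  have i: "integrable lborel (\<lambda>x. 4 * (ReP f (dx f) x)\<^sup>2)" using L2_integrable[OF L] by simp
  have "Lx_norm 2 (weak_deriv (\<lambda>x. (cmod (f x))\<^sup>2)) epowr 2 = (\<integral>\<^sup>+x. ennreal ((weak_deriv (\<lambda>x. (cmod (f x))\<^sup>2) x)\<^sup>2) \<partial>lborel)"
    using epowr_inverse[of 2] by (simp add: Lx_norm_def Lp_norm_def ennreal_epowr_2 enn2real_numeral)
  also have "\<dots> = (\<integral>\<^sup>+x. ennreal (4 * (ReP f (dx f) x)\<^sup>2) \<partial>lborel)"
    by (intro nn_integral_cong_AE eventually_mono[OF weak_deriv_mass[OF f]]) (simp add: power_mult_distrib)
  also have "\<dots> = ennreal (4 * (LINT x|lborel. (ReP f (dx f) x)\<^sup>2))" using i by (simp add: nn_integral_eq_integral)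
  also have "\<dots> \<le> ennreal (1 / 2 * virial_density p f)"
  proof (rule ennreal_leI)
    have "0 \<le> 2 * (p - 1) / (p + 1) * (LINT x|lborel. cmod (f x) powr (p + 3))" using c0 by (intro mult_nonneg_nonneg) auto
    moreover have "4 * a \<le> 1 / 2 * (8 * a + y)" if "0 \<le> y" for a y :: real using that by (simp add: field_simps)
    ultimately show "4 * (LINT x|lborel. (ReP f (dx f) x)\<^sup>2) \<le> 1 / 2 * virial_density p f" unfolding virial_density_def by blast
  qed
  finally show ?thesis .
qed

lemma potential_norm_bound:
  assumes p: "1 < p" and f: "H1 f"
  shows "Lx_norm (ennreal (p + 3)) f epowr (p + 3) \<le> ennreal ((p + 1) / (p - 1) / 2 * virial_density p f)"
proof -
  have "Lx_norm (ennreal (p + 3)) f epowr (p + 3) = (\<integral>\<^sup>+x. ennreal (cmod (f x) powr (p + 3)) \<partial>lborel)"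
    using p epowr_inverse[of "p + 3"] by (simp add: Lx_norm_def Lp_norm_def ennreal_epowr del: ennreal_plus)
  also have "\<dots> = ennreal (LINT x|lborel. cmod (f x) powr (p + 3))"
    using potential_lowpass_tendsto(2)[OF p f] by (simp add: nn_integral_eq_integral)
  also have "\<dots> \<le> ennreal ((p + 1) / (p - 1) / 2 * virial_density p f)"
  proof (rule ennreal_leI)
    have "(p + 1) / (p - 1) / 2 * virial_density p f = (p + 1) / (p - 1) / 2 * (8 * (LINT x|lborel. (ReP f (dx f) x)\<^sup>2)) 
      + (LINT x|lborel. cmod (f x) powr (p + 3))"
    proof -
      have c: "(p + 1) / (p - 1) / 2 * (2 * (p - 1) / (p + 1)) = 1" using p by simp
      have gen: "x * (y + z * w) = x * y + w" if "x * z = 1" for x y z w :: real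
        using that by (simp add: distrib_left mult.assoc[symmetric])
      show ?thesis unfolding virial_density_def by (rule gen[OF c])
    qed
    moreover have "0 \<le> (p + 1) / (p - 1) / 2 * (8 * (LINT x|lborel. (ReP f (dx f) x)\<^sup>2))" using p by (intro mult_nonneg_nonneg) auto
    ultimately show "(LINT x|lborel. cmod (f x) powr (p + 3)) \<le> (p + 1) / (p - 1) / 2 * virial_density p f" by linarith
  qed
  finally show ?thesis .
qed

theorem theorem1p2:
  fixes p :: real
  assumes "p > 1"
  shows "\<exists>C::real. \<forall>(I::real set) (u::real \<Rightarrow> real \<Rightarrow> complex).
    is_interval I \<longrightarrow> H1_solution p I u \<longrightarrow>
      mixed_norm 2 2 I (\<lambda>t. weak_deriv (\<lambda>x. (cmod (u t x))\<^sup>2))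
        \<le> ennreal C * (Lt_norm \<infinity> I (\<lambda>t. Hdot_norm 1 (u t)) epowr (1/2))
            * (mixed_norm \<infinity> 2 I u epowr (3/2)) \<and>
      mixed_norm (ennreal (p + 3)) (ennreal (p + 3)) I u epowr (p + 3)
        \<le> ennreal C * mixed_norm \<infinity> 2 I u ^ 3 * Lt_norm \<infinity> I (\<lambda>t. Hdot_norm 1 (u t))"
proof -
  \<comment> \<open>\<open>k / 2\<close> is the inverse of the coefficient of the potential
    energy in \<open>virial_density\<close>\<close>
  define k where "k = (p + 1) / (p - 1)"
  have k: "0 \<le> k" using assms by (simp add: k_def)
  show ?thesis
  proof (intro exI[of _ "1 + k"] allI impI conjI)
    fix I :: "real set" and u :: "real \<Rightarrow> real \<Rightarrow> complex"
    assume I: "is_interval I" and sol: "H1_solution p I u"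
    let ?A = "mixed_norm \<infinity> 2 I u" and ?B = "Lt_norm \<infinity> I (\<lambda>t. Hdot_norm 1 (u t))"
    let ?R = "restrict_space lborel I"
    have H: "H1 (u t)" if "t \<in> I" for t using C_H1_imp(1)[of I u t] sol that by (simp add: H1_solution_def)
    have sp: "t \<in> I" if "t \<in> space ?R" for t using that by (simp add: space_restrict_space)
    let ?w = "\<lambda>t. weak_deriv (\<lambda>x. (cmod (u t x))\<^sup>2)"
    have "(\<integral>\<^sup>+t. Lx_norm 2 (?w t) epowr 2 \<partial>?R) \<le> (\<integral>\<^sup>+t. ennreal (1 / 2 * virial_density p (u t)) \<partial>?R)"
      by (intro nn_integral_mono weak_deriv_norm_bound assms H sp)
    also have "\<dots> \<le> ennreal 1 * (?A ^ 3 * ?B)" by (rule virial_space_time_bound[OF assms I sol]) simp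
    finally have "mixed_norm 2 2 I ?w \<le> (?A ^ 3 * ?B) epowr (1 / 2)"
      unfolding mixed_norm_def Lt_norm_def Lp_norm_def by (simp add: enn2real_numeral epowr_mono)
    also have "\<dots> = 1 * (?B epowr (1 / 2) * ?A epowr (3 / 2))" by (simp add: epowr_half_product)
    also have "\<dots> \<le> ennreal (1 + k) * (?B epowr (1 / 2) * ?A epowr (3 / 2))"
      using k by (intro mult_right_mono) auto
    finally show "mixed_norm 2 2 I ?w \<le> ennreal (1 + k) * (?B epowr (1 / 2)) * (?A epowr (3 / 2))"
      by (simp add: mult.assoc)
    have "mixed_norm (ennreal (p + 3)) (ennreal (p + 3)) I u epowr (p + 3) = (\<integral>\<^sup>+t. Lx_norm (ennreal (p + 3)) (u t) epowr (p + 3) \<partial>?R)"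
      using assms epowr_inverse[of "p + 3"] unfolding mixed_norm_def Lt_norm_def Lp_norm_def by (simp del: ennreal_plus)
    also have "\<dots> \<le> (\<integral>\<^sup>+t. ennreal (k / 2 * virial_density p (u t)) \<partial>?R)"
      unfolding k_def by (intro nn_integral_mono potential_norm_bound assms H sp)
    also have "\<dots> \<le> ennreal k * (?A ^ 3 * ?B)" by (rule virial_space_time_bound[OF assms I sol k])
    also have "\<dots> \<le> ennreal (1 + k) * (?A ^ 3 * ?B)" by (intro mult_right_mono ennreal_leI) auto
    finally show "mixed_norm (ennreal (p + 3)) (ennreal (p + 3)) I u epowr (p + 3) \<le> ennreal (1 + k) * ?A ^ 3 * ?B"
      by (simp add: mult.assoc)
  qed
qed

end
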